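(* Let $n\ge 2$ and consider the piecewise smooth system $\dot{\mathbf x}=f(\mathbf x)+\varepsilon g(\mathbf x)$ described in the context, satisfying assumptions (A1), (A2), (A3) stated there. Then its first order Melnikov vector function $M(h)=F(h,0)$, $h\in G$, is $$\begin{aligned} M(h)=&\int_{\widehat{AB}}D\mathbf{H}^1(\mathbf{x})g^1(\mathbf{x})\,dt\\ &+\overline{D\mathbf{H}^1(A)}\Big[\overline{D\mathbf{H}^4(A)}\Big]^{-1}\underline{D\mathbf{H}^4(E)}\Big[\underline{D\mathbf{H}^3(E)}\Big]^{-1}\overline{D\mathbf{H}^3(C)}\Big[\overline{D\mathbf{H}^2(C)}\Big]^{-1}\int_{\widehat{BC}}D\mathbf{H}^2(\mathbf{x})g^2(\mathbf{x})\,dt\\ &+\overline{D\mathbf{H}^1(A)}\Big[\overline{D\mathbf{H}^4(A)}\Big]^{-1}\underline{D\mathbf{H}^4(E)}\Big[\underline{D\mathbf{H}^3(E)}\Big]^{-1}\int_{\widehat{CE}}D\mathbf{H}^3(\mathbf{x})g^3(\mathbf{x})\,dt\\ &+\overline{D\mathbf{H}^1(A)}\Big[\overline{D\mathbf{H}^4(A)}\Big]^{-1}\int_{\widehat{EA}}D\mathbf{H}^4(\mathbf{x})g^4(\mathbf{x})\,dt, \end{aligned}$$ where $A=A(h)$, $B=B(h)$, $C=C(h)$, $E=E(h)$. Further, if $M(h_0)=0$ and $\det DM(h_0)\neq 0$ for some $h_0\in G$, then for all sufficiently small $\varepsilon>0$ the system $\dot{\mathbf x}=f(\mathbf x)+\varepsilon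 g(\mathbf x)$ has a unique periodic orbit near $L_{h_0}$.
   Context: **System.** $\mathbf x=(x_1,\dots,x_n)^T\in\mathbb R^n$, $n\ge2$, $0\le\varepsilon\ll1$, and for $k=1,2,3,4$ the vector functions $f^k,g^k$ are $C^\infty$. The system $\dot{\mathbf x}=f(\mathbf x)+\varepsilon g(\mathbf x)$ has $(f,g)=(f^1,g^1)$ for $x_1\ge0,x_2\ge0$; $(f,g)=(f^2,g^2)$ for $x_1>0,x_2<0$; $(f,g)=(f^3,g^3)$ for $x_1<0,x_2<0$; $(f,g)=(f^4,g^4)$ for $x_1<0,x_2>0$. The system $\dot{\mathbf x}=f^k(\mathbf x)+\varepsilon g^k(\mathbf x)$ is called the $k$-th subsystem. The switching planes are $x_1=0$ and $x_2=0$. **(A1)** $U\subset\mathbb R^n$ is an open set with $U\cap\{x_1=0,x_2=0\}\ne\emptyset$. Put $U^1=\{\mathbf x\in U: x_1\ge0,x_2\ge0\}$, $U^2=\{\mathbf x\in U:x_1>0,x_2<0\}$, $U^3=\{\mathbf x\in U:x_1<0,x_2<0\}$, $U^4=\{\mathbf x\in U:x_1<0,x_2>0\}$. For each $k=1,2,3,4$ the $k$-th subsystem with $\varepsilon=0$ has $n-1$ different $C^\infty$ first integrals $H^k_1,\dots,H^k_{n-1}$ (defined and $C^\infty$ also at the boundary points at which they are evaluated below) whose gradients $DH^k_1(\mathbf x),\dots,DH^k_{n-1}(\mathbf x)$ are linearly independent for each $\mathbf x\in U^k$. **(A2)** Let $\mathbf H^k=(H^k_1,\dots,H^k_{n-1})^T$.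 There is an open set $G\subset\mathbb R^{n-1}$ such that for each $h=(h_1,\dots,h_{n-1})^T\in G$ the curves $L^1_h=\{\mathbf x\in U^1:\mathbf H^1(\mathbf x)=h\}$, $L^2_h=\{\mathbf x\in U^2:\mathbf H^2(\mathbf x)=\mathbf H^2(B(h))\}$, $L^3_h=\{\mathbf x\in U^3:\mathbf H^3(\mathbf x)=\mathbf H^3(C(h))\}$, $L^4_h=\{\mathbf x\in U^4:\mathbf H^4(\mathbf x)=\mathbf H^4(E(h))\}$ contain no critical point of the system with $\varepsilon=0$ and have four different end points in $U$ of the form $A(h)=(0,a_2(h),\dots,a_n(h))^T$, $B(h)=(b_1(h),0,b_3(h),\dots,b_n(h))^T$, $C(h)=(0,c_2(h),\dots,c_n(h))^T$, $E(h)=(e_1(h),0,e_3(h),\dots,e_n(h))^T$. For $\varepsilon=0$ the first subsystem has orbital arc $L^1_h=\widehat{AB}$ starting from $A(h)$ and ending at $B(h)$, the second has orbital arc $L^2_h=\widehat{BC}$ from $B(h)$ to $C(h)$, the third has orbital arc $L^3_h=\widehat{CE}$ from $C(h)$ to $E(h)$, and the fourth has orbital arc $L^4_h=\widehat{EA}$ from $E(h)$ to $A(h)$. Thus $L_h=L^1_h\cup L^2_h\cup L^3_h\cup L^4_h$ is a periodic orbit of the system with $\varepsilon=0$ surrounding the origin. **(A3)** The curves $L^k_h$ ($h\in G$, $k=1,2,3,4$) are not tangent to $x_1=0$ at $A(h),C(h)$, nor to $x_2=0$ at $B(h),E(h)$; that is, for $h\in G$ and $k=1,2,3,4$, $\det\frac{\partial(H^k_1,\dots,H^k_{n-1})}{\partial(x_2,x_3,\dots,x_n)}\ne0$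 at $A(h)$ and $C(h)$, and $\det\frac{\partial(H^k_1,\dots,H^k_{n-1})}{\partial(x_1,x_3,\dots,x_n)}\ne0$ at $B(h)$ and $E(h)$. **Melnikov function.** For small $\varepsilon\geq 0$, let $B_\varepsilon(h)$ be the first intersection point with $x_2=0$ of the orbit of the first subsystem starting from $A(h)$; $C_\varepsilon(h)$ the first intersection point with $x_1=0$ of the orbit of the second subsystem starting from $B_\varepsilon(h)$; $E_\varepsilon(h)$ the first intersection point with $x_2=0$ of the orbit of the third subsystem starting from $C_\varepsilon(h)$; $A_\varepsilon(h)$ the first intersection point with $x_1=0$ of the orbit of the fourth subsystem starting from $E_\varepsilon(h)$. These are smooth in $\varepsilon$, and $A_0(h)=A(h)$. The function $F$ is defined by $\mathbf H^1(A_\varepsilon(h))-\mathbf H^1(A(h))=\varepsilon F(h,\varepsilon)$ (it is $C^\infty$, including at $\varepsilon=0$), and $M(h)=F(h,0)$ is the first order Melnikov vector function. **Notation.** $D\mathbf H^k$ is the $(n-1)\times n$ Jacobian matrix. For a matrix $\Phi$, $\overline\Phi$ is $\Phi$ with its first column removed and $\underline\Phi$ is $\Phi$ with its second column removed. The integrals with respect to $dt$ are taken along the unperturbed ($\varepsilon=0$) orbital arcs, $t$ being the time of the corresponding unperturbed subsystem. A periodic orbit near $L_{h_0}$ means one through a point $A(h)$ with $h$ near $h_0$ that closes after one turn, $A_\varepsilon(h)=A(h)$; equivalently, it corresponds to a zero $h$ near $h_0$ of $F(\cdot,\varepsilon)$. *)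

theory Defs
  imports "HOL-Analysis.Analysis"
begin

text \<open>
  \<open>Ck_on k f S\<close> is meant for open \<open>S\<close>. The set \<open>S\<close> in \<open>smooth_on\<close> is arbitrary: a function is
  smooth on \<open>S\<close> if it agrees on \<open>S\<close> with a \<open>C\<^sup>\<infinity>\<close> function on an open neighbourhood of \<open>S\<close>; in
  particular this covers the one-sided domain \<open>\<epsilon> \<ge> 0\<close>.
\<close>

primrec Ck_on :: "nat \<Rightarrow> ('a::euclidean_space \<Rightarrow> 'b::real_normed_vector) \<Rightarrow> 'a set \<Rightarrow> bool" where
  "Ck_on 0 f S \<longleftrightarrow> continuous_on S f"
| "Ck_on (Suc k) f S \<longleftrightarrow>
     (\<forall>x\<in>S. f differentiable (at x)) \<and>
     (\<forall>v\<in>Basis. Ck_on k (\<lambda>x. frechet_derivative f (at x) v) S)"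

definition smooth_on :: "'a set \<Rightarrow> ('a::euclidean_space \<Rightarrow> 'b::real_normed_vector) \<Rightarrow> bool" where
  "smooth_on S f \<longleftrightarrow>
     (\<exists>W F. open W \<and> S \<subseteq> W \<and> (\<forall>k. Ck_on k F W) \<and> (\<forall>x\<in>S. F x = f x))"

text \<open>
  For a finite type \<open>'m\<close> with \<open>n - 1\<close> elements, \<open>\<real>\<^sup>n\<close> is \<open>real ^ ('m option)\<close>; since types are
  nonempty this gives exactly the dimensions \<open>n \<ge> 2\<close>. The coordinate \<open>x\<^sub>1\<close> has index \<open>None\<close>, the
  coordinates \<open>x\<^sub>2, \<dots>, x\<^sub>n\<close> have the indices \<open>Some j\<close>, and \<open>p :: 'm\<close> is the label for which
  \<open>Some p\<close> is the index of \<open>x\<^sub>2\<close>. The labels \<open>'m\<close> also index the \<open>n - 1\<close> first integrals.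
\<close>

text \<open>Only the indices \<open>k \<in> {1..4}\<close> are meaningful, here and below.\<close>

definition region :: "'m::finite \<Rightarrow> nat \<Rightarrow> (real ^ ('m option)) set" where
  "region p k =
    (if k = 1 then {x. x $ None \<ge> 0 \<and> x $ Some p \<ge> 0}
     else if k = 2 then {x. x $ None > 0 \<and> x $ Some p < 0}
     else if k = 3 then {x. x $ None < 0 \<and> x $ Some p < 0}
     else {x. x $ None < 0 \<and> x $ Some p > 0})"

text \<open>
  The matrix with its first column removed (columns \<open>2, 3, \<dots>, n\<close>) and the matrix with its second
  column removed (columns \<open>1, 3, \<dots>, n\<close>, so that column \<open>1\<close> takes the place \<open>p\<close> of column \<open>2\<close>).
\<close>

definition drop_col1 :: "real ^ ('m option) ^ 'm \<Rightarrow> real ^ 'm ^ ('m::finite)" where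
  "drop_col1 \<Phi> = (\<chi> i j. \<Phi> $ i $ Some j)"

definition drop_col2 :: "'m \<Rightarrow> real ^ ('m option) ^ 'm \<Rightarrow> real ^ 'm ^ ('m::finite)" where
  "drop_col2 p \<Phi> = (\<chi> i j. \<Phi> $ i $ (if j = p then None else Some j))"

definition solves :: "('a::real_normed_vector \<Rightarrow> 'a) \<Rightarrow> (real \<Rightarrow> 'a) \<Rightarrow> real set \<Rightarrow> bool" where
  "solves X \<gamma> I \<longleftrightarrow> (\<forall>t\<in>I. (\<gamma> has_vector_derivative X (\<gamma> t)) (at t within I))"

definition subsystem ::
  "(nat \<Rightarrow> 'a \<Rightarrow> 'a) \<Rightarrow> (nat \<Rightarrow> 'a \<Rightarrow> 'a) \<Rightarrow> real \<Rightarrow> nat \<Rightarrow> 'a::real_vector \<Rightarrow> 'a" where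
  "subsystem f g \<epsilon> k x = f k x + \<epsilon> *\<^sub>R g k x"

text \<open>
  The curve \<open>L\<close> is the orbital arc of \<open>X\<close> from \<open>P\<close> to \<open>Q\<close>, parametrised by the time of \<open>X\<close>. The end
  points are inserted because they lie on the switching planes and hence outside the regions
  2, 3 and 4, in which \<open>L\<close> is a level set.
\<close>

definition orbital_arc ::
  "('a::real_normed_vector \<Rightarrow> 'a) \<Rightarrow> 'a \<Rightarrow> 'a \<Rightarrow> 'a set \<Rightarrow> real \<Rightarrow> (real \<Rightarrow> 'a) \<Rightarrow> bool" where
  "orbital_arc X P Q L T \<gamma> \<longleftrightarrow>
     0 < T \<and> solves X \<gamma> {0..T} \<and> inj_on \<gamma> {0..T} \<and> \<gamma> 0 = P \<and> \<gamma> T = Q \<and>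
     \<gamma> ` {0..T} = insert P (insert Q L)"

definition first_intersection ::
  "(real ^ 'n \<Rightarrow> real ^ 'n) \<Rightarrow> 'n::finite \<Rightarrow> real ^ 'n \<Rightarrow> real ^ 'n \<Rightarrow> bool" where
  "first_intersection X i P Q \<longleftrightarrow>
     (\<exists>T \<gamma>. 0 < T \<and> solves X \<gamma> {0..T} \<and> \<gamma> 0 = P \<and> \<gamma> T = Q \<and> Q $ i = 0 \<and>
        (\<forall>t\<in>{0<..<T}. \<gamma> t $ i \<noteq> 0))"

text \<open>
  The piecewise smooth system has a closed orbit through \<open>P\<close> that runs once through the regions
  1, 2, 3, 4, in this order, switching at the times \<open>s 1\<close>, \<open>s 2\<close>, \<open>s 3\<close>, \<open>s 4\<close>.
\<close>

definition closed_orbit_through ::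
  "'m::finite \<Rightarrow> (nat \<Rightarrow> real ^ ('m option) \<Rightarrow> real ^ ('m option)) \<Rightarrow>
   (nat \<Rightarrow> real ^ ('m option) \<Rightarrow> real ^ ('m option)) \<Rightarrow> real \<Rightarrow> real ^ ('m option) \<Rightarrow> bool" where
  "closed_orbit_through p f g \<epsilon> P \<longleftrightarrow>
     (\<exists>\<gamma> s. s 0 = 0 \<and> \<gamma> 0 = P \<and> \<gamma> (s 4) = P \<and>
        (\<forall>k\<in>{1..4}. s (k - 1) < s k \<and>
           solves (subsystem f g \<epsilon> k) \<gamma> {s (k - 1)..s k} \<and>
           \<gamma> ` {s (k - 1)<..<s k} \<subseteq> region p k))"

end

theory Submission
  imports Defs
begin

text \<open>
  Only the first integrals \<open>H\<^sup>k\<close> are followed along the perturbed orbit: on the \<open>k\<close>-th leg \<open>H\<^sup>k\<close>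
  changes by \<open>\<epsilon>\<close> times an integral that tends to that of \<open>DH\<^sup>k g\<^sup>k\<close> over the unperturbed arc. On a
  switching plane, by (A3), a first order displacement measured by \<open>H\<^sup>k\<close> determines the displacement
  in space and hence the one measured by \<open>H\<^sup>k\<^sup>+\<^sup>1\<close>; this produces the products of matrices. The
  orbit closes iff \<open>H\<^sup>1\<close> returns to its value, that is iff \<open>F(h,\<epsilon>) = 0\<close>, and the inverse function
  theorem for \<open>(h,\<epsilon>) \<mapsto> (F(h,\<epsilon>),\<epsilon>)\<close> gives the unique zero near \<open>h\<^sub>0\<close>.

  Neither the continuity of the end points \<open>A(h), \<dots>, E(h)\<close> in \<open>h\<close> nor the fact that the first arc
  does not touch the boundary of its closed region from inside is assumed. Both follow since the
  arcs are the full level sets for all \<open>h\<close> in the open set \<open>G\<close>.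
\<close>

subsection \<open>Continuously differentiable maps\<close>

text \<open>A difference such as that between a perturbed point and \<open>C (h' \<epsilon>)\<close>
  has two moving ends, so a derivative at one fixed point is too weak. The derivative is used in its
  strict form: the linearisation error is small relative to the distance of any two points near the
  limit. Limits of crossings are proved along arbitrary filters because three kinds of limit occur:
  \<epsilon> = 0 with h tending to h0, which makes \<open>C\<close> and \<open>E\<close> continuous;
  fixed h with \<epsilon> tending to 0 from the right, which gives the formula; and (h, \<epsilon>)
  tending jointly to (h0, 0), which makes the statements about closed orbits hold uniformly on a
  neighbourhood. The function \<open>F\<close> is smooth only up to the boundary \<epsilon> = 0 of
  its domain. The inverse function argument is therefore carried out for a C1 extension across
  \<epsilon> = 0, and its zeros are read off for \<epsilon> > 0.\<close>

definition C1_on :: "'a set \<Rightarrow> ('a::euclidean_space \<Rightarrow> 'b::real_normed_vector) \<Rightarrow> ('a \<Rightarrow> 'a \<Rightarrow>\<^sub>L 'b) \<Rightarrow> bool"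
  where "C1_on W f f' \<longleftrightarrow> open W \<and> continuous_on W f' \<and>
    (\<forall>x\<in>W. (f has_derivative blinfun_apply (f' x)) (at x))"

lemma C1_onD:
  assumes "C1_on W f f'"
  shows "open W" "continuous_on W f'" "x \<in> W \<Longrightarrow> (f has_derivative blinfun_apply (f' x)) (at x)"
  using assms by (auto simp: C1_on_def)

lemma C1_on_continuous_on:
  assumes "C1_on W f f'"
  shows "continuous_on W f"
  using C1_onD[OF assms] has_derivative_continuous continuous_at_imp_continuous_on by metis

lemma Ck_on_1_imp_C1_on:
  assumes "open W" "Ck_on 1 f W"
  shows "\<exists>f'. C1_on W f f'"
proof -
  define f' where "f' x = Blinfun (frechet_derivative f (at x))" for x
  have d: "(f has_derivative frechet_derivative f (at x)) (at x)" if "x \<in> W" for x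
    using assms(2) that by (auto simp: frechet_derivative_works[symmetric])
  have f': "blinfun_apply (f' x) = frechet_derivative f (at x)" if "x \<in> W" for x
    unfolding f'_def using d[OF that] has_derivative_bounded_linear bounded_linear_Blinfun_apply by blast
  have "continuous_on W f'"
  proof (rule continuous_on_blinfun_componentwise)
    fix i :: 'a assume "i \<in> Basis"
    then have "continuous_on W (\<lambda>x. frechet_derivative f (at x) i)"
      using assms(2) by auto
    then show "continuous_on W (\<lambda>x. blinfun_apply (f' x) i)"
      by (rule continuous_on_eq) (simp add: f')
  qed
  then show ?thesis
    unfolding C1_on_def using assms(1) d f' by auto
qed

text \<open>The extension is kept apart from \<open>f\<close>: the set \<open>S\<close> need not be
  open (for \<open>F\<close> it is the half \<epsilon> \<ge> 0), so \<open>f\<close> itself may have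
  no derivative at points of \<open>S\<close>.\<close>

lemma smooth_on_imp_C1_extension:
  assumes "smooth_on S f"
  obtains W F F' where "S \<subseteq> W" "C1_on W F F'" "\<And>x. x \<in> S \<Longrightarrow> F x = f x"
proof -
  obtain W F where "open W" "S \<subseteq> W" "\<forall>k. Ck_on k F W" "\<forall>x\<in>S. F x = f x"
    using assms by (auto simp: smooth_on_def)
  moreover obtain F' where "C1_on W F F'"
    using Ck_on_1_imp_C1_on calculation by blast
  ultimately show thesis using that by blast
qed

lemma smooth_on_open_imp_C1_on:
  assumes "smooth_on W f" "open W"
  shows "\<exists>f'. C1_on W f f'"
proof -
  obtain V F F' where F: "W \<subseteq> V" "C1_on V F F'" "\<And>x. x \<in> W \<Longrightarrow> F x = f x"
    using smooth_on_imp_C1_extension[OF assms(1)] by blast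
  have "C1_on W f F'"
    unfolding C1_on_def
  proof (intro conjI ballI)
    show "continuous_on W F'" using F C1_onD(2) continuous_on_subset by blast
    fix x assume x: "x \<in> W"
    then show "(f has_derivative blinfun_apply (F' x)) (at x)"
      using has_derivative_transform_within_open[OF C1_onD(3)[OF F(2)] assms(2) x F(3)] F(1) by blast
  qed (use assms in auto)
  then show ?thesis by blast
qed

text \<open>The mean value inequality is applied to \<open>f\<close> minus its linearisation at
  \<open>x0\<close>; the derivative of this difference at \<open>x\<close> is
  \<open>f' x - f' x0\<close>, which is small near \<open>x0\<close> by continuity.\<close>

lemma C1_on_strict_derivative:
  assumes "C1_on W f f'" "x0 \<in> W" "e > 0"
  shows "\<exists>d>0. ball x0 d \<subseteq> W \<and> (\<forall>y\<in>ball x0 d. \<forall>z\<in>ball x0 d.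
      norm (f y - f z - blinfun_apply (f' x0) (y - z)) \<le> e * norm (y - z))"
proof -
  obtain d1 where d1: "d1 > 0" "ball x0 d1 \<subseteq> W"
    using C1_onD(1)[OF assms(1)] assms(2) openE by blast
  have "continuous (at x0) f'"
    using C1_onD(1,2)[OF assms(1)] assms(2) continuous_on_eq_continuous_at by blast
  then obtain d2 where d2: "d2 > 0" "\<And>y. dist y x0 < d2 \<Longrightarrow> dist (f' y) (f' x0) < e"
    using assms(3) unfolding continuous_at_eps_delta by metis
  define d where "d = min d1 d2"
  have W: "ball x0 d \<subseteq> W" using d1 by (auto simp: d_def)
  have "norm (f y - f z - blinfun_apply (f' x0) (y - z)) \<le> e * norm (y - z)"
    if "y \<in> ball x0 d" "z \<in> ball x0 d" for y z
  proof -
    have "norm ((f y - blinfun_apply (f' x0) y) - (f z - blinfun_apply (f' x0) z)) \<le> e * norm (y - z)"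
    proof (rule differentiable_bound[where S="ball x0 d" and f'="\<lambda>x. blinfun_apply (f' x - f' x0)"])
      fix x assume x: "x \<in> ball x0 d"
      show "((\<lambda>y. f y - blinfun_apply (f' x0) y) has_derivative blinfun_apply (f' x - f' x0)) (at x within ball x0 d)"
      proof -
        have "(f has_derivative blinfun_apply (f' x)) (at x within ball x0 d)"
          using C1_onD(3)[OF assms(1)] W x by (blast intro: has_derivative_at_withinI)
        from has_derivative_diff[OF this bounded_linear_imp_has_derivative[OF blinfun.bounded_linear_right[of "f' x0"]]]
        show ?thesis by (simp add: minus_blinfun.rep_eq)
      qed
      show "onorm (blinfun_apply (f' x - f' x0)) \<le> e"
        using d2(2)[of x] x by (simp add: norm_blinfun.rep_eq[symmetric] dist_norm d_def norm_minus_commute)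
    qed (use that in auto)
    then show ?thesis by (simp add: blinfun.diff_right algebra_simps)
  qed
  moreover have "d > 0" using d1 d2 by (auto simp: d_def)
  ultimately show ?thesis using W by blast
qed

text \<open>On the compact unit sphere the norm of the image attains its minimum, which is positive
  because the kernel is trivial; homogeneity does the rest.\<close>

lemma injective_linear_lower_bound:
  fixes L :: "'a::euclidean_space \<Rightarrow>\<^sub>L 'b::real_normed_vector"
  assumes "\<And>x. blinfun_apply L x = 0 \<Longrightarrow> x = 0"
  shows "\<exists>c>0. \<forall>x. c * norm x \<le> norm (blinfun_apply L x)"
proof -
  let ?S = "sphere (0::'a) 1"
  have "?S \<noteq> {}" by simp
  then obtain x0 where x0: "x0 \<in> ?S" "\<And>x. x \<in> ?S \<Longrightarrow> norm (blinfun_apply L x0) \<le> norm (blinfun_apply L x)"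
    using continuous_attains_inf[of ?S "\<lambda>x. norm (blinfun_apply L x)"]
      continuous_on_norm[OF linear_continuous_on[OF blinfun.bounded_linear_right[of L]], of ?S]
    by auto
  let ?c = "norm (blinfun_apply L x0)"
  have "?c > 0" using x0(1) assms by fastforce
  moreover have "?c * norm x \<le> norm (blinfun_apply L x)" for x
  proof (cases "x = 0")
    case False
    have "?c \<le> norm (blinfun_apply L (x /\<^sub>R norm x))"
      using False by (intro x0(2)) simp
    then show ?thesis using False by (simp add: blinfun.scaleR_right field_simps)
  qed simp
  ultimately show ?thesis by blast
qed

text \<open>The linearisation error is taken as \<open>c / 2\<close>, half the lower bound for the
  derivative, so two points with equal values must coincide.\<close>

lemma C1_on_locally_injective:
  assumes "C1_on W f f'" "x0 \<in> W" "\<And>x. blinfun_apply (f' x0) x = 0 \<Longrightarrow> x = 0"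
  obtains d where "d > 0" "ball x0 d \<subseteq> W" "inj_on f (ball x0 d)"
proof -
  obtain c where c: "c > 0" "\<And>x. c * norm x \<le> norm (blinfun_apply (f' x0) x)"
    using injective_linear_lower_bound assms(3) by blast
  obtain d where d: "d > 0" "ball x0 d \<subseteq> W" "\<forall>y\<in>ball x0 d. \<forall>z\<in>ball x0 d.
      norm (f y - f z - blinfun_apply (f' x0) (y - z)) \<le> c/2 * norm (y - z)"
    using C1_on_strict_derivative[OF assms(1,2) half_gt_zero[OF c(1)]] by blast
  have "inj_on f (ball x0 d)"
  proof (rule inj_onI)
    fix y z assume "y \<in> ball x0 d" "z \<in> ball x0 d" "f y = f z"
    then have "norm (blinfun_apply (f' x0) (y - z)) \<le> c/2 * norm (y - z)"
      using d(3)[rule_format, of y z] by simp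
    with c(2)[of "y - z"] have "c * norm (y - z) \<le> c/2 * norm (y - z)" by linarith
    then show "y = z" using c(1) by (auto simp: mult_le_cancel_right)
  qed
  then show thesis using that d by blast
qed

text \<open>Between spaces of equal finite dimension an injective derivative has a linear right
  inverse, as \<open>sussmann_open_mapping\<close> demands. Restricting to
  \<open>W \<inter> ball x0 r\<close> puts the preimages into the prescribed ball.\<close>

lemma C1_on_open_mapping:
  fixes f :: "'a::euclidean_space \<Rightarrow> 'a"
  assumes "C1_on W f f'" "x0 \<in> W" "\<And>x. blinfun_apply (f' x0) x = 0 \<Longrightarrow> x = 0" "r > 0"
  shows "\<exists>d>0. ball (f x0) d \<subseteq> f ` ball x0 r"
proof -
  let ?L = "blinfun_apply (f' x0)"
  have lin: "linear ?L" by (simp add: bounded_linear.linear blinfun.bounded_linear_right)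
  then have "inj ?L" using assms(3) linear_injective_0 by blast
  then obtain g' where g': "linear g'" "?L \<circ> g' = id"
    using lin linear_injective_imp_surjective linear_surjective_right_inverse by blast
  have "f x0 \<in> interior (f ` (W \<inter> ball x0 r))"
  proof (rule sussmann_open_mapping[of W f x0 ?L g'])
    show "x0 \<in> interior (W \<inter> ball x0 r)"
      using C1_onD(1)[OF assms(1)] assms by (simp add: interior_open open_Int)
  qed (use assms C1_onD[OF assms(1)] C1_on_continuous_on g' linear_conv_bounded_linear[of g'] in auto)
  then show ?thesis unfolding mem_interior by blast
qed

text \<open>Only \<open>x\<close> lies in the compact set; \<open>y\<close> will be a nearby point
  of a perturbed orbit. Uniform continuity is therefore taken on the compact thickening of
  \<open>S\<close> by a closed ball of radius \<open>r\<close>, which still lies in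
  \<open>W\<close>.\<close>

lemma compact_uniform_continuity:
  fixes K :: "'a::euclidean_space \<Rightarrow> 'b::metric_space"
  assumes "continuous_on W K" "open W" "compact S" "S \<subseteq> W" "e > 0"
  obtains d where "d > 0" "\<And>x y. x \<in> S \<Longrightarrow> dist x y < d \<Longrightarrow> y \<in> W \<and> dist (K x) (K y) < e"
proof -
  obtain r where r: "r > 0" "(\<Union>x\<in>S. cball x r) \<subseteq> W"
    using compact_subset_open_imp_cball_epsilon_subset assms by metis
  let ?T = "{x + y | x y. x \<in> S \<and> y \<in> cball 0 r}"
  have T: "compact ?T" using assms(3) by (intro compact_sums) auto
  have sub: "?T \<subseteq> W"
  proof clarify
    fix x y assume "x \<in> S" "y \<in> cball (0::'a) r"
    then have "x + y \<in> cball x r" by (simp add: dist_norm)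
    then show "x + y \<in> W" using r(2) \<open>x \<in> S\<close> by blast
  qed
  have mem: "y \<in> ?T" if "x \<in> S" "dist x y \<le> r" for x y
  proof -
    have "y = x + (y - x)" "y - x \<in> cball 0 r" using that by (auto simp: dist_norm norm_minus_commute)
    then show ?thesis using that(1) by blast
  qed
  have unif: "uniformly_continuous_on ?T K"
    using compact_uniformly_continuous[OF continuous_on_subset[OF assms(1) sub] T] .
  obtain d where d: "d > 0" "\<And>x y. x \<in> ?T \<Longrightarrow> y \<in> ?T \<Longrightarrow> dist y x < d \<Longrightarrow> dist (K y) (K x) < e"
    by (rule uniformly_continuous_onE[OF unif \<open>e > 0\<close>]) blast
  show thesis
  proof (rule that[of "min d r"])
    fix x y assume *: "x \<in> S" "dist x y < min d r"
    then have "y \<in> ?T" "x \<in> ?T" using mem[of x y] mem[of x x] r(1) by auto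
    then show "y \<in> W \<and> dist (K x) (K y) < e"
      using d(2)[of y x] * sub by auto
  qed (use d r in auto)
qed

lemma C1_on_Lipschitz_cball:
  fixes f :: "'a::euclidean_space \<Rightarrow> 'b::real_normed_vector"
  assumes "C1_on UNIV f f'"
  obtains L where "L \<ge> 0" "\<And>x y. x \<in> cball 0 R \<Longrightarrow> y \<in> cball 0 R \<Longrightarrow> norm (f x - f y) \<le> L * norm (x - y)"
proof -
  have "bounded (f' ` cball 0 R)"
    using C1_onD(2)[OF assms] by (intro compact_imp_bounded compact_continuous_image) (auto intro: continuous_on_subset)
  then obtain L where L: "L > 0" "\<And>x. x \<in> cball 0 R \<Longrightarrow> norm (f' x) \<le> L"
    unfolding bounded_pos by auto
  have "norm (f x - f y) \<le> L * norm (x - y)" if "x \<in> cball 0 R" "y \<in> cball 0 R" for x y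
    by (rule differentiable_bound[of "cball 0 R" f "\<lambda>x. blinfun_apply (f' x)"])
      (use that L C1_onD(3)[OF assms] in \<open>auto simp: norm_blinfun.rep_eq[symmetric] intro: has_derivative_at_withinI\<close>)
  then show thesis using that[of L] L(1) by force
qed

subsection \<open>Comparison of solutions\<close>

text \<open>Estimates along an orbit are available only as long as it stays within distance
  \<open>r\<close> of its reference, which is the very thing to be shown. At the first time at which
  \<open>r\<close> is reached the weak bound holds on the whole past, so \<open>step\<close> yields
  the strict bound there, a contradiction.\<close>

lemma continuous_bootstrap:
  fixes d :: "real \<Rightarrow> real"
  assumes "continuous_on {a..b} d" "d a < r"
    and step: "\<And>t. a \<le> t \<Longrightarrow> t \<le> b \<Longrightarrow> (\<And>s. a \<le> s \<Longrightarrow> s \<le> t \<Longrightarrow> d s \<le> r) \<Longrightarrow> d t < r"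
    and t: "a \<le> t" "t \<le> b"
  shows "d t < r"
proof (rule ccontr)
  assume "\<not> d t < r"
  define S where "S = {s \<in> {a..t}. r \<le> d s}"
  have "closed S"
    using continuous_closed_preimage[of "{a..t}" d "{r..}"] continuous_on_subset[OF assms(1), of "{a..t}"] t
    by (auto simp: S_def vimage_def Int_def)
  moreover have "S \<subseteq> {a..t}" by (auto simp: S_def)
  ultimately have "compact S" by (metis compact_Icc compact_Int_closed inf.absorb2)
  moreover have "S \<noteq> {}" using \<open>\<not> d t < r\<close> t by (auto simp: S_def)
  ultimately obtain s0 where s0: "s0 \<in> S" "\<And>s. s \<in> S \<Longrightarrow> s0 \<le> s"
    using compact_attains_inf by metis
  have less: "d s < r" if "a \<le> s" "s < s0" for s
    using s0(1) s0(2)[of s] that by (force simp: S_def)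
  have a0: "a < s0" using s0(1) assms(2) by (auto simp: S_def less_le)
  \<comment> \<open>This allows \<open>step\<close> to be used at \<open>s0\<close> itself: a larger
    value would, by continuity, be preceded by a value still above \<open>r\<close>, against the
    minimality of \<open>s0\<close>.\<close>
  have "d s0 \<le> r"
  proof (rule ccontr)
    assume n: "\<not> d s0 \<le> r"
    have "\<exists>x\<ge>a. x \<le> s0 \<and> d x = (d s0 + r) / 2"
      using n a0 assms(2) s0(1) t
      by (intro IVT'[of d]) (auto simp: S_def intro: continuous_on_subset[OF assms(1)])
    then obtain x where x: "a \<le> x" "x \<le> s0" "d x = (d s0 + r) / 2" by blast
    then have "x \<noteq> s0" "r < d x" using n by (auto simp: field_simps)
    then show False using less[of x] x by auto
  qed
  then have "d s0 < r"
    using s0(1) t less by (intro step) (auto simp: S_def le_less)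
  then show False using s0(1) by (auto simp: S_def)
qed

lemma nonincreasing_Icc:
  fixes f :: "real \<Rightarrow> real"
  assumes "a \<le> b" "\<And>x. a < x \<Longrightarrow> x < b \<Longrightarrow> \<exists>y. (f has_real_derivative y) (at x) \<and> y \<le> 0"
    and "continuous_on {a..b} f"
  shows "f b \<le> f a"
proof (cases "a < b")
  case True
  obtain l z where z: "a < z" "z < b" "DERIV f z :> l" "f b - f a = (b - a) * l"
    using MVT[of a b f] True assms(2,3) real_differentiable_def by metis
  then have "l \<le> 0" using assms(2) DERIV_unique by blast
  then have "(b - a) * l \<le> 0" using True by (simp add: mult_nonneg_nonpos)
  then show ?thesis using z by simp
qed (use assms(1) in auto)

lemma solves_subset: "solves X \<gamma> I \<Longrightarrow> J \<subseteq> I \<Longrightarrow> solves X \<gamma> J"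
  unfolding solves_def using has_vector_derivative_within_subset by blast

lemma solves_continuous_on: "solves X \<gamma> I \<Longrightarrow> continuous_on I \<gamma>"
  unfolding solves_def continuous_on_eq_continuous_within
  using has_vector_derivative_continuous by blast

lemma solves_interior:
  assumes "solves X \<gamma> {a..b}" "a < t" "t < b"
  shows "(\<gamma> has_vector_derivative X (\<gamma> t)) (at t)"
  using assms at_within_Icc_at[of a t b] unfolding solves_def
  by (metis atLeastAtMost_iff less_eq_real_def)

text \<open>
  Gronwall's argument for \<open>z = \<gamma> - \<phi>\<close>, carried out for \<open>|z|\<^sup>2\<close> instead of \<open>|z|\<close>, which need not be
  differentiable; the term \<open>2\<epsilon>N|z|\<close> is absorbed by \<open>|z|\<^sup>2 + \<epsilon>\<^sup>2N\<^sup>2\<close>.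
\<close>

lemma solution_comparison:
  fixes X g :: "'a::euclidean_space \<Rightarrow> 'a"
  assumes X: "C1_on UNIV X X'" and g: "continuous_on UNIV g"
    and \<phi>: "solves X \<phi> {0..T}" "0 \<le> T" and "\<eta> > 0"
  shows "\<exists>\<delta>>0. \<forall>\<epsilon> S \<gamma> t. 0 \<le> \<epsilon> \<longrightarrow> \<epsilon> < \<delta> \<longrightarrow> S \<le> T \<longrightarrow> solves (\<lambda>x. X x + \<epsilon> *\<^sub>R g x) \<gamma> {0..S} \<longrightarrow>
      dist (\<gamma> 0) (\<phi> 0) < \<delta> \<longrightarrow> 0 \<le> t \<longrightarrow> t \<le> S \<longrightarrow> dist (\<gamma> t) (\<phi> t) < \<eta>"
proof -
  have "bounded (\<phi> ` {0..T})"
    using \<phi>(1) solves_continuous_on compact_continuous_image compact_imp_bounded by blast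
  then obtain R0 where R0: "\<And>t. t \<in> {0..T} \<Longrightarrow> norm (\<phi> t) \<le> R0"
    unfolding bounded_iff by blast
  \<comment> \<open>The ball of radius \<open>R\<close> contains the arc together with its tube of
    radius \<eta>. The Lipschitz constant of \<open>X\<close> and the bound for \<open>g\<close> on
    it apply while the bootstrap keeps \<gamma> in the tube.\<close>
  define R where "R = R0 + \<eta>"
  obtain L where L: "L \<ge> 0" "\<And>x y. x \<in> cball 0 R \<Longrightarrow> y \<in> cball 0 R \<Longrightarrow> norm (X x - X y) \<le> L * norm (x - y)"
    using C1_on_Lipschitz_cball[OF X] by blast
  have "bounded (g ` cball 0 R)"
    using g by (intro compact_imp_bounded compact_continuous_image) (auto intro: continuous_on_subset)
  then obtain N where N: "N > 0" "\<And>x. x \<in> cball 0 R \<Longrightarrow> norm (g x) \<le> N"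
    unfolding bounded_pos by auto
  \<comment> \<open>The Lipschitz term contributes \<open>2 * L\<close> to the growth rate of |z|^2,
    the absorbed perturbation 1. Hence |z|^2 + c, damped by the factor exp(- K s), is nonincreasing;
    with initial distance and \<epsilon> below \<delta> this bounds |z|^2 by \<delta>^2 q, and
    \<delta> is chosen to make that less than \<eta>^2.\<close>
  define K where "K = 2 * L + 1"
  define q where "q = exp (K * T) * (1 + N\<^sup>2)"
  have q: "q > 0" by (simp add: q_def add_pos_nonneg)
  define \<delta> where "\<delta> = \<eta> / (sqrt q + 1)"
  have \<delta>: "\<delta> > 0" using \<open>\<eta> > 0\<close> q by (simp add: \<delta>_def add_nonneg_pos)
  have "\<delta> * sqrt q < \<eta>"
    using \<open>\<eta> > 0\<close> q by (simp add: \<delta>_def field_simps add_nonneg_pos)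
  then have \<delta>q: "\<delta>\<^sup>2 * q < \<eta>\<^sup>2"
    using power_strict_mono[of "\<delta> * sqrt q" \<eta> 2] \<delta> q by (simp add: power_mult_distrib)
  have main: "dist (\<gamma> t) (\<phi> t) < \<eta>"
    if \<epsilon>: "0 \<le> \<epsilon>" "\<epsilon> < \<delta>" and S: "S \<le> T" and \<gamma>: "solves (\<lambda>x. X x + \<epsilon> *\<^sub>R g x) \<gamma> {0..S}"
      and \<gamma>0: "dist (\<gamma> 0) (\<phi> 0) < \<delta>" and t: "0 \<le> t" "t \<le> S" for \<epsilon> S \<gamma> t
  proof (rule continuous_bootstrap[of 0 S "\<lambda>t. dist (\<gamma> t) (\<phi> t)" \<eta> t])
    have \<phi>S: "solves X \<phi> {0..S}" using solves_subset[OF \<phi>(1)] S by auto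
    show "continuous_on {0..S} (\<lambda>t. dist (\<gamma> t) (\<phi> t))"
      using solves_continuous_on[OF \<gamma>] solves_continuous_on[OF \<phi>S] by (intro continuous_intros)
    have "\<delta> \<le> \<eta>" using \<open>\<eta> > 0\<close> q by (simp add: \<delta>_def field_simps add_nonneg_pos)
    then show "dist (\<gamma> 0) (\<phi> 0) < \<eta>" using \<gamma>0 by linarith
    fix t assume t: "0 \<le> t" "t \<le> S" and near: "\<And>s. 0 \<le> s \<Longrightarrow> s \<le> t \<Longrightarrow> dist (\<gamma> s) (\<phi> s) \<le> \<eta>"
    have ball: "\<phi> s \<in> cball 0 R" "\<gamma> s \<in> cball 0 R" if "0 \<le> s" "s \<le> t" for s
      using R0[of s] near[OF that] that t S \<open>\<eta> > 0\<close> norm_triangle_ineq2[of "\<gamma> s" "\<phi> s"]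
      by (auto simp: R_def dist_norm)
    define z where "z s = \<gamma> s - \<phi> s" for s
    define c where "c = \<epsilon>\<^sup>2 * N\<^sup>2"
    define w where "w s = exp (- K * s) * (z s \<bullet> z s + c)" for s
    have cont: "continuous_on {0..t} z"
      using solves_continuous_on[OF \<gamma>] solves_continuous_on[OF \<phi>S] t
      by (auto simp: z_def[abs_def] intro!: continuous_on_diff elim: continuous_on_subset)
    have "w t \<le> w 0"
    proof (rule nonincreasing_Icc[of 0 t w])
      show "continuous_on {0..t} w"
        using cont by (auto simp: w_def[abs_def] intro!: continuous_intros)
      fix s assume s: "0 < s" "s < t"
      define z' where "z' = X (\<gamma> s) + \<epsilon> *\<^sub>R g (\<gamma> s) - X (\<phi> s)"
      have "(z has_vector_derivative z') (at s)"
        using has_vector_derivative_diff[OF solves_interior[OF \<gamma>, of s] solves_interior[OF \<phi>S, of s]] s t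
        by (simp add: z_def[abs_def] z'_def)
      then have dz: "(z has_derivative (\<lambda>h. h *\<^sub>R z')) (at s)"
        by (simp add: has_vector_derivative_def)
      have dzz: "((\<lambda>s. z s \<bullet> z s) has_real_derivative 2 * (z s \<bullet> z')) (at s)"
        unfolding has_field_derivative_def using has_derivative_inner[OF dz dz]
        by (rule has_derivative_eq_rhs) (auto simp: inner_commute)
      have dw: "(w has_real_derivative exp (- K * s) * (2 * (z s \<bullet> z') - K * (z s \<bullet> z s + c))) (at s)"
        unfolding w_def by (rule derivative_eq_intros dzz refl)+ (simp add: algebra_simps)
      have "norm z' \<le> norm (X (\<gamma> s) - X (\<phi> s)) + norm (\<epsilon> *\<^sub>R g (\<gamma> s))"
        unfolding z'_def using norm_triangle_ineq[of "X (\<gamma> s) - X (\<phi> s)" "\<epsilon> *\<^sub>R g (\<gamma> s)"]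
        by (simp add: algebra_simps)
      also have "\<dots> \<le> L * norm (z s) + \<epsilon> * N"
        using L(2)[OF ball(2,1)[of s]] N(2)[OF ball(2)[of s]] s \<epsilon> by (auto simp: z_def intro!: add_mono mult_left_mono)
      finally have nz: "norm z' \<le> L * norm (z s) + \<epsilon> * N" .
      have "2 * (z s \<bullet> z') \<le> 2 * (norm (z s) * (L * norm (z s) + \<epsilon> * N))"
        using norm_cauchy_schwarz[of "z s" z'] mult_left_mono[OF nz, of "norm (z s)"] by simp
      also have "\<dots> \<le> K * (norm (z s))\<^sup>2 + c"
        using zero_le_power2[of "norm (z s) - \<epsilon> * N"]
        by (simp add: K_def c_def power2_eq_square algebra_simps)
      also have "\<dots> \<le> K * (z s \<bullet> z s + c)"
        using L(1) by (simp add: K_def c_def power2_norm_eq_inner algebra_simps)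
      finally have "exp (- K * s) * (2 * (z s \<bullet> z') - K * (z s \<bullet> z s + c)) \<le> 0"
        by (intro mult_nonneg_nonpos) auto
      then show "\<exists>y. (w has_real_derivative y) (at s) \<and> y \<le> 0" using dw by blast
    qed (use t in auto)
    then have "z t \<bullet> z t + c \<le> exp (K * t) * (z 0 \<bullet> z 0 + c)"
      by (simp add: w_def exp_minus field_simps)
    also have "\<dots> \<le> exp (K * T) * (\<delta>\<^sup>2 + \<delta>\<^sup>2 * N\<^sup>2)"
    proof (rule mult_mono)
      show "exp (K * t) \<le> exp (K * T)" using t S L(1) by (simp add: K_def mult_left_mono)
      have "(norm (z 0))\<^sup>2 \<le> \<delta>\<^sup>2" using \<gamma>0 by (intro power_mono) (auto simp: z_def dist_norm)
      moreover have "\<epsilon>\<^sup>2 \<le> \<delta>\<^sup>2" using \<epsilon> by (intro power_mono) auto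
      ultimately show "z 0 \<bullet> z 0 + c \<le> \<delta>\<^sup>2 + \<delta>\<^sup>2 * N\<^sup>2"
        by (auto simp: c_def power2_norm_eq_inner intro!: add_mono mult_right_mono)
    qed (auto simp: c_def)
    also have "\<dots> = \<delta>\<^sup>2 * q" by (simp add: q_def algebra_simps)
    finally have "z t \<bullet> z t + c \<le> \<delta>\<^sup>2 * q" .
    moreover have "c \<ge> 0" by (simp add: c_def)
    ultimately have "(norm (z t))\<^sup>2 < \<eta>\<^sup>2" using \<delta>q by (simp add: power2_norm_eq_inner)
    then show "dist (\<gamma> t) (\<phi> t) < \<eta>"
      using \<open>\<eta> > 0\<close> by (simp add: dist_norm z_def power2_less_imp_less)
  qed (use t in auto)
  then show ?thesis using \<delta> by blast
qed

lemma solution_component_within: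
  fixes \<gamma> :: "real \<Rightarrow> real ^ 'n"
  assumes "solves X \<gamma> I" "t \<in> I"
  shows "((\<lambda>t. a * \<gamma> t $ i) has_real_derivative a * X (\<gamma> t) $ i) (at t within I)"
proof -
  have "((\<lambda>t. \<gamma> t $ i) has_vector_derivative X (\<gamma> t) $ i) (at t within I)"
    using bounded_linear.has_vector_derivative[OF bounded_linear_vec_nth] assms unfolding solves_def by blast
  then show ?thesis
    by (auto simp: has_real_derivative_iff_has_vector_derivative intro: has_vector_derivative_mult_right)
qed

lemma solution_component_derivative:
  fixes \<gamma> :: "real \<Rightarrow> real ^ 'n"
  assumes "solves X \<gamma> {s..T}" "s < t" "t < T"
  shows "((\<lambda>t. a * \<gamma> t $ i) has_real_derivative a * X (\<gamma> t) $ i) (at t)"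
  using solution_component_within[OF assms(1), of t a i] at_within_Icc_at[OF assms(2,3)] assms(2,3) by simp

lemma solution_norm_bound:
  fixes \<gamma> :: "real \<Rightarrow> 'a::euclidean_space"
  assumes "solves X \<gamma> {s..t}" "s \<le> t" "\<And>r. s \<le> r \<Longrightarrow> r \<le> t \<Longrightarrow> norm (X (\<gamma> r)) \<le> N"
  shows "dist (\<gamma> t) (\<gamma> s) \<le> N * (t - s)"
proof -
  have "norm (\<gamma> t - \<gamma> s) \<le> N * norm (t - s)"
  proof (rule differentiable_bound[of "{s..t}" \<gamma> "\<lambda>r h. h *\<^sub>R X (\<gamma> r)"])
    fix r assume "r \<in> {s..t}"
    then show "(\<gamma> has_derivative (\<lambda>h. h *\<^sub>R X (\<gamma> r))) (at r within {s..t})"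
      using assms(1) unfolding solves_def has_vector_derivative_def by blast
    show "onorm (\<lambda>h. h *\<^sub>R X (\<gamma> r)) \<le> N"
      using assms(3)[of r] \<open>r \<in> {s..t}\<close> onorm_scaleR_left[of "\<lambda>h::real. h" "X (\<gamma> r)"]
      by (simp add: onorm_id bounded_linear_ident)
  qed (use assms in auto)
  then show ?thesis using assms(2) by (simp add: dist_norm)
qed

text \<open>Serves to meet several smallness conditions with a single constant.\<close>

lemma finite_pos_lower_bound:
  fixes S :: "real set"
  assumes "finite S" "\<forall>x\<in>S. 0 < x"
  shows "\<exists>m>0. \<forall>x\<in>S. m \<le> x"
proof (cases "S = {}")
  case False
  then have "0 < Min S" using assms by simp
  then show ?thesis using Min_le[OF assms(1)] by blast
qed (auto intro: exI[of _ 1])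

subsection \<open>Perturbed crossings of a quadrant\<close>

text \<open>The signs let one argument serve all four legs. The inequalities are strict, so for open
  \<open>U\<close> the set is open even for the first leg, whose region contains its
  boundary.\<close>

definition quadrant :: "(real ^ 'n) set \<Rightarrow> 'n \<Rightarrow> 'n \<Rightarrow> real \<Rightarrow> real \<Rightarrow> (real ^ 'n) set" where
  "quadrant U i j a b = {x \<in> U. 0 < a * x $ i \<and> 0 < b * x $ j}"

text \<open>The plane of coordinate \<open>j\<close> is left at time 0 and that of coordinate
  \<open>i\<close> is met at time \<open>T\<close>. The curve is not confined to a quadrant, since
  first intersection points are not defined that way; confinement is a conclusion of
  \<open>crossing_near_arc\<close>.\<close>

definition crossing ::
  "(real ^ 'n \<Rightarrow> real ^ 'n) \<Rightarrow> (real ^ 'n \<Rightarrow> real ^ 'n) \<Rightarrow> 'n \<Rightarrow> 'n \<Rightarrow> real \<Rightarrow> real \<Rightarrow>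
    (real \<Rightarrow> real ^ 'n) \<Rightarrow> bool" where
  "crossing X g i j \<epsilon> T \<gamma> \<longleftrightarrow> 0 < T \<and> solves (\<lambda>x. X x + \<epsilon> *\<^sub>R g x) \<gamma> {0..T} \<and> \<gamma> 0 $ j = 0 \<and>
    \<gamma> T $ i = 0 \<and> (\<forall>t\<in>{0<..<T}. \<gamma> t $ i \<noteq> 0)"

text \<open>The set \<open>S\<close> records what is known about the location of the curve:
  \<open>UNIV\<close> for the points as they are given, a quadrant or region after the comparison
  with the arc.\<close>

definition reaches ::
  "(real ^ 'n \<Rightarrow> real ^ 'n) \<Rightarrow> (real ^ 'n \<Rightarrow> real ^ 'n) \<Rightarrow> 'n \<Rightarrow> 'n \<Rightarrow> (real ^ 'n) set \<Rightarrow> real \<Rightarrow>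
    real ^ 'n \<Rightarrow> real ^ 'n \<Rightarrow> bool" where
  "reaches X g i j S \<epsilon> P Q \<longleftrightarrow>
    (\<exists>T \<gamma>. crossing X g i j \<epsilon> T \<gamma> \<and> \<gamma> 0 = P \<and> \<gamma> T = Q \<and> \<gamma> ` {0<..<T} \<subseteq> S)"

text \<open>
  The arc \<open>\<phi>\<close> enters the open quadrant through the hyperplane \<open>x\<^sub>j = 0\<close> and leaves it through
  \<open>x\<^sub>i = 0\<close>; the signs \<open>a\<close> and \<open>b\<close> select the quadrant.
\<close>

locale quadrant_arc =
  fixes X g :: "real ^ 'n \<Rightarrow> real ^ 'n" and X' and i j :: 'n and a b :: real
    and U :: "(real ^ 'n) set" and T0 :: real and \<phi> :: "real \<Rightarrow> real ^ 'n"
  assumes X: "C1_on UNIV X X'" and g: "continuous_on UNIV g" and U: "open U"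
    and T0: "0 < T0" and sol: "solves X \<phi> {0..T0}"
    and inside: "\<And>t. 0 < t \<Longrightarrow> t < T0 \<Longrightarrow> \<phi> t \<in> U \<and> 0 < a * \<phi> t $ i \<and> 0 < b * \<phi> t $ j"
    and start: "\<phi> 0 \<in> U" "0 < a * \<phi> 0 $ i" "\<phi> 0 $ j = 0" "0 < b * X (\<phi> 0) $ j"
    and target: "\<phi> T0 \<in> U" "\<phi> T0 $ i = 0" "0 < b * \<phi> T0 $ j" "a * X (\<phi> T0) $ i < 0"
begin

abbreviation "Q \<equiv> quadrant U i j a b"
abbreviation "cross \<equiv> crossing X g i j"

lemma open_quadrant: "open Q"
proof -
  have "Q = U \<inter> {x. 0 < a * x $ i} \<inter> {x. 0 < b * x $ j}"
    by (auto simp: quadrant_def)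
  then show ?thesis
    using U by (auto intro!: open_Int open_Collect_less continuous_intros)
qed

lemma continuous_X: "continuous_on S X"
  using C1_on_continuous_on[OF X] continuous_on_subset by blast

text \<open>The conditions are strict inequalities, jointly continuous in (x, \<epsilon>), so they
  persist near (\<phi> 0, 0). The radius is halved to turn a ball of the product space into separate
  bounds on \<open>x\<close> and \<epsilon>.\<close>

lemma start_neighbourhood:
  obtains \<rho> where "\<rho> > 0"
    "\<And>x \<epsilon>. dist x (\<phi> 0) < \<rho> \<Longrightarrow> \<bar>\<epsilon>\<bar> < \<rho> \<Longrightarrow>
      x \<in> U \<and> 0 < a * x $ i \<and> 0 < b * (X x + \<epsilon> *\<^sub>R g x) $ j"
proof -
  let ?S = "{z::(real ^ 'n) \<times> real. 0 < a * fst z $ i} \<inter>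
    {z. 0 < b * (X (fst z) + snd z *\<^sub>R g (fst z)) $ j} \<inter> U \<times> UNIV"
  have "open ?S"
    using U by (intro open_Int open_Times open_Collect_less continuous_intros
      continuous_on_compose2[OF continuous_X[of UNIV]] continuous_on_compose2[OF g]) auto
  moreover have "(\<phi> 0, 0) \<in> ?S" using start by auto
  ultimately obtain r where r: "r > 0" "\<And>z. dist z (\<phi> 0, 0) < r \<Longrightarrow> z \<in> ?S"
    unfolding open_dist by blast
  have "(x, \<epsilon>) \<in> ?S" if "dist x (\<phi> 0) < r / 2" "\<bar>\<epsilon>\<bar> < r / 2" for x \<epsilon>
    using dist_Pair_Pair[of x \<epsilon> "\<phi> 0" 0] sqrt_sum_squares_le_sum_abs[of "dist x (\<phi> 0)" "\<bar>\<epsilon>\<bar>"] that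
    by (intro r(2)) (auto simp: dist_real_def)
  then show thesis using that[of "r / 2"] r(1) by auto
qed

lemma target_neighbourhood:
  obtains \<rho> c N where "\<rho> > 0" "c > 0" "N > 0"
    "\<And>x \<epsilon>. dist x (\<phi> T0) < \<rho> \<Longrightarrow> \<bar>\<epsilon>\<bar> < \<rho> \<Longrightarrow>
      x \<in> U \<and> 0 < b * x $ j \<and> a * (X x + \<epsilon> *\<^sub>R g x) $ i < - c \<and> norm (X x + \<epsilon> *\<^sub>R g x) < N"
proof -
  \<comment> \<open>Half the rate at which \<open>a * x $ i\<close> decreases where the arc meets
    its target plane; this much of the rate survives nearby and for small \<epsilon>.\<close>
  define c where "c = - (a * X (\<phi> T0) $ i) / 2"
  define N where "N = norm (X (\<phi> T0)) + 1"
  let ?S = "{z::(real ^ 'n) \<times> real. 0 < b * fst z $ j} \<inter>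
    {z. a * (X (fst z) + snd z *\<^sub>R g (fst z)) $ i < - c} \<inter>
    {z. norm (X (fst z) + snd z *\<^sub>R g (fst z)) < N} \<inter> U \<times> UNIV"
  have "open ?S"
    using U by (intro open_Int open_Times open_Collect_less continuous_intros
      continuous_on_compose2[OF continuous_X[of UNIV]] continuous_on_compose2[OF g]) auto
  moreover have "(\<phi> T0, 0) \<in> ?S" using target by (auto simp: c_def N_def)
  ultimately obtain r where r: "r > 0" "\<And>z. dist z (\<phi> T0, 0) < r \<Longrightarrow> z \<in> ?S"
    unfolding open_dist by blast
  have "(x, \<epsilon>) \<in> ?S" if "dist x (\<phi> T0) < r / 2" "\<bar>\<epsilon>\<bar> < r / 2" for x \<epsilon>
    using dist_Pair_Pair[of x \<epsilon> "\<phi> T0" 0] sqrt_sum_squares_le_sum_abs[of "dist x (\<phi> T0)" "\<bar>\<epsilon>\<bar>"] that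
    by (intro r(2)) (auto simp: dist_real_def)
  moreover have "c > 0" "N > 0" using target by (auto simp: c_def N_def add_nonneg_pos)
  ultimately show thesis using that[of "r / 2" c N] r(1) by auto
qed

text \<open>
  Existence of the perturbed orbit up to its crossing is a hypothesis, so only a comparison is
  needed. Just before the end point the field has a component of definite sign towards the target
  hyperplane, which bounds the crossing time from above.
\<close>

lemma crossing_near_arc:
  assumes "\<eta> > 0"
  shows "\<exists>\<delta>>0. \<forall>\<epsilon> T \<gamma>. 0 \<le> \<epsilon> \<longrightarrow> \<epsilon> < \<delta> \<longrightarrow> cross \<epsilon> T \<gamma> \<longrightarrow> dist (\<gamma> 0) (\<phi> 0) < \<delta> \<longrightarrow>
      \<bar>T - T0\<bar> < \<eta> \<and> dist (\<gamma> T) (\<phi> T0) < \<eta> \<and> \<gamma> ` {0<..<T} \<subseteq> Q \<and>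
      (\<forall>t\<in>{0..T}. dist (\<gamma> t) (\<phi> (min t T0)) < \<eta>)"
proof -
  obtain \<rho>0 where \<rho>0: "\<rho>0 > 0"
    "\<And>x \<epsilon>. dist x (\<phi> 0) < \<rho>0 \<Longrightarrow> \<bar>\<epsilon>\<bar> < \<rho>0 \<Longrightarrow>
      x \<in> U \<and> 0 < a * x $ i \<and> 0 < b * (X x + \<epsilon> *\<^sub>R g x) $ j"
    using start_neighbourhood by blast
  obtain \<rho>1 c N where \<rho>1: "\<rho>1 > 0" "c > 0" "N > 0"
    "\<And>x \<epsilon>. dist x (\<phi> T0) < \<rho>1 \<Longrightarrow> \<bar>\<epsilon>\<bar> < \<rho>1 \<Longrightarrow>
      x \<in> U \<and> 0 < b * x $ j \<and> a * (X x + \<epsilon> *\<^sub>R g x) $ i < - c \<and> norm (X x + \<epsilon> *\<^sub>R g x) < N"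
    using target_neighbourhood by blast
  define \<rho> where "\<rho> = min \<rho>1 \<eta>"
  have \<rho>: "\<rho> > 0" "\<rho> \<le> \<eta>" "\<rho> \<le> \<rho>1" using \<rho>1(1) assms by (auto simp: \<rho>_def)
  have cont\<phi>: "continuous_on {0..T0} \<phi>" using solves_continuous_on[OF sol] .
  obtain \<tau>1 where \<tau>1: "\<tau>1 > 0" "\<And>t. t \<in> {0..T0} \<Longrightarrow> dist t 0 < \<tau>1 \<Longrightarrow> dist (\<phi> t) (\<phi> 0) < \<rho>0 / 2"
    using cont\<phi>[unfolded continuous_on_iff, rule_format, of 0 "\<rho>0 / 2"] T0 \<rho>0(1) by auto
  obtain \<tau>2 where \<tau>2: "\<tau>2 > 0" "\<And>t. t \<in> {0..T0} \<Longrightarrow> dist t T0 < \<tau>2 \<Longrightarrow> dist (\<phi> t) (\<phi> T0) < \<rho> / 4"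
    using cont\<phi>[unfolded continuous_on_iff, rule_format, of T0 "\<rho> / 4"] T0 \<rho>(1) by auto
  \<comment> \<open>The constant \<tau> splits time into a start up to \<tau>, a middle, and an end
    within \<tau> of \<open>T0\<close>. The entry \<open>\<rho> / (8 * N)\<close> limits how far an
    orbit of speed at most \<open>N\<close> travels in a time \<tau> after
    \<open>T0\<close>.\<close>
  have "\<forall>x\<in>{\<tau>1 / 2, \<tau>2 / 2, T0 / 4, \<eta> / 2, \<rho> / (8 * N)}. 0 < x"
    using \<tau>1(1) \<tau>2(1) T0 assms \<rho>(1) \<rho>1(3) by auto
  from finite_pos_lower_bound[OF _ this]
  obtain \<tau> where "\<tau> > 0" "\<forall>x\<in>{\<tau>1 / 2, \<tau>2 / 2, T0 / 4, \<eta> / 2, \<rho> / (8 * N)}. \<tau> \<le> x"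
    by auto
  then have \<tau>: "\<tau> > 0" "\<tau> < \<tau>1" "\<tau> < \<tau>2" "\<tau> \<le> T0 / 4" "\<tau> < \<eta>" "\<tau> \<le> \<rho> / (8 * N)"
    by auto
  then have N\<tau>: "N * \<tau> \<le> \<rho> / 8" using \<rho>1(3) by (simp add: field_simps)
  have "compact (\<phi> ` {\<tau>..T0 - \<tau>})" "\<phi> ` {\<tau>..T0 - \<tau>} \<subseteq> Q"
    using inside \<tau>(1) by (auto simp: quadrant_def intro!: compact_continuous_image continuous_on_subset[OF cont\<phi>])
  then obtain d where d: "d > 0" "(\<Union>x\<in>\<phi> ` {\<tau>..T0 - \<tau>}. ball x d) \<subseteq> Q"
    using compact_subset_open_imp_ball_epsilon_subset open_quadrant by metis
  \<comment> \<open>At time \<open>T0\<close> the coordinate that measures the distance to the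
    target is at most \<open>\<bar>a\<bar> * \<eta>'\<close>. This has to be less than
    \<open>c * \<tau>\<close>, the amount that it loses during a further time \<tau>.\<close>
  let ?q = "c * \<tau> / (2 * (\<bar>a\<bar> + 1))"
  have "?q > 0" using \<rho>1(2) \<tau>(1) by (simp add: add_nonneg_pos)
  then have "\<forall>x\<in>{\<rho>0 / 2, \<rho> / 4, d, ?q, \<eta>}. 0 < x"
    using \<rho>0(1) \<rho>(1) d(1) assms by auto
  from finite_pos_lower_bound[OF _ this]
  obtain \<eta>' where "\<eta>' > 0" "\<forall>x\<in>{\<rho>0 / 2, \<rho> / 4, d, ?q, \<eta>}. \<eta>' \<le> x"
    by auto
  then have \<eta>': "\<eta>' > 0" "\<eta>' \<le> \<rho>0 / 2" "\<eta>' \<le> \<rho> / 4" "\<eta>' \<le> d" "\<eta>' \<le> ?q" "\<eta>' \<le> \<eta>"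
    by auto
  have "\<bar>a\<bar> * \<eta>' \<le> \<bar>a\<bar> * (c * \<tau> / (2 * (\<bar>a\<bar> + 1)))" using \<eta>'(5) by (rule mult_left_mono) simp
  also have "\<dots> < c * \<tau>"
  proof -
    have "\<bar>a\<bar> / (2 * (\<bar>a\<bar> + 1)) < 1" by simp
    then show ?thesis using mult_strict_left_mono[of "\<bar>a\<bar> / (2 * (\<bar>a\<bar> + 1))" 1 "c * \<tau>"] \<rho>1(2) \<tau>(1)
      by (simp add: mult.commute mult.left_commute)
  qed
  finally have a\<eta>': "\<bar>a\<bar> * \<eta>' < c * \<tau>" .
  obtain \<delta>1 where \<delta>1: "\<delta>1 > 0"
    "\<forall>\<epsilon> S \<gamma> t. 0 \<le> \<epsilon> \<longrightarrow> \<epsilon> < \<delta>1 \<longrightarrow> S \<le> T0 \<longrightarrow> solves (\<lambda>x. X x + \<epsilon> *\<^sub>R g x) \<gamma> {0..S} \<longrightarrow>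
      dist (\<gamma> 0) (\<phi> 0) < \<delta>1 \<longrightarrow> 0 \<le> t \<longrightarrow> t \<le> S \<longrightarrow> dist (\<gamma> t) (\<phi> t) < \<eta>'"
    using solution_comparison[OF X g sol less_imp_le[OF T0] \<eta>'(1)] by blast
  define \<delta> where "\<delta> = min (min \<delta>1 \<rho>0) (min \<rho>1 \<eta>)"
  have \<delta>: "\<delta> > 0" "\<delta> \<le> \<delta>1" "\<delta> \<le> \<rho>0" "\<delta> \<le> \<rho>1" using \<delta>1(1) \<rho>0(1) \<rho>1(1) assms by (auto simp: \<delta>_def)
  have main: "\<bar>T - T0\<bar> < \<eta> \<and> dist (\<gamma> T) (\<phi> T0) < \<eta> \<and> \<gamma> ` {0<..<T} \<subseteq> Q \<and>
      (\<forall>t\<in>{0..T}. dist (\<gamma> t) (\<phi> (min t T0)) < \<eta>)"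
    if \<epsilon>: "0 \<le> \<epsilon>" "\<epsilon> < \<delta>" and cr: "cross \<epsilon> T \<gamma>" and \<gamma>0: "dist (\<gamma> 0) (\<phi> 0) < \<delta>" for \<epsilon> T \<gamma>
  proof -
    let ?Y = "\<lambda>x. X x + \<epsilon> *\<^sub>R g x"
    have T: "0 < T" and \<gamma>: "solves ?Y \<gamma> {0..T}" and \<gamma>ij: "\<gamma> 0 $ j = 0" "\<gamma> T $ i = 0"
      and \<gamma>i: "\<And>t. 0 < t \<Longrightarrow> t < T \<Longrightarrow> \<gamma> t $ i \<noteq> 0"
      using cr by (auto simp: crossing_def)
    have cont\<gamma>: "continuous_on {0..T} \<gamma>" using solves_continuous_on[OF \<gamma>] .
    have near: "dist (\<gamma> t) (\<phi> t) < \<eta>'" if "0 \<le> t" "t \<le> T" "t \<le> T0" for t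
      using \<delta>1(2)[rule_format, of \<epsilon> "min T T0" \<gamma> t] solves_subset[OF \<gamma>] \<epsilon> \<gamma>0 \<delta>(2) that by force
    have near0: "dist (\<gamma> t) (\<phi> 0) < \<rho>0" if "0 \<le> t" "t \<le> T" "t \<le> \<tau>" for t
      using near[of t] \<tau>1(2)[of t] that \<tau> T0 \<eta>'(2) dist_triangle[of "\<gamma> t" "\<phi> 0" "\<phi> t"] by (auto simp: dist_real_def)
    have pos0: "\<gamma> t \<in> U \<and> 0 < a * \<gamma> t $ i \<and> 0 < b * ?Y (\<gamma> t) $ j" if "0 \<le> t" "t \<le> T" "t \<le> \<tau>" for t
      using \<rho>0(2)[OF near0[OF that], of \<epsilon>] \<epsilon> \<delta>(3) by auto
    have mid: "\<gamma> t \<in> Q" if "\<tau> \<le> t" "t \<le> T0 - \<tau>" "t \<le> T" for t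
    proof -
      have "\<gamma> t \<in> ball (\<phi> t) d" using near[of t] that \<tau>(1) \<eta>'(4) by (auto simp: dist_commute)
      then show ?thesis using d(2) that by force
    qed
    \<comment> \<open>Coordinate \<open>i\<close> vanishes at time \<open>T\<close>, whereas
      \<open>pos0\<close> and \<open>mid\<close> keep it away from zero up to
      \<open>T0 - \<tau>\<close>.\<close>
    have T_lower: "T0 - \<tau> < T"
    proof (rule ccontr)
      assume "\<not> T0 - \<tau> < T"
      then show False
        using pos0[of T] mid[of T] T \<gamma>ij(2) by (cases "T \<le> \<tau>") (auto simp: quadrant_def)
    qed
    \<comment> \<open>Beyond \<open>T0\<close> there is no arc to compare with. The orbit is held
      near the target by the speed bound \<open>N\<close>, which is itself valid only near the
      target; hence the bootstrap.\<close>
    have bound: "dist (\<gamma> t) (\<phi> T0) < \<rho> / 2" if "T0 \<le> t" "t \<le> T" "t \<le> T0 + \<tau>" for t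
    proof (rule continuous_bootstrap[of T0 t "\<lambda>t. dist (\<gamma> t) (\<phi> T0)"])
      show "continuous_on {T0..t} (\<lambda>t. dist (\<gamma> t) (\<phi> T0))"
        using continuous_on_subset[OF cont\<gamma>, of "{T0..t}"] that T0 by (intro continuous_intros) auto
      have nT0: "dist (\<gamma> T0) (\<phi> T0) < \<rho> / 4" using near[of T0] T0 that \<eta>'(3) by auto
      then show "dist (\<gamma> T0) (\<phi> T0) < \<rho> / 2" using \<rho>(1) by auto
      fix s assume s: "T0 \<le> s" "s \<le> t" and b: "\<And>r. T0 \<le> r \<Longrightarrow> r \<le> s \<Longrightarrow> dist (\<gamma> r) (\<phi> T0) \<le> \<rho> / 2"
      have "dist (\<gamma> s) (\<gamma> T0) \<le> N * (s - T0)"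
      proof (rule solution_norm_bound)
        show "solves ?Y \<gamma> {T0..s}" using solves_subset[OF \<gamma>] s that T0 by auto
        fix r assume "T0 \<le> r" "r \<le> s"
        then have "dist (\<gamma> r) (\<phi> T0) < \<rho>1" using b[of r] \<rho> by linarith
        then show "norm (?Y (\<gamma> r)) \<le> N" using \<rho>1(4)[of "\<gamma> r" \<epsilon>] \<epsilon> \<delta>(4) by auto
      qed (use s in auto)
      also have "\<dots> \<le> N * \<tau>" using s that \<rho>1(3) by (intro mult_left_mono) auto
      finally show "dist (\<gamma> s) (\<phi> T0) < \<rho> / 2"
        using N\<tau> nT0 \<rho>(1) dist_triangle[of "\<gamma> s" "\<phi> T0" "\<gamma> T0"] by linarith
    qed (use that in auto)
    have near1: "dist (\<gamma> t) (\<phi> T0) < \<rho>" if "T0 - \<tau> \<le> t" "t \<le> T" "t \<le> T0 + \<tau>" for t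
    proof (cases "t \<le> T0")
      case True
      then show ?thesis
        using near[of t] \<tau>2(2)[of t] that \<tau> T0 \<eta>'(3) \<rho>(1) dist_triangle[of "\<gamma> t" "\<phi> T0" "\<phi> t"]
        by (auto simp: dist_real_def)
    qed (use bound[of t] that \<rho>(1) in auto)
    have upos: "0 < a * \<gamma> t $ i" if "0 < t" "t < T" for t
    proof (rule ccontr)
      assume "\<not> 0 < a * \<gamma> t $ i"
      then have "\<exists>x\<ge>0. x \<le> t \<and> a * \<gamma> x $ i = 0"
        using pos0[of 0] T \<tau>(1) that continuous_on_subset[OF cont\<gamma>, of "{0..t}"]
        by (intro IVT2') (auto intro!: continuous_intros)
      then obtain x where "0 \<le> x" "x \<le> t" "a * \<gamma> x $ i = 0" by blast
      then show False using pos0[of 0] \<gamma>i[of x] start(2) that T \<tau>(1) by (cases "x = 0") auto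
    qed
    have T_upper: "T < T0 + \<tau>"
    proof (rule ccontr)
      assume n: "\<not> T < T0 + \<tau>"
      have "a * \<gamma> (T0 + \<tau>) $ i + c * (T0 + \<tau>) \<le> a * \<gamma> T0 $ i + c * T0"
      proof (rule nonincreasing_Icc[of T0 "T0 + \<tau>" "\<lambda>t. a * \<gamma> t $ i + c * t"])
        show "continuous_on {T0..T0 + \<tau>} (\<lambda>t. a * \<gamma> t $ i + c * t)"
          using continuous_on_subset[OF cont\<gamma>, of "{T0..T0 + \<tau>}"] n T0 by (intro continuous_intros) auto
        fix t assume t: "T0 < t" "t < T0 + \<tau>"
        have "((\<lambda>t. a * \<gamma> t $ i + c * t) has_real_derivative a * ?Y (\<gamma> t) $ i + c) (at t)"
          using DERIV_add[OF solution_component_derivative[OF \<gamma>, of t a i] DERIV_cmult_Id[of c]] t T0 n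
          by (simp del: vector_add_component vector_scaleR_component)
        moreover have "a * ?Y (\<gamma> t) $ i + c \<le> 0"
          using \<rho>1(4)[of "\<gamma> t" \<epsilon>] near1[of t] t n \<rho>(3) \<epsilon> \<delta>(4) by auto
        ultimately show "\<exists>y. ((\<lambda>t. a * \<gamma> t $ i + c * t) has_real_derivative y) (at t) \<and> y \<le> 0" by blast
      qed (use \<tau>(1) in auto)
      moreover have "\<bar>\<gamma> T0 $ i\<bar> \<le> \<eta>'"
        using component_le_norm_cart[of "\<gamma> T0 - \<phi> T0" i] near[of T0] n T0 \<tau>(1) target(2)
        by (auto simp: dist_norm)
      then have "a * \<gamma> T0 $ i \<le> \<bar>a\<bar> * \<eta>'"
        by (metis abs_ge_self abs_mult mult_left_mono abs_ge_zero order_trans)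
      ultimately have "a * \<gamma> (T0 + \<tau>) $ i < 0" using a\<eta>' by (simp add: algebra_simps)
      moreover have "0 \<le> a * \<gamma> (T0 + \<tau>) $ i"
        using n upos[of "T0 + \<tau>"] \<gamma>ij(2) T0 \<tau>(1) by (cases "T = T0 + \<tau>") auto
      ultimately show False by simp
    qed
    have "\<gamma> t \<in> Q" if t: "0 < t" "t < T" for t
    proof -
      consider "t \<le> \<tau>" | "\<tau> \<le> t" "t \<le> T0 - \<tau>" | "T0 - \<tau> \<le> t" by linarith
      then show ?thesis
      proof cases
        case 1
        \<comment> \<open>The orbit starts on the boundary of the quadrant, so closeness to the arc
          says nothing about the sign of this coordinate; its positive derivative does.\<close>
        have "b * \<gamma> 0 $ j < b * \<gamma> t $ j"
        proof (rule DERIV_pos_imp_increasing_open[of 0 t "\<lambda>t. b * \<gamma> t $ j"])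
          show "continuous_on {0..t} (\<lambda>t. b * \<gamma> t $ j)"
            using continuous_on_subset[OF cont\<gamma>, of "{0..t}"] t by (intro continuous_intros) auto
          fix s assume "0 < s" "s < t"
          then show "\<exists>y. ((\<lambda>t. b * \<gamma> t $ j) has_real_derivative y) (at s) \<and> 0 < y"
            using solution_component_derivative[OF \<gamma>, of s b j] pos0[of s] t 1 by auto
        qed (use t in auto)
        then show ?thesis using pos0[of t] t 1 \<gamma>ij by (simp add: quadrant_def)
      next
        case 2
        then show ?thesis using mid t by auto
      next
        case 3
        then show ?thesis
          using \<rho>1(4)[of "\<gamma> t" \<epsilon>] near1[of t] t T_upper \<rho>(3) \<epsilon> \<delta>(4) upos[of t] by (simp add: quadrant_def)
      qed
    qed
    moreover have "dist (\<gamma> t) (\<phi> (min t T0)) < \<eta>" if "0 \<le> t" "t \<le> T" for t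
    proof (cases "t \<le> T0")
      case True
      then show ?thesis using near[of t] that \<eta>'(6) by auto
    next
      case False
      then show ?thesis using near1[of t] that T_upper \<rho>(2) \<tau>(1) by auto
    qed
    moreover have "dist (\<gamma> T) (\<phi> T0) < \<eta>" using near1[of T] T_lower T_upper \<rho>(2) by auto
    moreover have "\<bar>T - T0\<bar> < \<eta>" using T_lower T_upper \<tau>(5) by auto
    ultimately show ?thesis by auto
  qed
  then show ?thesis using \<delta>(1) by blast
qed

text \<open>Along the perturbed orbit the derivative of \<open>H\<close> is DH (X + \<epsilon> g) =
  \<epsilon> DH g, as DH X = 0 in the quadrant. The quotient is thus exactly the integral of DH g
  over the perturbed orbit, and only the convergence of this integral is at stake.\<close>

lemma crossing_integral_ratio:
  fixes H :: "real ^ 'n \<Rightarrow> 'b::euclidean_space"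
  assumes H: "C1_on W H H'" and W: "Q \<subseteq> W" "\<phi> 0 \<in> W" "\<phi> T0 \<in> W"
    and first_integral: "\<And>x. x \<in> Q \<Longrightarrow> blinfun_apply (H' x) (X x) = 0" and "e > 0"
  shows "\<exists>\<delta>>0. \<forall>\<epsilon> T \<gamma>. 0 < \<epsilon> \<longrightarrow> \<epsilon> < \<delta> \<longrightarrow> cross \<epsilon> T \<gamma> \<longrightarrow> dist (\<gamma> 0) (\<phi> 0) < \<delta> \<longrightarrow>
    norm ((H (\<gamma> T) - H (\<gamma> 0)) /\<^sub>R \<epsilon> - integral {0..T0} (\<lambda>t. blinfun_apply (H' (\<phi> t)) (g (\<phi> t)))) < e"
proof -
  define K where "K = (\<lambda>x. blinfun_apply (H' x) (g x))"
  have contK: "continuous_on W K"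
    unfolding K_def using C1_onD(2)[OF H] continuous_on_subset[OF g]
    by (intro continuous_intros) auto
  have openW: "open W" using C1_onD(1)[OF H] .
  have cont\<phi>: "continuous_on {0..T0} \<phi>" using solves_continuous_on[OF sol] .
  have \<phi>W: "\<phi> t \<in> W" if "t \<in> {0..T0}" for t
    using inside[of t] W that by (cases "t = 0 \<or> t = T0") (auto simp: quadrant_def)
  \<comment> \<open>One half of \<open>e\<close> pays for the difference of the integrands over a
    length of at most \<open>T0 + 1\<close>, the other half for replacing the upper limit
    \<open>T\<close> by \<open>T0\<close>.\<close>
  define e1 where "e1 = e / (2 * (T0 + 2))"
  have e1: "e1 > 0" using \<open>e > 0\<close> T0 by (simp add: e1_def)
  obtain d where d: "d > 0" "\<And>x y. x \<in> \<phi> ` {0..T0} \<Longrightarrow> dist x y < d \<Longrightarrow> y \<in> W \<and> dist (K x) (K y) < e1"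
    by (rule compact_uniform_continuity[OF contK openW compact_continuous_image[OF cont\<phi> compact_Icc] _ e1])
      (use \<phi>W in blast)+
  \<comment> \<open>The perturbed crossing time may exceed \<open>T0\<close>, so the arc is
    continued by its end point.\<close>
  define \<psi> where "\<psi> t = \<phi> (min t T0)" for t
  have \<psi>: "\<psi> t \<in> \<phi> ` {0..T0}" if "0 \<le> t" for t using that T0 by (auto simp: \<psi>_def)
  have cont\<psi>: "continuous_on {0..T} (\<lambda>t. K (\<psi> t))" for T
  proof -
    have "continuous_on {0..T} \<psi>"
      unfolding \<psi>_def using T0 by (intro continuous_on_compose2[OF cont\<phi>] continuous_intros) auto
    moreover have "\<psi> t \<in> W" if "0 \<le> t" for t using \<psi>[OF that] \<phi>W by auto
    ultimately show ?thesis by (intro continuous_on_compose2[OF contK]) auto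
  qed
  have "continuous_on {0..T0 + 1} (\<lambda>T. integral {0..T} (\<lambda>t. K (\<psi> t)))"
    using cont\<psi>[of "T0 + 1"] by (intro indefinite_integral_continuous_1 integrable_continuous_real)
  then obtain d2 where d2: "d2 > 0" "\<And>T. T \<in> {0..T0 + 1} \<Longrightarrow> dist T T0 < d2 \<Longrightarrow>
      dist (integral {0..T} (\<lambda>t. K (\<psi> t))) (integral {0..T0} (\<lambda>t. K (\<psi> t))) < e / 2"
    using \<open>e > 0\<close> T0 unfolding continuous_on_iff
    by (metis (mono_tags, lifting) atLeastAtMost_iff half_gt_zero le_add_same_cancel1 less_eq_real_def zero_le_one)
  define \<eta> where "\<eta> = min (min d d2) 1"
  have \<eta>: "\<eta> > 0" "\<eta> \<le> d" "\<eta> \<le> d2" "\<eta> \<le> 1" using d(1) d2(1) by (auto simp: \<eta>_def)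
  obtain \<delta> where \<delta>: "\<delta> > 0" "\<forall>\<epsilon> T \<gamma>. 0 \<le> \<epsilon> \<longrightarrow> \<epsilon> < \<delta> \<longrightarrow> cross \<epsilon> T \<gamma> \<longrightarrow> dist (\<gamma> 0) (\<phi> 0) < \<delta> \<longrightarrow>
      \<bar>T - T0\<bar> < \<eta> \<and> dist (\<gamma> T) (\<phi> T0) < \<eta> \<and> \<gamma> ` {0<..<T} \<subseteq> Q \<and>
      (\<forall>t\<in>{0..T}. dist (\<gamma> t) (\<phi> (min t T0)) < \<eta>)"
    using crossing_near_arc[OF \<eta>(1)] by blast
  have "norm ((H (\<gamma> T) - H (\<gamma> 0)) /\<^sub>R \<epsilon> - integral {0..T0} (\<lambda>t. K (\<phi> t))) < e"
    if \<epsilon>: "0 < \<epsilon>" "\<epsilon> < \<delta>" and cr: "cross \<epsilon> T \<gamma>" and \<gamma>0: "dist (\<gamma> 0) (\<phi> 0) < \<delta>" for \<epsilon> T \<gamma>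
  proof -
    have T: "0 < T" and \<gamma>: "solves (\<lambda>x. X x + \<epsilon> *\<^sub>R g x) \<gamma> {0..T}"
      using cr by (auto simp: crossing_def)
    have *: "\<bar>T - T0\<bar> < \<eta>" "\<And>t. 0 < t \<Longrightarrow> t < T \<Longrightarrow> \<gamma> t \<in> Q"
      "\<And>t. t \<in> {0..T} \<Longrightarrow> dist (\<psi> t) (\<gamma> t) < \<eta>"
      using \<delta>(2)[rule_format, of \<epsilon> T \<gamma>] \<epsilon> cr \<gamma>0 by (auto simp: \<psi>_def dist_commute)
    have \<gamma>W: "\<gamma> t \<in> W" "norm (K (\<gamma> t) - K (\<psi> t)) < e1" if "t \<in> {0..T}" for t
      using d(2)[OF \<psi>, of t "\<gamma> t"] *(3)[OF that] that \<eta>(2) by (auto simp: dist_norm norm_minus_commute)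
    \<comment> \<open>The identity \<open>first_integral\<close> is available in the open quadrant,
      that is at inner times; at the two ends continuity of \<open>H\<close> along the orbit is
      enough.\<close>
    have "((\<lambda>t. \<epsilon> *\<^sub>R K (\<gamma> t)) has_integral H (\<gamma> T) - H (\<gamma> 0)) {0..T}"
    proof (rule fundamental_theorem_of_calculus_interior)
      show "continuous_on {0..T} (\<lambda>t. H (\<gamma> t))"
        using \<gamma>W(1)
        by (intro continuous_on_compose2[OF C1_on_continuous_on[OF H] solves_continuous_on[OF \<gamma>]]) blast
      fix t assume t: "t \<in> {0<..<T}"
      have "((\<lambda>t. H (\<gamma> t)) has_vector_derivative blinfun_apply (H' (\<gamma> t)) (X (\<gamma> t) + \<epsilon> *\<^sub>R g (\<gamma> t))) (at t)"
        using has_derivative_compose[OF solves_interior[OF \<gamma>, of t, unfolded has_vector_derivative_def]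
            C1_onD(3)[OF H \<gamma>W(1)[of t]]] t
        by (simp add: has_vector_derivative_def blinfun.scaleR_right)
      then show "((\<lambda>t. H (\<gamma> t)) has_vector_derivative \<epsilon> *\<^sub>R K (\<gamma> t)) (at t)"
        using first_integral[OF *(2)] t by (simp add: K_def blinfun.add_right blinfun.scaleR_right)
    qed (use T in auto)
    from has_integral_cmul[OF this, of "inverse \<epsilon>"]
    have "((\<lambda>t. K (\<gamma> t)) has_integral (H (\<gamma> T) - H (\<gamma> 0)) /\<^sub>R \<epsilon>) {0..T}"
      using \<epsilon> by simp
    moreover have "((\<lambda>t. K (\<psi> t)) has_integral integral {0..T} (\<lambda>t. K (\<psi> t))) {0..T}"
      using cont\<psi>[of T] by (intro integrable_integral integrable_continuous_real)
    ultimately have "((\<lambda>t. K (\<gamma> t) - K (\<psi> t)) has_integral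
        (H (\<gamma> T) - H (\<gamma> 0)) /\<^sub>R \<epsilon> - integral {0..T} (\<lambda>t. K (\<psi> t))) {0..T}"
      by (rule has_integral_diff)
    then have "norm ((H (\<gamma> T) - H (\<gamma> 0)) /\<^sub>R \<epsilon> - integral {0..T} (\<lambda>t. K (\<psi> t))) \<le> e1 * measure lborel {0..T}"
      using e1 \<gamma>W(2) by (intro has_integral_bound_real[where f="\<lambda>t. K (\<gamma> t) - K (\<psi> t)"]) (auto intro: less_imp_le)
    also have "\<dots> = e1 * T" using T by simp
    also have "\<dots> \<le> e1 * (T0 + 1)" using *(1) \<eta>(4) e1 by (intro mult_left_mono) auto
    also have "\<dots> < e / 2" using \<open>e > 0\<close> T0 by (simp add: e1_def field_simps)
    finally have "norm ((H (\<gamma> T) - H (\<gamma> 0)) /\<^sub>R \<epsilon> - integral {0..T} (\<lambda>t. K (\<psi> t))) < e / 2" .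
    moreover have "norm (integral {0..T} (\<lambda>t. K (\<psi> t)) - integral {0..T0} (\<lambda>t. K (\<psi> t))) < e / 2"
      using d2(2)[of T] *(1) \<eta> T by (auto simp: dist_norm)
    moreover have "integral {0..T0} (\<lambda>t. K (\<psi> t)) = integral {0..T0} (\<lambda>t. K (\<phi> t))"
      by (rule integral_cong) (auto simp: \<psi>_def)
    ultimately show ?thesis
      using norm_triangle_ineq[of "(H (\<gamma> T) - H (\<gamma> 0)) /\<^sub>R \<epsilon> - integral {0..T} (\<lambda>t. K (\<psi> t))"
        "integral {0..T} (\<lambda>t. K (\<psi> t)) - integral {0..T0} (\<lambda>t. K (\<psi> t))"] by simp
  qed
  then show ?thesis using \<delta>(1) by (auto simp: K_def)
qed

end

subsection \<open>Jacobians restricted to a coordinate hyperplane\<close>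

lemma C1_on_jacobian:
  fixes H :: "real ^ 'n \<Rightarrow> real ^ 'm"
  assumes "C1_on W H H'" "x \<in> W"
  shows "jacobian H (at x) *v v = blinfun_apply (H' x) v"
proof -
  have "frechet_derivative H (at x) = blinfun_apply (H' x)"
    using C1_onD(3)[OF assms] frechet_derivative_at by metis
  then show ?thesis
    by (simp add: jacobian_def matrix_works bounded_linear.linear blinfun.bounded_linear_right)
qed

text \<open>The map \<iota> enumerates the columns to be kept, so that \<open>drop_col1\<close> and
  \<open>drop_col2\<close> become instances of one operation, and the two switching planes instances
  of one locale.\<close>

definition sel_cols :: "('m \<Rightarrow> 'n) \<Rightarrow> real ^ 'n ^ 'm \<Rightarrow> real ^ 'm ^ 'm" where
  "sel_cols \<iota> \<Phi> = (\<chi> a b. \<Phi> $ a $ \<iota> b)"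

definition sel :: "('m \<Rightarrow> 'n) \<Rightarrow> real ^ 'n \<Rightarrow> real ^ 'm" where
  "sel \<iota> x = (\<chi> b. x $ \<iota> b)"

text \<open>In the locale below, where \<open>range \<iota>\<close> misses exactly \<open>i\<close>,
  this map and \<open>sel\<close> are the linear chart of the hyperplane \<open>x $ i = 0\<close>
  and its inverse.\<close>

definition unsel :: "('m \<Rightarrow> 'n) \<Rightarrow> real ^ 'm \<Rightarrow> real ^ 'n" where
  "unsel \<iota> u = (\<chi> k. if k \<in> range \<iota> then u $ inv \<iota> k else 0)"

locale hyperplane =
  fixes \<iota> :: "'m::finite \<Rightarrow> 'n::finite" and i :: 'n
  assumes inj: "inj \<iota>" and range: "range \<iota> = - {i}"
begin

lemma unsel_sel: "x $ i = 0 \<Longrightarrow> unsel \<iota> (sel \<iota> x) = x"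
  by (auto simp: unsel_def sel_def vec_eq_iff range f_inv_into_f)

lemma unsel_component: "unsel \<iota> u $ i = 0"
  by (simp add: unsel_def range)

lemma sel_unsel: "sel \<iota> (unsel \<iota> u) = u"
  using inj by (simp add: unsel_def sel_def vec_eq_iff)

lemma linear_unsel: "linear (unsel \<iota>)"
  by (rule linearI) (auto simp: unsel_def vec_eq_iff)

lemma linear_sel: "linear (sel \<iota>)"
  by (rule linearI) (auto simp: sel_def vec_eq_iff)

lemma mult_on_hyperplane:
  assumes "x $ i = 0"
  shows "\<Phi> *v x = sel_cols \<iota> \<Phi> *v sel \<iota> x"
proof -
  have "(\<Sum>k\<in>UNIV. \<Phi> $ a $ k * x $ k) = (\<Sum>k\<in>range \<iota>. \<Phi> $ a $ k * x $ k)" for a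
    using assms range by (intro sum.mono_neutral_right) auto
  also have "\<dots> a = (\<Sum>b\<in>UNIV. \<Phi> $ a $ \<iota> b * x $ \<iota> b)" for a
    using inj by (subst sum.reindex) auto
  finally show ?thesis by (simp add: vec_eq_iff matrix_vector_mult_def sel_cols_def sel_def)
qed

lemma sel_eq_matrix_inv:
  assumes "x $ i = 0" "det (sel_cols \<iota> \<Phi>) \<noteq> 0"
  shows "sel \<iota> x = matrix_inv (sel_cols \<iota> \<Phi>) *v (\<Phi> *v x)"
proof -
  have "\<exists>B. sel_cols \<iota> \<Phi> ** B = mat 1 \<and> B ** sel_cols \<iota> \<Phi> = mat 1"
    using assms(2) by (simp add: invertible_det_nz[symmetric] invertible_def)
  then have "matrix_inv (sel_cols \<iota> \<Phi>) ** sel_cols \<iota> \<Phi> = mat 1"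
    unfolding matrix_inv_def by (rule someI2_ex) blast
  then show ?thesis using assms(1) by (simp add: mult_on_hyperplane matrix_vector_mul_assoc)
qed

text \<open>This turns (A3) into transversality of the field: the field lies in the kernel of the
  Jacobian of the first integrals, and on vectors of the hyperplane that Jacobian acts as the
  invertible matrix \<open>sel_cols \<iota> \<Phi>\<close>.\<close>

lemma kernel_transversal:
  assumes "det (sel_cols \<iota> \<Phi>) \<noteq> 0" "\<Phi> *v x = 0" "x \<noteq> 0"
  shows "x $ i \<noteq> 0"
proof
  assume "x $ i = 0"
  then have "sel \<iota> x = 0" using sel_eq_matrix_inv assms by (metis matrix_vector_mult_0_right)
  then show False using unsel_sel[OF \<open>x $ i = 0\<close>] linear_0[OF linear_unsel] assms(3) by metis
qed

text \<open>In the chart \<open>unsel \<iota>\<close> the restriction of \<open>H\<close> to the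
  hyperplane is a map between spaces of equal dimension, whose derivative is injective by the
  determinant condition.\<close>

lemma hyperplane_open_mapping:
  fixes H :: "real ^ 'n \<Rightarrow> real ^ 'm"
  assumes H: "C1_on W H H'" and Q: "Q \<in> W" "Q $ i = 0"
    and det: "det (sel_cols \<iota> (jacobian H (at Q))) \<noteq> 0" and "r > 0"
  shows "\<exists>d>0. \<forall>h. dist h (H Q) < d \<longrightarrow> (\<exists>x. dist x Q < r \<and> x $ i = 0 \<and> H x = h)"
proof -
  have bl: "bounded_linear (unsel \<iota>)" using linear_unsel linear_conv_bounded_linear by blast
  then have apply_unsel: "blinfun_apply (Blinfun (unsel \<iota>)) = unsel \<iota>" by (rule bounded_linear_Blinfun_apply)
  let ?V = "unsel \<iota> -` W"
  let ?f = "\<lambda>u. H (unsel \<iota> u)"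
  let ?f' = "\<lambda>u. H' (unsel \<iota> u) o\<^sub>L Blinfun (unsel \<iota>)"
  have cont: "continuous_on S (unsel \<iota>)" for S using linear_continuous_on[OF bl] .
  have C1: "C1_on ?V ?f ?f'"
    unfolding C1_on_def
  proof (intro conjI ballI)
    show "open ?V" using open_vimage[OF C1_onD(1)[OF H]] cont by blast
    show "continuous_on ?V ?f'"
      by (intro continuous_intros continuous_on_compose2[OF C1_onD(2)[OF H] cont]) auto
    fix u assume "u \<in> ?V"
    then have 1: "(H has_derivative blinfun_apply (H' (unsel \<iota> u))) (at (unsel \<iota> u))"
      using C1_onD(3)[OF H] by simp
    have 2: "(unsel \<iota> has_derivative unsel \<iota>) (at u)" using bl by (rule bounded_linear_imp_has_derivative)
    have "blinfun_apply (?f' u) = (\<lambda>v. blinfun_apply (H' (unsel \<iota> u)) (unsel \<iota> v))"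
      by (simp add: fun_eq_iff apply_unsel)
    then show "(?f has_derivative blinfun_apply (?f' u)) (at u)"
      using has_derivative_compose[OF 2 1] by metis
  qed
  let ?u = "sel \<iota> Q"
  have Qu: "unsel \<iota> ?u = Q" using unsel_sel Q by blast
  have ker: "v = 0" if "blinfun_apply (?f' ?u) v = 0" for v
  proof (rule ccontr)
    assume "v \<noteq> 0"
    then have "unsel \<iota> v \<noteq> 0" using sel_unsel linear_0[OF linear_sel] by metis
    moreover have "jacobian H (at Q) *v unsel \<iota> v = 0"
      using that C1_on_jacobian[OF H Q(1)] by (simp add: Qu apply_unsel)
    ultimately show False using kernel_transversal[OF det] unsel_component by blast
  qed
  obtain s where s: "s > 0" "\<And>u. dist u ?u < s \<Longrightarrow> dist (unsel \<iota> u) Q < r"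
    using cont[of UNIV] \<open>r > 0\<close> Qu unfolding continuous_on_iff by (metis UNIV_I)
  obtain d where d: "d > 0" "ball (?f ?u) d \<subseteq> ?f ` ball ?u s"
    using C1_on_open_mapping[OF C1 _ ker s(1)] Q(1) Qu by (metis vimageI)
  have "\<exists>x. dist x Q < r \<and> x $ i = 0 \<and> H x = h" if "dist h (H Q) < d" for h
  proof -
    have "h \<in> ?f ` ball ?u s" using d(2) that Qu by (auto simp: dist_commute)
    then obtain u where "dist u ?u < s" "h = ?f u" by (auto simp: dist_commute)
    then show ?thesis using s(2) unsel_component by blast
  qed
  then show ?thesis using d(1) by blast
qed

end

text \<open>The strict derivative allows both points to move. Its error is small relative to |y -
  z|, and it stays small after division by \<open>k\<close> because the displacement quotient is
  bounded.\<close>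

lemma C1_on_difference_quotient:
  assumes K: "C1_on W K K'" "Q \<in> W" and lim: "(y \<longlongrightarrow> Q) F" "(z \<longlongrightarrow> Q) F"
    and bound: "\<forall>\<^sub>F s in F. norm ((y s - z s) /\<^sub>R k s) \<le> M"
  shows "((\<lambda>s. (K (y s) - K (z s)) /\<^sub>R k s - blinfun_apply (K' Q) ((y s - z s) /\<^sub>R k s)) \<longlongrightarrow> 0) F"
proof (rule tendstoI)
  fix e :: real assume "e > 0"
  \<comment> \<open>Positive, so that one may divide by it, and strictly above \<open>M\<close>, for
    the strict inequality at the end.\<close>
  define M' where "M' = \<bar>M\<bar> + 1"
  have M': "M' > 0" "M < M'" by (auto simp: M'_def)
  obtain d where d: "d > 0" "\<forall>y\<in>ball Q d. \<forall>z\<in>ball Q d.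
      norm (K y - K z - blinfun_apply (K' Q) (y - z)) \<le> e / M' * norm (y - z)"
    using C1_on_strict_derivative[OF K divide_pos_pos[OF \<open>e > 0\<close> M'(1)]] by blast
  have "\<forall>\<^sub>F s in F. y s \<in> ball Q d" "\<forall>\<^sub>F s in F. z s \<in> ball Q d"
    using tendstoD[OF lim(1) d(1)] tendstoD[OF lim(2) d(1)] by (auto simp: dist_commute)
  then show "\<forall>\<^sub>F s in F. dist ((K (y s) - K (z s)) /\<^sub>R k s - blinfun_apply (K' Q) ((y s - z s) /\<^sub>R k s)) 0 < e"
    using bound
  proof eventually_elim
    case (elim s)
    have "norm ((K (y s) - K (z s)) /\<^sub>R k s - blinfun_apply (K' Q) ((y s - z s) /\<^sub>R k s)) =
        norm ((K (y s) - K (z s) - blinfun_apply (K' Q) (y s - z s)) /\<^sub>R k s)"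
      unfolding blinfun.scaleR_right[of "K' Q" _ "y s - z s"] by (simp only: scaleR_diff_right)
    also have "\<dots> \<le> \<bar>inverse (k s)\<bar> * (e / M' * norm (y s - z s))"
      using d(2)[rule_format, OF elim(1,2)] by (simp only: norm_scaleR mult_left_mono abs_ge_zero)
    also have "\<dots> = e / M' * norm ((y s - z s) /\<^sub>R k s)" by (simp only: norm_scaleR mult.left_commute)
    also have "\<dots> \<le> e / M' * M" using elim(3) \<open>e > 0\<close> M'(1) by (intro mult_left_mono) auto
    also have "\<dots> < e / M' * M'" using \<open>e > 0\<close> M' by (intro mult_strict_left_mono) auto
    finally show ?case using M'(1) by simp
  qed
qed

context hyperplane
begin

text \<open>On the hyperplane \<open>x\<close> is recovered from its image by a linear map, the
  inverse matrix followed by the chart; \<open>c\<close> is the reciprocal of a bound for this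
  map.\<close>

lemma hyperplane_lower_bound:
  fixes \<Phi> :: "real ^ 'n ^ 'm"
  assumes "det (sel_cols \<iota> \<Phi>) \<noteq> 0"
  obtains c where "c > 0" "\<And>x. x $ i = 0 \<Longrightarrow> c * norm x \<le> norm (\<Phi> *v x)"
proof -
  let ?L = "\<lambda>w. unsel \<iota> (matrix_inv (sel_cols \<iota> \<Phi>) *v w)"
  have "linear ?L" using linear_compose[OF matrix_vector_mul_linear linear_unsel] by (simp add: comp_def)
  then obtain B where B: "B > 0" "\<And>w. norm (?L w) \<le> B * norm w"
    using linear_bounded_pos by blast
  have "inverse B * norm x \<le> norm (\<Phi> *v x)" if "x $ i = 0" for x
    using B(2)[of "\<Phi> *v x"] B(1) sel_eq_matrix_inv[OF that assms] unsel_sel[OF that]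
    by (simp add: field_simps)
  then show thesis using that[of "inverse B"] B(1) by auto
qed

text \<open>Applied to \<open>A\<^sub>\<epsilon> h \<epsilon>\<close> and \<open>A h\<close>, this
  turns equality of levels into equality of points, so that the orbit closes.\<close>

lemma hyperplane_inj:
  fixes H :: "real ^ 'n \<Rightarrow> real ^ 'm"
  assumes H: "C1_on W H H'" and Q: "Q \<in> W"
    and det: "det (sel_cols \<iota> (jacobian H (at Q))) \<noteq> 0"
  obtains r where "r > 0" "\<And>x y. dist x Q < r \<Longrightarrow> dist y Q < r \<Longrightarrow> x $ i = 0 \<Longrightarrow> y $ i = 0 \<Longrightarrow> H x = H y \<Longrightarrow> x = y"
proof -
  obtain c where c: "c > 0" "\<And>x. x $ i = 0 \<Longrightarrow> c * norm x \<le> norm (jacobian H (at Q) *v x)"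
    using hyperplane_lower_bound[OF det] by blast
  obtain d where d: "d > 0" "\<forall>y\<in>ball Q d. \<forall>z\<in>ball Q d.
      norm (H y - H z - blinfun_apply (H' Q) (y - z)) \<le> c / 2 * norm (y - z)"
    using C1_on_strict_derivative[OF H Q half_gt_zero[OF c(1)]] by blast
  show thesis
  proof (rule that[OF d(1)])
    fix x y assume *: "dist x Q < d" "dist y Q < d" "x $ i = 0" "y $ i = 0" "H x = H y"
    then have "norm (blinfun_apply (H' Q) (x - y)) \<le> c / 2 * norm (x - y)"
      using d(2)[rule_format, of x y] by (simp add: dist_commute)
    moreover have "c * norm (x - y) \<le> norm (blinfun_apply (H' Q) (x - y))"
      using c(2)[of "x - y"] * C1_on_jacobian[OF H Q] by simp
    ultimately have "c * norm (x - y) \<le> c / 2 * norm (x - y)" by linarith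
    then show "x = y" using c(1) by (auto simp: mult_le_cancel_right)
  qed
qed

text \<open>Each use contributes one pair of matrices to the formula. To first order a displacement
  within the hyperplane is determined by the change of \<open>H\<close>, and it determines the
  change of \<open>K\<close>; the scale \<open>k\<close> is \<epsilon> in the application.\<close>

lemma hyperplane_transfer:
  fixes H K :: "real ^ 'n \<Rightarrow> real ^ 'm"
  assumes H: "C1_on W H H'" "Q \<in> W" and K: "C1_on W' K K'" "Q \<in> W'"
    and det: "det (sel_cols \<iota> (jacobian H (at Q))) \<noteq> 0"
    and lim: "(y \<longlongrightarrow> Q) F" "(z \<longlongrightarrow> Q) F"
    and plane: "\<forall>\<^sub>F s in F. y s $ i = 0" "\<forall>\<^sub>F s in F. z s $ i = 0"
    and w: "((\<lambda>s. (H (y s) - H (z s)) /\<^sub>R k s) \<longlongrightarrow> w) F"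
  shows "((\<lambda>s. (K (y s) - K (z s)) /\<^sub>R k s) \<longlongrightarrow>
    (sel_cols \<iota> (jacobian K (at Q)) ** matrix_inv (sel_cols \<iota> (jacobian H (at Q)))) *v w) F"
proof -
  let ?P = "matrix_inv (sel_cols \<iota> (jacobian H (at Q)))"
  define q where "q s = (y s - z s) /\<^sub>R k s" for s
  obtain c where c: "c > 0" "\<And>x. x $ i = 0 \<Longrightarrow> c * norm x \<le> norm (jacobian H (at Q) *v x)"
    using hyperplane_lower_bound[OF det] by blast
  obtain d where d: "d > 0" "\<forall>y\<in>ball Q d. \<forall>z\<in>ball Q d.
      norm (H y - H z - blinfun_apply (H' Q) (y - z)) \<le> c / 2 * norm (y - z)"
    using C1_on_strict_derivative[OF H half_gt_zero[OF c(1)]] by blast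
  have "\<forall>\<^sub>F s in F. y s \<in> ball Q d" "\<forall>\<^sub>F s in F. z s \<in> ball Q d"
    using tendstoD[OF lim(1) d(1)] tendstoD[OF lim(2) d(1)] by (auto simp: dist_commute)
  moreover have "\<forall>\<^sub>F s in F. norm ((H (y s) - H (z s)) /\<^sub>R k s) < norm w + 1"
    using order_tendstoD(2)[OF tendsto_norm[OF w]] by simp
  \<comment> \<open>The displacement quotient has to be bounded before anything is known about its
    convergence: on the hyperplane the lower bound \<open>c\<close> for the derivative of
    \<open>H\<close> outweighs the linearisation error \<open>c / 2\<close>.\<close>
  ultimately have bound: "\<forall>\<^sub>F s in F. norm (q s) \<le> 2 / c * (norm w + 1)"
    using plane
  proof eventually_elim
    case (elim s)
    have "c * norm (y s - z s) \<le> norm (blinfun_apply (H' Q) (y s - z s))"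
      using c(2)[of "y s - z s"] elim C1_on_jacobian[OF H] by simp
    also have "\<dots> \<le> norm (H (y s) - H (z s)) + c / 2 * norm (y s - z s)"
      using d(2)[rule_format, OF elim(1,2)] norm_triangle_ineq2[of "blinfun_apply (H' Q) (y s - z s)" "H (y s) - H (z s)"]
      by (simp add: norm_minus_commute)
    finally have "norm (y s - z s) \<le> 2 / c * norm (H (y s) - H (z s))"
      using c(1) by (simp add: field_simps)
    then have "norm (q s) \<le> \<bar>inverse (k s)\<bar> * (2 / c * norm (H (y s) - H (z s)))"
      unfolding q_def by (simp add: mult_left_mono del: times_divide_eq_left)
    also have "\<dots> = 2 / c * norm ((H (y s) - H (z s)) /\<^sub>R k s)" by simp
    also have "\<dots> \<le> 2 / c * (norm w + 1)" using elim(3) c(1) by (intro mult_left_mono) auto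
    finally show ?case .
  qed
  have "((\<lambda>s. (H (y s) - H (z s)) /\<^sub>R k s - ((H (y s) - H (z s)) /\<^sub>R k s - blinfun_apply (H' Q) (q s))) \<longlongrightarrow> w - 0) F"
    using w C1_on_difference_quotient[OF H lim bound[unfolded q_def]] unfolding q_def by (rule tendsto_diff)
  then have "((\<lambda>s. jacobian H (at Q) *v q s) \<longlongrightarrow> w) F"
    by (simp add: C1_on_jacobian[OF H])
  then have "((\<lambda>s. (sel_cols \<iota> (jacobian K (at Q)) ** ?P) *v (jacobian H (at Q) *v q s)) \<longlongrightarrow>
      (sel_cols \<iota> (jacobian K (at Q)) ** ?P) *v w) F"
    by (rule bounded_linear.tendsto[OF matrix_vector_mul_bounded_linear])
  \<comment> \<open>As \<open>q s\<close> is a vector of the hyperplane, the inverse matrix recovers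
    its coordinates from its image under the Jacobian of \<open>H\<close>, and the Jacobian of
    \<open>K\<close> then acts on these coordinates.\<close>
  moreover have "\<forall>\<^sub>F s in F. (sel_cols \<iota> (jacobian K (at Q)) ** ?P) *v (jacobian H (at Q) *v q s) =
      blinfun_apply (K' Q) (q s)"
    using plane
  proof eventually_elim
    case (elim s)
    then have "q s $ i = 0" by (simp add: q_def)
    then show ?case
      using sel_eq_matrix_inv[OF _ det, of "q s"] mult_on_hyperplane[of "q s" "jacobian K (at Q)"] C1_on_jacobian[OF K]
      by (simp add: matrix_vector_mul_assoc[symmetric])
  qed
  ultimately have "((\<lambda>s. blinfun_apply (K' Q) (q s)) \<longlongrightarrow> (sel_cols \<iota> (jacobian K (at Q)) ** ?P) *v w) F"
    by (rule Lim_transform_eventually)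
  from tendsto_add[OF C1_on_difference_quotient[OF K lim bound[unfolded q_def]] this[unfolded q_def]]
  show ?thesis by simp
qed

end

section \<open>Limits of perturbed crossings\<close>

context quadrant_arc
begin

text \<open>Unperturbed arcs become special crossings, so that the limit lemmas also give the
  continuity of \<open>C\<close> and \<open>E\<close> in h.\<close>

lemma crossing_self: "cross 0 T0 \<phi>"
  unfolding crossing_def using T0 sol inside start(3) target(2) by force

text \<open>This is \<open>crossing_near_arc\<close> read along a filter. The first conclusion
  supplies the initial limit for the next leg; the second improves the location from
  \<open>UNIV\<close> to the quadrant.\<close>

lemma reaches_tendsto:
  assumes "(\<epsilon> \<longlongrightarrow> 0) F" "\<forall>\<^sub>F s in F. 0 \<le> \<epsilon> s" "\<forall>\<^sub>F s in F. reaches X g i j UNIV (\<epsilon> s) (x s) (y s)"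
    and "(x \<longlongrightarrow> \<phi> 0) F"
  shows "(y \<longlongrightarrow> \<phi> T0) F" "\<forall>\<^sub>F s in F. reaches X g i j Q (\<epsilon> s) (x s) (y s)"
proof -
  have main: "\<forall>\<^sub>F s in F. dist (y s) (\<phi> T0) < \<eta> \<and> reaches X g i j Q (\<epsilon> s) (x s) (y s)" if "\<eta> > 0" for \<eta>
  proof -
    obtain \<delta> where \<delta>: "\<delta> > 0" "\<forall>\<epsilon> T \<gamma>. 0 \<le> \<epsilon> \<longrightarrow> \<epsilon> < \<delta> \<longrightarrow> cross \<epsilon> T \<gamma> \<longrightarrow> dist (\<gamma> 0) (\<phi> 0) < \<delta> \<longrightarrow>
        \<bar>T - T0\<bar> < \<eta> \<and> dist (\<gamma> T) (\<phi> T0) < \<eta> \<and> \<gamma> ` {0<..<T} \<subseteq> Q \<and>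
        (\<forall>t\<in>{0..T}. dist (\<gamma> t) (\<phi> (min t T0)) < \<eta>)"
      using crossing_near_arc[OF \<open>\<eta> > 0\<close>] by blast
    show ?thesis
      using order_tendstoD(2)[OF assms(1) \<delta>(1)] assms(2,3) tendstoD[OF assms(4) \<delta>(1)]
    proof eventually_elim
      case (elim s)
      then obtain T \<gamma> where "cross (\<epsilon> s) T \<gamma>" "\<gamma> 0 = x s" "\<gamma> T = y s" by (auto simp: reaches_def)
      then show ?case using \<delta>(2)[rule_format, of "\<epsilon> s" T \<gamma>] elim by (auto simp: reaches_def)
    qed
  qed
  show "(y \<longlongrightarrow> \<phi> T0) F"
    by (rule tendstoI) (use main eventually_mono in fast)
  show "\<forall>\<^sub>F s in F. reaches X g i j Q (\<epsilon> s) (x s) (y s)"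
    using main[OF zero_less_one] by (rule eventually_mono) blast
qed

lemma reaches_ratio_tendsto:
  fixes H :: "real ^ 'n \<Rightarrow> 'b::euclidean_space"
  assumes H: "C1_on W H H'" and W: "Q \<subseteq> W" "\<phi> 0 \<in> W" "\<phi> T0 \<in> W"
    and first_integral: "\<And>x. x \<in> Q \<Longrightarrow> blinfun_apply (H' x) (X x) = 0"
    and "(\<epsilon> \<longlongrightarrow> 0) F" "\<forall>\<^sub>F s in F. 0 < \<epsilon> s" "\<forall>\<^sub>F s in F. reaches X g i j UNIV (\<epsilon> s) (x s) (y s)"
    and "(x \<longlongrightarrow> \<phi> 0) F"
  shows "((\<lambda>s. (H (y s) - H (x s)) /\<^sub>R \<epsilon> s) \<longlongrightarrow>
    integral {0..T0} (\<lambda>t. blinfun_apply (H' (\<phi> t)) (g (\<phi> t)))) F"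
proof (rule tendstoI)
  fix e :: real assume "e > 0"
  then obtain \<delta> where \<delta>: "\<delta> > 0" "\<forall>\<epsilon> T \<gamma>. 0 < \<epsilon> \<longrightarrow> \<epsilon> < \<delta> \<longrightarrow> cross \<epsilon> T \<gamma> \<longrightarrow> dist (\<gamma> 0) (\<phi> 0) < \<delta> \<longrightarrow>
    norm ((H (\<gamma> T) - H (\<gamma> 0)) /\<^sub>R \<epsilon> - integral {0..T0} (\<lambda>t. blinfun_apply (H' (\<phi> t)) (g (\<phi> t)))) < e"
    using crossing_integral_ratio[OF H W first_integral] by blast
  show "\<forall>\<^sub>F s in F. dist ((H (y s) - H (x s)) /\<^sub>R \<epsilon> s)
      (integral {0..T0} (\<lambda>t. blinfun_apply (H' (\<phi> t)) (g (\<phi> t)))) < e"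
    using order_tendstoD(2)[OF assms(6) \<delta>(1)] assms(7,8) tendstoD[OF assms(9) \<delta>(1)]
  proof eventually_elim
    case (elim s)
    then obtain T \<gamma> where "cross (\<epsilon> s) T \<gamma>" "\<gamma> 0 = x s" "\<gamma> T = y s" by (auto simp: reaches_def)
    then show ?case using \<delta>(2)[rule_format, of "\<epsilon> s" T \<gamma>] elim by (simp only: dist_norm)
  qed
qed

end

section \<open>Orbital arcs, signs at their ends, and gluing of legs\<close>

lemma first_intersection_reaches:
  assumes "first_intersection (subsystem f g \<epsilon> k) i P Q" "P $ j = 0"
  shows "reaches (f k) (g k) i j UNIV \<epsilon> P Q" "Q $ i = 0"
proof -
  have "subsystem f g \<epsilon> k = (\<lambda>x. f k x + \<epsilon> *\<^sub>R g k x)" by (simp add: fun_eq_iff subsystem_def)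
  then show "reaches (f k) (g k) i j UNIV \<epsilon> P Q"
    using assms unfolding first_intersection_def reaches_def crossing_def by auto
  show "Q $ i = 0" using assms(1) by (auto simp: first_intersection_def)
qed

text \<open>The n - 1 independent rows are orthogonal to \<open>v\<close>, hence form a basis of the
  whole space together with \<open>v\<close>, and \<open>z\<close> is orthogonal to all of it. In
  the application \<open>v\<close> is the field and \<Phi> the Jacobian of the first
  integrals.\<close>

lemma kernel_one_dimensional:
  fixes \<Phi> :: "real ^ 'm::finite option ^ 'm"
  assumes "inj (\<lambda>j. row j \<Phi>)" "independent (rows \<Phi>)"
    and v: "\<Phi> *v v = 0" "v \<noteq> 0" and z: "\<Phi> *v z = 0" "v \<bullet> z = 0"
  shows "z = 0"
proof -
  have row: "row j \<Phi> \<bullet> x = (\<Phi> *v x) $ j" for j x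
    by (simp add: row_def matrix_vector_mult_def inner_vec_def)
  have orth: "x \<bullet> y = 0" if "\<Phi> *v x = 0" "y \<in> rows \<Phi>" for x y
    using that row by (auto simp: rows_def inner_commute)
  have "v \<notin> span (rows \<Phi>)"
  proof
    assume "v \<in> span (rows \<Phi>)"
    then have "orthogonal v v"
      using orth[OF v(1)] by (intro orthogonal_to_span[of v "rows \<Phi>" v]) (auto simp: orthogonal_def)
    then show False using v(2) by (simp add: orthogonal_def)
  qed
  then have ind: "independent (insert v (rows \<Phi>))" and "v \<notin> rows \<Phi>"
    using independent_insertI[OF _ assms(2)] span_base by blast+
  moreover have rows: "rows \<Phi> = range (\<lambda>j. row j \<Phi>)" by (auto simp: rows_def)
  then have "card (rows \<Phi>) = CARD('m)" "finite (rows \<Phi>)" using assms(1) by (auto simp: card_image)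
  ultimately have "card (insert v (rows \<Phi>)) = DIM(real ^ 'm option)" "finite (insert v (rows \<Phi>))"
    by (auto simp: card_UNIV_option)
  then have "UNIV \<subseteq> span (insert v (rows \<Phi>))"
    using ind card_eq_dim[of "insert v (rows \<Phi>)" UNIV] by simp
  then have "orthogonal z z"
    using orth[OF z(1)] z(2)
    by (intro orthogonal_to_span[of z "insert v (rows \<Phi>)" z]) (auto simp: orthogonal_def inner_commute)
  then show ?thesis by (simp add: orthogonal_def)
qed

text \<open>In \<open>orbital_arc\<close> the set \<open>L\<close> is enlarged by the two end
  points; injectivity keeps inner times away from them.\<close>

lemma orbital_arc_interior:
  assumes "orbital_arc X P Q L T \<gamma>" "0 < t" "t < T"
  shows "\<gamma> t \<in> L"
proof -
  have "\<gamma> t \<noteq> \<gamma> 0" "\<gamma> t \<noteq> \<gamma> T"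
    using assms by (auto simp: orbital_arc_def dest: inj_onD)
  moreover have "\<gamma> t \<in> insert (\<gamma> 0) (insert (\<gamma> T) L)"
    using assms unfolding orbital_arc_def by (metis atLeastAtMost_iff image_eqI less_imp_le)
  ultimately show ?thesis by blast
qed

lemma constant_on_Icc:
  fixes q :: "real \<Rightarrow> 'a::t1_space"
  assumes "continuous_on {0..T} q" "0 < T" "\<And>t. 0 < t \<Longrightarrow> t < T \<Longrightarrow> q t = c" "t \<in> {0..T}"
  shows "q t = c"
  using continuous_constant_on_closure[of "{0<..<T}" q c t] assms by auto

text \<open>A coordinate that starts at 0 with negative derivative would become negative at once.
  The sign \<open>a\<close> adapts the statement to each quadrant.\<close>

lemma start_transversal:
  fixes \<gamma> :: "real \<Rightarrow> real ^ 'n"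
  assumes "solves X \<gamma> {0..T}" "0 < T" "a * \<gamma> 0 $ i = 0"
    and "\<And>t. 0 < t \<Longrightarrow> t < T \<Longrightarrow> 0 \<le> a * \<gamma> t $ i" and "a \<noteq> 0" "X (\<gamma> 0) $ i \<noteq> 0"
  shows "0 < a * X (\<gamma> 0) $ i"
proof (rule ccontr)
  assume "\<not> 0 < a * X (\<gamma> 0) $ i"
  then have "a * X (\<gamma> 0) $ i < 0" using assms(5,6) by (metis linorder_neqE_linordered_idom mult_eq_0_iff)
  then obtain d where d: "d > 0" "\<And>h. h > 0 \<Longrightarrow> 0 + h \<in> {0..T} \<Longrightarrow> h < d \<Longrightarrow> a * \<gamma> 0 $ i > a * \<gamma> (0 + h) $ i"
    using has_real_derivative_neg_dec_right[OF solution_component_within[OF assms(1), of 0 a i]] assms(2) by auto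
  obtain s where s: "0 < s" "s < d" "s < T" using field_lbound_gt_zero[OF d(1) assms(2)] by blast
  then have "a * \<gamma> s $ i < 0" using d(2)[of s] assms(3) by auto
  then show False using assms(4)[of s] s by auto
qed

lemma end_transversal:
  fixes \<gamma> :: "real \<Rightarrow> real ^ 'n"
  assumes "solves X \<gamma> {0..T}" "0 < T" "a * \<gamma> T $ i = 0"
    and "\<And>t. 0 < t \<Longrightarrow> t < T \<Longrightarrow> 0 \<le> a * \<gamma> t $ i" and "a \<noteq> 0" "X (\<gamma> T) $ i \<noteq> 0"
  shows "a * X (\<gamma> T) $ i < 0"
proof (rule ccontr)
  assume "\<not> a * X (\<gamma> T) $ i < 0"
  then have "0 < a * X (\<gamma> T) $ i" using assms(5,6) by (metis linorder_neqE_linordered_idom mult_eq_0_iff)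
  then obtain d where d: "d > 0" "\<And>h. h > 0 \<Longrightarrow> T - h \<in> {0..T} \<Longrightarrow> h < d \<Longrightarrow> a * \<gamma> (T - h) $ i < a * \<gamma> T $ i"
    using has_real_derivative_pos_inc_left[OF solution_component_within[OF assms(1), of T a i]] assms(2) by auto
  obtain s where s: "0 < s" "s < d" "s < T" using field_lbound_gt_zero[OF d(1) assms(2)] by blast
  then have "a * \<gamma> (T - s) $ i < 0" using d(2)[of s] assms(3) by auto
  then show False using assms(4)[of "T - s"] s by auto
qed

lemma hyperplane_Some: "hyperplane Some None"
  by unfold_locales (auto simp: notin_range_Some)

lemma hyperplane_swap: "hyperplane (\<lambda>j. if j = p then None else Some j) (Some p)"
proof
  show "inj (\<lambda>j. if j = p then None else Some j)" by (auto simp: inj_def)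
  show "range (\<lambda>j. if j = p then None else Some j) = - {Some p}"
  proof (rule set_eqI)
    fix x show "x \<in> range (\<lambda>j. if j = p then None else Some j) \<longleftrightarrow> x \<in> - {Some p}"
      by (cases x) (auto simp: image_iff)
  qed
qed

lemma drop_col_sel_cols:
  "drop_col1 = sel_cols Some" "drop_col2 p = sel_cols (\<lambda>j. if j = p then None else Some j)"
  by (auto simp: fun_eq_iff drop_col1_def drop_col2_def sel_cols_def)

lemma solves_cong:
  "(\<And>t. t \<in> I \<Longrightarrow> \<gamma> t = \<gamma>' t) \<Longrightarrow> solves X \<gamma> I \<longleftrightarrow> solves X \<gamma>' I"
  unfolding solves_def by (intro ball_cong refl) (metis has_vector_derivative_transform)

lemma solves_shift:
  assumes "solves X \<gamma> {0..T}"
  shows "solves X (\<lambda>t. \<gamma> (t - c)) {c..c + T}"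
  unfolding solves_def
proof
  fix t assume t: "t \<in> {c..c + T}"
  have "((\<lambda>t. t - c) has_vector_derivative 1) (at t within {c..c + T})"
    by (auto intro!: derivative_eq_intros)
  moreover have "(\<gamma> has_vector_derivative X (\<gamma> (t - c))) (at (t - c) within (\<lambda>t. t - c) ` {c..c + T})"
    using assms t by (auto simp: solves_def)
  ultimately show "((\<lambda>t. \<gamma> (t - c)) has_vector_derivative X (\<gamma> (t - c))) (at t within {c..c + T})"
    using vector_diff_chain_within[of "\<lambda>t. t - c" 1 t "{c..c + T}" \<gamma> "X (\<gamma> (t - c))"] by (simp add: comp_def)
qed

text \<open>The legs are shifted to consecutive time intervals and concatenated; they fit together
  since leg \<open>k\<close> ends at the point \<open>P k\<close> from which the next one
  starts.\<close>

lemma closed_orbit_through_reaches: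
  fixes P :: "nat \<Rightarrow> real ^ 'm::finite option"
  assumes "\<And>k. k \<in> {1..4} \<Longrightarrow> reaches (f k) (g k) (i k) (j k) (region p k) \<epsilon> (P (k - 1)) (P k)" "P 4 = P 0"
  shows "closed_orbit_through p f g \<epsilon> (P 0)"
proof -
  have "\<forall>k\<in>{1..4}. \<exists>T \<gamma>. 0 < T \<and> solves (subsystem f g \<epsilon> k) \<gamma> {0..T} \<and> \<gamma> 0 = P (k - 1) \<and> \<gamma> T = P k \<and>
      \<gamma> ` {0<..<T} \<subseteq> region p k"
  proof
    fix k :: nat assume "k \<in> {1..4}"
    moreover have "subsystem f g \<epsilon> k = (\<lambda>x. f k x + \<epsilon> *\<^sub>R g k x)" by (simp add: fun_eq_iff subsystem_def)
    ultimately show "\<exists>T \<gamma>. 0 < T \<and> solves (subsystem f g \<epsilon> k) \<gamma> {0..T} \<and> \<gamma> 0 = P (k - 1) \<and> \<gamma> T = P k \<and>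
        \<gamma> ` {0<..<T} \<subseteq> region p k"
      using assms(1)[of k] unfolding reaches_def crossing_def by auto
  qed
  then obtain T \<gamma> where \<gamma>: "\<And>k. k \<in> {1..4} \<Longrightarrow> 0 < T k \<and> solves (subsystem f g \<epsilon> k) (\<gamma> k) {0..T k} \<and>
      \<gamma> k 0 = P (k - 1) \<and> \<gamma> k (T k) = P k \<and> \<gamma> k ` {0<..<T k} \<subseteq> region p k"
    by metis
  define s where "s k = (\<Sum>l=1..k. T l)" for k
  have s_step: "s k = s (k - 1) + T k" if "k \<in> {1..4}" for k
    using that by (cases k) (auto simp: s_def)
  have s_mono: "s l \<le> s k" if "l \<le> k" "k \<le> 4" for k l
  proof -
    have "0 \<le> T x" if "x \<in> {1..k}" for x using \<gamma>[of x] that \<open>k \<le> 4\<close> by auto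
    then show ?thesis unfolding s_def using that(1) by (intro sum_mono2) auto
  qed
  \<comment> \<open>Up to time \<open>s 4\<close> the least \<open>k\<close> with
    \<open>t \<le> s k\<close> picks the leg whose interval, open on the left and closed on the
    right, contains \<open>t\<close>. A switching time thus belongs to the earlier leg, and
    \<open>k = 0\<close> provides the starting point.\<close>
  define \<Gamma> where "\<Gamma> t = (let k = LEAST k. t \<le> s k in if k = 0 then P 0 else \<gamma> k (t - s (k - 1)))" for t
  have \<Gamma>: "\<Gamma> t = \<gamma> k (t - s (k - 1))" if k: "k \<in> {1..4}" and t: "t \<in> {s (k - 1)..s k}" for k t
  proof (cases "t = s (k - 1)")
    case False
    have "(LEAST k. t \<le> s k) = k"
    proof (rule Least_equality)
      fix l assume l: "t \<le> s l"
      show "k \<le> l"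
      proof (rule ccontr)
        assume "\<not> k \<le> l"
        then have "s l \<le> s (k - 1)" using k by (intro s_mono) auto
        then show False using l t False by auto
      qed
    qed (use t in auto)
    then show ?thesis using k by (auto simp: \<Gamma>_def)
  next
    case True
    have "(LEAST l. t \<le> s l) = k - 1"
    proof (rule Least_equality)
      fix l assume l: "t \<le> s l"
      show "k - 1 \<le> l"
      proof (rule ccontr)
        assume "\<not> k - 1 \<le> l"
        then have "s (k - 1) = s (k - 1 - 1) + T (k - 1)" "0 < T (k - 1)" "s l \<le> s (k - 1 - 1)"
          using k s_step[of "k - 1"] \<gamma>[of "k - 1"] by (auto intro!: s_mono)
        then show False using l True by auto
      qed
    qed (use True in auto)
    \<comment> \<open>At the left end of leg \<open>k\<close> the curve \<Gamma> is still on the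
      preceding leg, whose end is the start of leg \<open>k\<close>.\<close>
    moreover have "\<gamma> (k - 1) (t - s (k - 1 - 1)) = P (k - 1)" if "k - 1 \<noteq> 0"
    proof -
      have "k - 1 \<in> {1..4}" using that k by auto
      from \<gamma>[OF this] s_step[OF this] show ?thesis using True by simp
    qed
    ultimately show ?thesis using \<gamma>[OF k] True by (auto simp: \<Gamma>_def Let_def)
  qed
  have "solves (subsystem f g \<epsilon> k) \<Gamma> {s (k - 1)..s k} \<and> \<Gamma> ` {s (k - 1)<..<s k} \<subseteq> region p k \<and> s (k - 1) < s k"
    if k: "k \<in> {1..4}" for k
  proof (intro conjI)
    show "solves (subsystem f g \<epsilon> k) \<Gamma> {s (k - 1)..s k}"
      using solves_shift[of "subsystem f g \<epsilon> k" "\<gamma> k" "T k" "s (k - 1)"] \<gamma>[OF k] s_step[OF k] \<Gamma>[OF k]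
      by (subst solves_cong[of _ \<Gamma> "\<lambda>t. \<gamma> k (t - s (k - 1))"]) auto
    show "s (k - 1) < s k" using s_step[OF k] \<gamma>[OF k] by auto
    show "\<Gamma> ` {s (k - 1)<..<s k} \<subseteq> region p k"
    proof clarify
      fix t assume t: "t \<in> {s (k - 1)<..<s k}"
      then have "t - s (k - 1) \<in> {0<..<T k}" using s_step[OF k] by auto
      then show "\<Gamma> t \<in> region p k" using \<Gamma>[OF k, of t] \<gamma>[OF k] t by auto
    qed
  qed
  moreover have "s 0 = 0" by (simp add: s_def)
  moreover have "\<Gamma> 0 = P 0" using \<Gamma>[of 1 0] \<gamma>[of 1] s_step[of 1] \<open>s 0 = 0\<close> by auto
  moreover have "\<Gamma> (s 4) = P 0" using \<Gamma>[of 4 "s 4"] \<gamma>[of 4] s_step[of 4] assms(2) by auto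
  ultimately show ?thesis unfolding closed_orbit_through_def by blast
qed

subsection \<open>The unperturbed system\<close>

declare One_nat_def [simp del]

locale switching_system =
  fixes p :: "'m::finite"
    and f g :: "nat \<Rightarrow> real ^ ('m option) \<Rightarrow> real ^ ('m option)"
    and H :: "nat \<Rightarrow> real ^ ('m option) \<Rightarrow> real ^ 'm"
    and U :: "(real ^ ('m option)) set"
    and G :: "(real ^ 'm) set"
    and A B C E :: "real ^ 'm \<Rightarrow> real ^ ('m option)"
    and T :: "nat \<Rightarrow> real ^ 'm \<Rightarrow> real"
    and \<phi> :: "nat \<Rightarrow> real ^ 'm \<Rightarrow> real \<Rightarrow> real ^ ('m option)"
  assumes smooth_fields: "\<forall>k\<in>{1..4}. smooth_on UNIV (f k) \<and> smooth_on UNIV (g k)"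
    and open_U: "open U"
    and smooth_integrals: "\<forall>k\<in>{1..4}. \<exists>W. open W \<and> U \<inter> region p k \<subseteq> W \<and>
          (\<forall>h\<in>G. {A h, B h, C h, E h} \<subseteq> W) \<and> smooth_on W (H k)"
    and first_integrals: "\<forall>k\<in>{1..4}. \<forall>x\<in>U \<inter> region p k. jacobian (H k) (at x) *v f k x = 0"
    and independent_integrals: "\<forall>k\<in>{1..4}. \<forall>x\<in>U \<inter> region p k.
          inj (\<lambda>j. row j (jacobian (H k) (at x))) \<and> independent (rows (jacobian (H k) (at x)))"
    and open_G: "open G"
    and in_U: "\<forall>h\<in>G. {A h, B h, C h, E h} \<subseteq> U"
    and A_plane: "\<forall>h\<in>G. A h $ None = 0 \<and> A h $ Some p > 0"
    and B_plane: "\<forall>h\<in>G. B h $ None > 0 \<and> B h $ Some p = 0"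
    and C_plane: "\<forall>h\<in>G. C h $ None = 0 \<and> C h $ Some p < 0"
    and E_plane: "\<forall>h\<in>G. E h $ None < 0 \<and> E h $ Some p = 0"
    and arc1: "\<forall>h\<in>G. orbital_arc (f 1) (A h) (B h)
          {x \<in> U \<inter> region p 1. H 1 x = h} (T 1 h) (\<phi> 1 h)"
    and arc2: "\<forall>h\<in>G. orbital_arc (f 2) (B h) (C h)
          {x \<in> U \<inter> region p 2. H 2 x = H 2 (B h)} (T 2 h) (\<phi> 2 h)"
    and arc3: "\<forall>h\<in>G. orbital_arc (f 3) (C h) (E h)
          {x \<in> U \<inter> region p 3. H 3 x = H 3 (C h)} (T 3 h) (\<phi> 3 h)"
    and arc4: "\<forall>h\<in>G. orbital_arc (f 4) (E h) (A h)
          {x \<in> U \<inter> region p 4. H 4 x = H 4 (E h)} (T 4 h) (\<phi> 4 h)"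
    and no_critical: "\<forall>h\<in>G. \<forall>k\<in>{1..4}. \<forall>t\<in>{0..T k h}. f k (\<phi> k h t) \<noteq> 0"
    and transversal: "\<forall>h\<in>G. \<forall>k\<in>{1..4}.
          det (drop_col1 (jacobian (H k) (at (A h)))) \<noteq> 0 \<and>
          det (drop_col1 (jacobian (H k) (at (C h)))) \<noteq> 0 \<and>
          det (drop_col2 p (jacobian (H k) (at (B h)))) \<noteq> 0 \<and>
          det (drop_col2 p (jacobian (H k) (at (E h)))) \<noteq> 0"
begin

definition Df :: "nat \<Rightarrow> real ^ ('m option) \<Rightarrow> (real ^ ('m option)) \<Rightarrow>\<^sub>L (real ^ ('m option))" where
  "Df k = (SOME f'. C1_on UNIV (f k) f')"

definition dom :: "nat \<Rightarrow> (real ^ ('m option)) set" where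
  "dom k = (SOME W. open W \<and> U \<inter> region p k \<subseteq> W \<and>
    (\<forall>h\<in>G. {A h, B h, C h, E h} \<subseteq> W) \<and> smooth_on W (H k))"

definition DH :: "nat \<Rightarrow> real ^ ('m option) \<Rightarrow> (real ^ ('m option)) \<Rightarrow>\<^sub>L (real ^ 'm)" where
  "DH k = (SOME H'. C1_on (dom k) (H k) H')"

lemma C1_f: "k \<in> {1..4} \<Longrightarrow> C1_on UNIV (f k) (Df k)"
  unfolding Df_def by (rule someI_ex[OF smooth_on_open_imp_C1_on]) (use smooth_fields in auto)

lemma continuous_g: "k \<in> {1..4} \<Longrightarrow> continuous_on UNIV (g k)"
  using smooth_fields smooth_on_open_imp_C1_on[of UNIV "g k"] C1_on_continuous_on by blast

lemma dom:
  assumes "k \<in> {1..4}"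
  shows "U \<inter> region p k \<subseteq> dom k" "h \<in> G \<Longrightarrow> {A h, B h, C h, E h} \<subseteq> dom k" "C1_on (dom k) (H k) (DH k)"
proof -
  have *: "open (dom k) \<and> U \<inter> region p k \<subseteq> dom k \<and>
      (\<forall>h\<in>G. {A h, B h, C h, E h} \<subseteq> dom k) \<and> smooth_on (dom k) (H k)"
    unfolding dom_def by (rule someI_ex[OF bspec[OF smooth_integrals assms]])
  then show "U \<inter> region p k \<subseteq> dom k" "h \<in> G \<Longrightarrow> {A h, B h, C h, E h} \<subseteq> dom k" by blast+
  show "C1_on (dom k) (H k) (DH k)"
    unfolding DH_def by (rule someI_ex[OF smooth_on_open_imp_C1_on]) (use * in auto)
qed

lemma DH_field:
  assumes "k \<in> {1..4}" "x \<in> U \<inter> region p k"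
  shows "blinfun_apply (DH k x) (f k x) = 0"
  using bspec[OF bspec[OF first_integrals assms(1)] assms(2)] C1_on_jacobian[OF dom(3)[OF assms(1)]]
    subsetD[OF dom(1)[OF assms(1)] assms(2)] by simp

text \<open>Level and kernel identity are given inside the region, while the end points of arcs 2, 3
  and 4 lie outside it. Both are carried to the closed time interval by continuity.\<close>

lemma arc_integral:
  assumes k: "k \<in> {1..4}" and "h \<in> G"
    and arc: "orbital_arc (f k) P Q {x \<in> U \<inter> region p k. H k x = c} (T k h) (\<phi> k h)"
    and PQ: "P \<in> dom k" "Q \<in> dom k"
    and t: "t \<in> {0..T k h}"
  shows "H k (\<phi> k h t) = c" "jacobian (H k) (at (\<phi> k h t)) *v f k (\<phi> k h t) = 0" "\<phi> k h t \<in> dom k"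
proof -
  have T: "0 < T k h" and sol: "solves (f k) (\<phi> k h) {0..T k h}"
    using arc by (auto simp: orbital_arc_def)
  have int: "\<phi> k h t \<in> U \<inter> region p k" "H k (\<phi> k h t) = c" if "0 < t" "t < T k h" for t
    using orbital_arc_interior[OF arc that] by auto
  have mem: "\<phi> k h t \<in> dom k" if "t \<in> {0..T k h}" for t
    using int(1)[of t] PQ arc that dom(1)[OF k] unfolding orbital_arc_def
    by (metis (no_types, lifting) atLeastAtMost_iff less_eq_real_def subsetD)
  note cont = solves_continuous_on[OF sol]
  note C1 = dom(3)[OF k]
  show "H k (\<phi> k h t) = c"
    using mem by (intro constant_on_Icc[OF continuous_on_compose2[OF C1_on_continuous_on[OF C1] cont] T int(2) t]) auto
  have "continuous_on {0..T k h} (\<lambda>t. blinfun_apply (DH k (\<phi> k h t)) (f k (\<phi> k h t)))"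
    using mem by (intro continuous_intros continuous_on_compose2[OF C1_onD(2)[OF C1] cont]
      continuous_on_compose2[OF C1_on_continuous_on[OF C1_f[OF k]] cont]) auto
  from constant_on_Icc[OF this T DH_field[OF k int(1)] t]
  show "jacobian (H k) (at (\<phi> k h t)) *v f k (\<phi> k h t) = 0"
    using C1_on_jacobian[OF C1 mem[OF t]] by simp
  show "\<phi> k h t \<in> dom k" using mem t .
qed

lemma regions: "region p 1 = {x. x $ None \<ge> 0 \<and> x $ Some p \<ge> 0}" "region p 2 = {x. x $ None > 0 \<and> x $ Some p < 0}"
  "region p 3 = {x. x $ None < 0 \<and> x $ Some p < 0}" "region p 4 = {x. x $ None < 0 \<and> x $ Some p > 0}"
  by (simp_all add: region_def)

text \<open>The first region contains its boundary, so here the arc including its end points is the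
  whole level set. The last claim, which says this, identifies points near the switching planes by
  their level.\<close>

lemma arc1_facts:
  assumes "h \<in> G"
  shows "0 < T 1 h" "solves (f 1) (\<phi> 1 h) {0..T 1 h}" "\<phi> 1 h 0 = A h" "\<phi> 1 h (T 1 h) = B h"
    "inj_on (\<phi> 1 h) {0..T 1 h}"
    "t \<in> {0..T 1 h} \<Longrightarrow> \<phi> 1 h t \<in> U \<inter> region p 1"
    "t \<in> {0..T 1 h} \<Longrightarrow> H 1 (\<phi> 1 h t) = h"
    "x \<in> U \<inter> region p 1 \<Longrightarrow> H 1 x = h \<Longrightarrow> \<exists>t\<in>{0..T 1 h}. x = \<phi> 1 h t"
proof -
  note arc = bspec[OF arc1 assms]
  show T: "0 < T 1 h" "solves (f 1) (\<phi> 1 h) {0..T 1 h}" "\<phi> 1 h 0 = A h" "\<phi> 1 h (T 1 h) = B h"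
    "inj_on (\<phi> 1 h) {0..T 1 h}"
    using arc by (auto simp: orbital_arc_def)
  show "t \<in> {0..T 1 h} \<Longrightarrow> H 1 (\<phi> 1 h t) = h"
    using arc_integral(1)[OF _ assms arc] dom(2)[OF _ assms] by auto
  have "A h \<in> U \<inter> region p 1" "B h \<in> U \<inter> region p 1"
    using in_U A_plane B_plane assms by (auto simp: regions less_imp_le)
  then show "t \<in> {0..T 1 h} \<Longrightarrow> \<phi> 1 h t \<in> U \<inter> region p 1"
    using orbital_arc_interior[OF arc, of t] T(3,4) by (cases "t = 0 \<or> t = T 1 h") auto
  assume "x \<in> U \<inter> region p 1" "H 1 x = h"
  then have "x \<in> \<phi> 1 h ` {0..T 1 h}" using arc unfolding orbital_arc_def by blast
  then show "\<exists>t\<in>{0..T 1 h}. x = \<phi> 1 h t" by blast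
qed

text \<open>These signs come ahead of \<open>leg\<close>, before the arc is known to run in the open
  quadrant: they enter the continuity of \<open>A\<close> and \<open>B\<close>, on which
  \<open>arc1_interior\<close> rests.\<close>

lemma f1_transversal:
  assumes "h \<in> G"
  shows "0 < f 1 (A h) $ None" "f 1 (B h) $ Some p < 0"
proof -
  note F = arc1_facts[OF assms]
  have "f 1 (\<phi> 1 h 0) $ None \<noteq> 0"
  proof (rule hyperplane.kernel_transversal[OF hyperplane_Some])
    show "det (sel_cols Some (jacobian (H 1) (at (A h)))) \<noteq> 0"
      using transversal assms by (auto simp: drop_col_sel_cols[symmetric])
    show "jacobian (H 1) (at (A h)) *v f 1 (\<phi> 1 h 0) = 0"
      using first_integrals F(6)[of 0] F(1,3) by auto
    show "f 1 (\<phi> 1 h 0) \<noteq> 0" using no_critical assms F(1) by auto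
  qed
  then have "0 < 1 * f 1 (\<phi> 1 h 0) $ None"
    using F A_plane assms by (intro start_transversal) (auto simp: regions)
  then show "0 < f 1 (A h) $ None" using F(3) by simp
  have "f 1 (\<phi> 1 h (T 1 h)) $ Some p \<noteq> 0"
  proof (rule hyperplane.kernel_transversal[OF hyperplane_swap])
    show "det (sel_cols (\<lambda>j. if j = p then None else Some j) (jacobian (H 1) (at (B h)))) \<noteq> 0"
      using transversal assms by (auto simp: drop_col_sel_cols[symmetric])
    show "jacobian (H 1) (at (B h)) *v f 1 (\<phi> 1 h (T 1 h)) = 0"
      using first_integrals F(6)[of "T 1 h"] F(1,4) by auto
    show "f 1 (\<phi> 1 h (T 1 h)) \<noteq> 0" using no_critical assms F(1) by auto
  qed
  then have "1 * f 1 (\<phi> 1 h (T 1 h)) $ Some p < 0"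
    using F B_plane assms by (intro end_transversal) (auto simp: regions)
  then show "f 1 (B h) $ Some p < 0" using F(4) by simp
qed

text \<open>
  The level arc through \<open>x\<close> cannot continue past \<open>x\<close>, since the field would carry it out of the
  first region there; hence \<open>x\<close> is the end point of the arc.
\<close>

lemma A_section:
  assumes "h0 \<in> G"
  shows "\<exists>r>0. \<forall>x. dist x (A h0) < r \<longrightarrow> x $ None = 0 \<longrightarrow> H 1 x \<in> G \<longrightarrow> x = A (H 1 x)"
proof -
  let ?S = "U \<inter> {x. 0 < x $ Some p} \<inter> {x. 0 < f 1 x $ None}"
  have "open ?S"
    using open_U C1_on_continuous_on[OF C1_f[of 1]] by (intro open_Int open_Collect_less continuous_intros) auto
  moreover have "A h0 \<in> ?S" using in_U A_plane f1_transversal(1) assms by auto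
  ultimately obtain r where r: "r > 0" "\<And>x. dist x (A h0) < r \<Longrightarrow> x \<in> ?S" unfolding open_dist by blast
  have "x = A (H 1 x)" if x: "dist x (A h0) < r" "x $ None = 0" "H 1 x \<in> G" for x
  proof -
    let ?h = "H 1 x"
    note F = arc1_facts[OF x(3)]
    have "x \<in> U \<inter> region p 1" using r(2)[OF x(1)] x(2) by (auto simp: regions)
    then obtain t where t: "t \<in> {0..T 1 ?h}" "x = \<phi> 1 ?h t" using F(8) by blast
    have "t = 0"
    proof (rule ccontr)
      assume "t \<noteq> 0"
      \<comment> \<open>Here the arc is followed backwards in time: with a positive derivative at a
        zero of the coordinate, slightly earlier values would be negative.\<close>
      have "0 < 1 * f 1 (\<phi> 1 ?h t) $ None" using r(2)[OF x(1)] t(2) by simp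
      from has_real_derivative_pos_inc_left[OF solution_component_within[OF F(2) t(1)] this]
      obtain d where d: "d > 0" "\<And>s. s > 0 \<Longrightarrow> t - s \<in> {0..T 1 ?h} \<Longrightarrow> s < d \<Longrightarrow>
          1 * \<phi> 1 ?h (t - s) $ None < 1 * \<phi> 1 ?h t $ None" by blast
      have "0 < t" using t \<open>t \<noteq> 0\<close> by auto
      then obtain s where s: "0 < s" "s < d" "s < t" using field_lbound_gt_zero[OF d(1)] by blast
      then have "\<phi> 1 ?h (t - s) $ None < 0" using d(2)[of s] t x(2) by auto
      moreover have "0 \<le> \<phi> 1 ?h (t - s) $ None" using F(6)[of "t - s"] s t by (auto simp: regions)
      ultimately show False by simp
    qed
    then show ?thesis using t(2) F(3) by simp
  qed
  then show ?thesis using r(1) by blast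
qed

text \<open>As for \<open>A\<close>, but forwards in time: near \<open>B h0\<close> the field points
  towards negative \<open>x $ Some p\<close>, so an arc that went on after \<open>x\<close> would
  leave the first region.\<close>

lemma B_section:
  assumes "h0 \<in> G"
  shows "\<exists>r>0. \<forall>x. dist x (B h0) < r \<longrightarrow> x $ Some p = 0 \<longrightarrow> H 1 x \<in> G \<longrightarrow> x = B (H 1 x)"
proof -
  let ?S = "U \<inter> {x. 0 < x $ None} \<inter> {x. f 1 x $ Some p < 0}"
  have "open ?S"
    using open_U C1_on_continuous_on[OF C1_f[of 1]] by (intro open_Int open_Collect_less continuous_intros) auto
  moreover have "B h0 \<in> ?S" using in_U B_plane f1_transversal(2) assms by auto
  ultimately obtain r where r: "r > 0" "\<And>x. dist x (B h0) < r \<Longrightarrow> x \<in> ?S" unfolding open_dist by blast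
  have "x = B (H 1 x)" if x: "dist x (B h0) < r" "x $ Some p = 0" "H 1 x \<in> G" for x
  proof -
    let ?h = "H 1 x"
    note F = arc1_facts[OF x(3)]
    have "x \<in> U \<inter> region p 1" using r(2)[OF x(1)] x(2) by (auto simp: regions)
    then obtain t where t: "t \<in> {0..T 1 ?h}" "x = \<phi> 1 ?h t" using F(8) by blast
    have "t = T 1 ?h"
    proof (rule ccontr)
      assume "t \<noteq> T 1 ?h"
      have "1 * f 1 (\<phi> 1 ?h t) $ Some p < 0" using r(2)[OF x(1)] t(2) by simp
      from has_real_derivative_neg_dec_right[OF solution_component_within[OF F(2) t(1)] this]
      obtain d where d: "d > 0" "\<And>s. s > 0 \<Longrightarrow> t + s \<in> {0..T 1 ?h} \<Longrightarrow> s < d \<Longrightarrow>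
          1 * \<phi> 1 ?h (t + s) $ Some p < 1 * \<phi> 1 ?h t $ Some p" by blast
      have "0 < T 1 ?h - t" using t \<open>t \<noteq> T 1 ?h\<close> by auto
      then obtain s where s: "0 < s" "s < d" "s < T 1 ?h - t" using field_lbound_gt_zero[OF d(1)] by blast
      then have "\<phi> 1 ?h (t + s) $ Some p < 0" using d(2)[of s] t x(2) by auto
      moreover have "0 \<le> \<phi> 1 ?h (t + s) $ Some p" using F(6)[of "t + s"] s t by (auto simp: regions)
      ultimately show False by simp
    qed
    then show ?thesis using t(2) F(4) by simp
  qed
  then show ?thesis using r(1) by blast
qed

lemma H1_A: "h \<in> G \<Longrightarrow> H 1 (A h) = h" and H1_B: "h \<in> G \<Longrightarrow> H 1 (B h) = h"
  using arc1_facts(1,3,4) arc1_facts(7)[of h 0] arc1_facts(7)[of h "T 1 h"] by force+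

lemma near_G:
  assumes "h0 \<in> G"
  shows "\<exists>d>0. \<forall>h. dist h h0 < d \<longrightarrow> h \<in> G"
  using open_G assms unfolding open_dist by blast

text \<open>The open mapping property on the plane supplies, for every level near \<open>h0\<close>,
  a point of that level close to \<open>A h0\<close>; by \<open>A_section\<close> this point is
  \<open>A h\<close>.\<close>

lemma A_continuous:
  assumes "h0 \<in> G"
  shows "isCont A h0"
  unfolding continuous_at_eps_delta
proof (intro allI impI)
  fix e :: real assume "e > 0"
  obtain r where r: "r > 0" "\<And>x. dist x (A h0) < r \<Longrightarrow> x $ None = 0 \<Longrightarrow> H 1 x \<in> G \<Longrightarrow> x = A (H 1 x)"
    using A_section[OF assms] by blast
  obtain d where d: "d > 0" "\<And>h. dist h (H 1 (A h0)) < d \<Longrightarrow> \<exists>x. dist x (A h0) < min r e \<and> x $ None = 0 \<and> H 1 x = h"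
    using hyperplane.hyperplane_open_mapping[OF hyperplane_Some dom(3)[of 1], of "A h0" "min r e"]
      dom(2)[of 1 h0] A_plane transversal assms r(1) \<open>e > 0\<close> by (auto simp: drop_col_sel_cols)
  obtain d' where d': "d' > 0" "\<And>h. dist h h0 < d' \<Longrightarrow> h \<in> G" using near_G[OF assms] by blast
  have "dist (A h) (A h0) < e" if "dist h h0 < min d d'" for h
  proof -
    have "dist h (H 1 (A h0)) < d" using that H1_A[OF assms] by simp
    from d(2)[OF this] obtain x where x: "dist x (A h0) < min r e" "x $ None = 0" "H 1 x = h" by blast
    have "x = A h" using x r(2)[of x] d'(2)[of h] that by auto
    then show ?thesis using x by simp
  qed
  then show "\<exists>d>0. \<forall>h. dist h h0 < d \<longrightarrow> dist (A h) (A h0) < e"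
    using d(1) d'(1) by (intro exI[of _ "min d d'"]) auto
qed

lemma B_continuous:
  assumes "h0 \<in> G"
  shows "isCont B h0"
  unfolding continuous_at_eps_delta
proof (intro allI impI)
  fix e :: real assume "e > 0"
  obtain r where r: "r > 0" "\<And>x. dist x (B h0) < r \<Longrightarrow> x $ Some p = 0 \<Longrightarrow> H 1 x \<in> G \<Longrightarrow> x = B (H 1 x)"
    using B_section[OF assms] by blast
  obtain d where d: "d > 0" "\<And>h. dist h (H 1 (B h0)) < d \<Longrightarrow> \<exists>x. dist x (B h0) < min r e \<and> x $ Some p = 0 \<and> H 1 x = h"
    using hyperplane.hyperplane_open_mapping[OF hyperplane_swap dom(3)[of 1], of "B h0" p "min r e"]
      dom(2)[of 1 h0] B_plane transversal assms r(1) \<open>e > 0\<close> by (auto simp: drop_col_sel_cols)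
  obtain d' where d': "d' > 0" "\<And>h. dist h h0 < d' \<Longrightarrow> h \<in> G" using near_G[OF assms] by blast
  have "dist (B h) (B h0) < e" if "dist h h0 < min d d'" for h
  proof -
    have "dist h (H 1 (B h0)) < d" using that H1_B[OF assms] by simp
    from d(2)[OF this] obtain x where x: "dist x (B h0) < min r e" "x $ Some p = 0" "H 1 x = h" by blast
    have "x = B h" using x r(2)[of x] d'(2)[of h] that by auto
    then show ?thesis using x by simp
  qed
  then show "\<exists>d>0. \<forall>h. dist h h0 < d \<longrightarrow> dist (B h) (B h0) < e"
    using d(1) d'(1) by (intro exI[of _ "min d d'"]) auto
qed

text \<open>
  If the arc touched a switching plane at an interior point \<open>D\<close>, the field would be tangent to the
  plane there. The arcs of nearby levels sweep out a neighbourhood of \<open>D\<close>, so that one of them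
  would leave the first region.
\<close>

lemma arc1_interior:
  assumes h0: "h0 \<in> G" and t': "0 < t'" "t' < T 1 h0" and i: "i \<in> {None, Some p}"
  shows "0 < \<phi> 1 h0 t' $ i"
proof (rule ccontr)
  assume neg: "\<not> 0 < \<phi> 1 h0 t' $ i"
  note F = arc1_facts[OF h0]
  have nonneg: "0 \<le> \<phi> 1 h t $ i" if "h \<in> G" "t \<in> {0..T 1 h}" for h t
    using arc1_facts(6)[OF that] i by (auto simp: regions)
  define D where "D = \<phi> 1 h0 t'"
  have D: "D \<in> U \<inter> region p 1" "D $ i = 0" "H 1 D = h0" "D \<in> dom 1"
    using F(6)[of t'] F(7)[of t'] t' neg nonneg[OF h0, of t'] dom(1)[of 1] by (auto simp: D_def)
  define v where "v = f 1 D"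
  have v: "v \<noteq> 0" "jacobian (H 1) (at D) *v v = 0"
    using no_critical h0 t' first_integrals D(1) by (auto simp: v_def D_def)
  have "v $ i = 0"
  proof (rule DERIV_local_min[of "\<lambda>t. 1 * \<phi> 1 h0 t $ i" _ t' "min t' (T 1 h0 - t')"])
    show "((\<lambda>t. 1 * \<phi> 1 h0 t $ i) has_real_derivative v $ i) (at t')"
      using solution_component_derivative[OF F(2) t', of 1 i] by (simp add: v_def D_def)
    show "\<forall>y. \<bar>t' - y\<bar> < min t' (T 1 h0 - t') \<longrightarrow> 1 * \<phi> 1 h0 t' $ i \<le> 1 * \<phi> 1 h0 y $ i"
    proof (intro allI impI)
      fix y assume "\<bar>t' - y\<bar> < min t' (T 1 h0 - t')"
      then have "y \<in> {0..T 1 h0}" by auto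
      then show "1 * \<phi> 1 h0 t' $ i \<le> 1 * \<phi> 1 h0 y $ i" using D(2) nonneg[OF h0] by (simp add: D_def)
    qed
  qed (use t' in auto)
  have ker: "z = 0" if "blinfun_apply (DH 1 D) z = 0" "v \<bullet> z = 0" for z
    using kernel_one_dimensional[OF _ _ v(2,1), of z] that independent_integrals D(1)
      C1_on_jacobian[OF dom(3)[of 1] D(4)] by auto
  \<comment> \<open>The kernel of the Jacobian at \<open>D\<close> is spanned by \<open>v\<close>.
    Level and progress \<open>v \<bullet> x\<close> along the arc therefore determine points near
    \<open>D\<close>, which is the fact \<open>inj\<close> below.\<close>
  let ?L = "\<lambda>z. (blinfun_apply (DH 1 D) z, v \<bullet> z)"
  have "bounded_linear ?L"
    by (intro bounded_linear_Pair blinfun.bounded_linear_right bounded_linear_inner_right)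
  then have L: "blinfun_apply (Blinfun ?L) = ?L" by (rule bounded_linear_Blinfun_apply)
  obtain c where c: "c > 0" "\<And>z. c * norm z \<le> norm (?L z)"
    using injective_linear_lower_bound[of "Blinfun ?L"] ker unfolding L zero_prod_def by blast
  obtain r where r: "r > 0" "\<forall>y\<in>ball D r. \<forall>z\<in>ball D r.
      norm (H 1 y - H 1 z - blinfun_apply (DH 1 D) (y - z)) \<le> c / 2 * norm (y - z)"
    using C1_on_strict_derivative[OF dom(3)[of 1] D(4) half_gt_zero[OF c(1)]] by auto
  have inj: "y = z" if "dist y D < r" "dist z D < r" "H 1 y = H 1 z" "v \<bullet> y = v \<bullet> z" for y z
  proof -
    have "norm (?L (y - z)) \<le> c / 2 * norm (y - z)"
      using r(2)[rule_format, of y z] that by (simp add: dist_commute norm_Pair inner_diff_right)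
    with c(2)[of "y - z"] have "c * norm (y - z) \<le> c / 2 * norm (y - z)" by linarith
    then show ?thesis using c(1) by (auto simp: mult_le_cancel_right)
  qed
  define \<psi> where "\<psi> t = v \<bullet> \<phi> 1 h0 t" for t
  have "(\<psi> has_real_derivative v \<bullet> v) (at t')"
    unfolding \<psi>_def[abs_def] has_real_derivative_iff_has_vector_derivative v_def D_def
    by (intro bounded_linear.has_vector_derivative[OF bounded_linear_inner_right] solves_interior[OF F(2) t'])
  then obtain d1 d2 where d12: "d1 > 0" "\<And>s. s > 0 \<Longrightarrow> s < d1 \<Longrightarrow> \<psi> t' < \<psi> (t' + s)"
      "d2 > 0" "\<And>s. s > 0 \<Longrightarrow> s < d2 \<Longrightarrow> \<psi> (t' - s) < \<psi> t'"
    using DERIV_pos_inc_right[of \<psi> "v \<bullet> v" t'] DERIV_pos_inc_left[of \<psi> "v \<bullet> v" t'] v(1) by auto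
  obtain d3 where d3: "d3 > 0" "\<And>t. t \<in> {0..T 1 h0} \<Longrightarrow> dist t t' < d3 \<Longrightarrow> dist (\<phi> 1 h0 t) D < r / 2"
    using solves_continuous_on[OF F(2)] t' r(1) half_gt_zero unfolding continuous_on_iff D_def
    by (metis atLeastAtMost_iff less_imp_le)
  have "\<forall>x\<in>{d1, d2, d3, t', T 1 h0 - t'}. 0 < x" using d12 d3 t' by auto
  from finite_pos_lower_bound[OF _ this]
  obtain \<kappa>' where "\<kappa>' > 0" "\<forall>x\<in>{d1, d2, d3, t', T 1 h0 - t'}. \<kappa>' \<le> x" by auto
  then obtain \<kappa> where \<kappa>: "0 < \<kappa>" "\<kappa> < d1" "\<kappa> < d2" "\<kappa> < d3" "\<kappa> < t'" "\<kappa> < T 1 h0 - t'"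
    using dense[of 0 \<kappa>'] by auto
  \<comment> \<open>Up to time \<open>t' + \<kappa>\<close> the arc keeps a distance
    \<open>c0\<close> from its end point \<open>B h0\<close>. As \<open>B\<close> is continuous, an
    arc of a nearby level cannot have ended by then; see \<open>long\<close>.\<close>
  have "closed (\<phi> 1 h0 ` {0..t' + \<kappa>})"
    using \<kappa> t' by (intro compact_imp_closed compact_continuous_image continuous_on_subset[OF solves_continuous_on[OF F(2)]]) auto
  moreover have "B h0 \<notin> \<phi> 1 h0 ` {0..t' + \<kappa>}"
  proof
    assume "B h0 \<in> \<phi> 1 h0 ` {0..t' + \<kappa>}"
    then obtain t where "t \<in> {0..t' + \<kappa>}" "\<phi> 1 h0 t = \<phi> 1 h0 (T 1 h0)" using F(4) by auto
    then show False using inj_onD[OF F(5), of t "T 1 h0"] \<kappa> t' by auto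
  qed
  ultimately obtain c0 where c0: "c0 > 0" "\<And>t. t \<in> {0..t' + \<kappa>} \<Longrightarrow> c0 \<le> dist (B h0) (\<phi> 1 h0 t)"
    using separate_point_closed by (metis imageI)
  \<comment> \<open>The progress \<psi> changes by at least \<open>m\<close> from \<open>t'\<close>
    to either side, so a nearby arc whose progress is off by less than \<open>m\<close> still passes
    the value \<open>v \<bullet> D\<close>.\<close>
  define m where "m = min (\<psi> t' - \<psi> (t' - \<kappa>)) (\<psi> (t' + \<kappa>) - \<psi> t')"
  have m: "m > 0" using d12 \<kappa> by (auto simp: m_def)
  have "\<forall>x\<in>{r / 2, c0 / 2, m / norm v}. 0 < x" using r(1) c0(1) m v(1) by auto
  from finite_pos_lower_bound[OF _ this]
  obtain \<eta> where \<eta>: "\<eta> > 0" "\<eta> \<le> r / 2" "\<eta> \<le> c0 / 2" "\<eta> \<le> m / norm v" by auto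
  \<comment> \<open>Applied below with \<epsilon> = 0, where it expresses continuous dependence on
    the initial point.\<close>
  obtain \<delta> where \<delta>: "\<delta> > 0" "\<forall>\<epsilon> S \<gamma> t. 0 \<le> \<epsilon> \<longrightarrow> \<epsilon> < \<delta> \<longrightarrow> S \<le> T 1 h0 \<longrightarrow>
      solves (\<lambda>x. f 1 x + \<epsilon> *\<^sub>R g 1 x) \<gamma> {0..S} \<longrightarrow> dist (\<gamma> 0) (\<phi> 1 h0 0) < \<delta> \<longrightarrow> 0 \<le> t \<longrightarrow> t \<le> S \<longrightarrow>
      dist (\<gamma> t) (\<phi> 1 h0 t) < \<eta>"
    using solution_comparison[OF C1_f[of 1] continuous_g[of 1] F(2) less_imp_le[OF F(1)] \<eta>(1)] by auto
  obtain da where da: "da > 0" "\<And>h. dist h h0 < da \<Longrightarrow> dist (A h) (A h0) < \<delta>"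
    using A_continuous[OF h0] \<delta>(1) unfolding continuous_at_eps_delta by blast
  obtain db where db: "db > 0" "\<And>h. dist h h0 < db \<Longrightarrow> dist (B h) (B h0) < c0 / 2"
    using B_continuous[OF h0] half_gt_zero[OF c0(1)] unfolding continuous_at_eps_delta by blast
  obtain dg where dg: "dg > 0" "\<And>h. dist h h0 < dg \<Longrightarrow> h \<in> G" using near_G[OF h0] by blast
  have "isCont (H 1) D"
    using C1_onD(3)[OF dom(3)[of 1] D(4)] has_derivative_continuous by auto
  then obtain dH where dH: "dH > 0" "\<And>x. dist x D < dH \<Longrightarrow> dist (H 1 x) h0 < min da (min db dg)"
    using da(1) db(1) dg(1) D(3) unfolding continuous_at_eps_delta by (metis min_less_iff_conj)
  obtain s where s: "0 < s" "s < dH" "s < r" using field_lbound_gt_zero[OF dH(1) r(1)] by blast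
  \<comment> \<open>A point just outside the region. By the tangency \<open>v $ i = 0\<close> it has
    the same progress as \<open>D\<close>, so the arc of its level, when it attains that progress
    near \<open>D\<close>, must pass through \<open>x\<close> itself.\<close>
  define x where "x = D - s *\<^sub>R axis i 1"
  have x: "dist x D = s" "x $ i = - s" "v \<bullet> x = v \<bullet> D"
    using s(1) D(2) \<open>v $ i = 0\<close> by (simp_all add: x_def dist_norm inner_diff_right inner_axis axis_nth)
  define h where "h = H 1 x"
  have h: "dist h h0 < da" "dist h h0 < db" "h \<in> G" using dH(2)[of x] x(1) s dg(2)[of h] by (auto simp: h_def)
  note Fh = arc1_facts[OF h(3)]
  have close: "dist (\<phi> 1 h t) (\<phi> 1 h0 t) < \<eta>" if "0 \<le> t" "t \<le> T 1 h" "t \<le> T 1 h0" for t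
    using \<delta>(2)[rule_format, of 0 "min (T 1 h) (T 1 h0)" "\<phi> 1 h" t] \<delta>(1) that da(2)[OF h(1)] Fh(3) F(3)
      solves_subset[OF Fh(2), of "{0..min (T 1 h) (T 1 h0)}"] by auto
  have long: "t' + \<kappa> < T 1 h"
  proof (rule ccontr)
    assume "\<not> t' + \<kappa> < T 1 h"
    then have "dist (B h) (\<phi> 1 h0 (T 1 h)) < c0 / 2" "c0 \<le> dist (B h0) (\<phi> 1 h0 (T 1 h))"
      using close[of "T 1 h"] c0(2)[of "T 1 h"] Fh(1,4) \<kappa> \<eta>(3) by auto
    then show False using db(2)[OF h(2)] dist_triangle3[of "B h0" "\<phi> 1 h0 (T 1 h)" "B h"] by auto
  qed
  have \<psi>close: "\<bar>v \<bullet> \<phi> 1 h t - \<psi> t\<bar> < m" if "t \<in> {0..t' + \<kappa>}" for t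
  proof -
    have "\<bar>v \<bullet> \<phi> 1 h t - \<psi> t\<bar> \<le> norm v * dist (\<phi> 1 h t) (\<phi> 1 h0 t)"
      using Cauchy_Schwarz_ineq2[of v "\<phi> 1 h t - \<phi> 1 h0 t"] by (simp add: \<psi>_def inner_diff_right dist_norm)
    also have "\<dots> < norm v * (m / norm v)"
      using close[of t] that long \<kappa> \<eta>(4) v(1) by (intro mult_strict_left_mono) auto
    finally show ?thesis using v(1) by simp
  qed
  have "\<exists>t\<ge>t' - \<kappa>. t \<le> t' + \<kappa> \<and> v \<bullet> \<phi> 1 h t = v \<bullet> D"
  proof (rule IVT')
    show "v \<bullet> \<phi> 1 h (t' - \<kappa>) \<le> v \<bullet> D" "v \<bullet> D \<le> v \<bullet> \<phi> 1 h (t' + \<kappa>)"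
      using \<psi>close[of "t' - \<kappa>"] \<psi>close[of "t' + \<kappa>"] \<kappa> t' by (auto simp: m_def \<psi>_def[of t'] D_def)
    show "continuous_on {t' - \<kappa>..t' + \<kappa>} (\<lambda>t. v \<bullet> \<phi> 1 h t)"
      using continuous_on_subset[OF solves_continuous_on[OF Fh(2)], of "{t' - \<kappa>..t' + \<kappa>}"] \<kappa> long
      by (intro continuous_intros) auto
  qed (use \<kappa> in auto)
  then obtain t where t: "t' - \<kappa> \<le> t" "t \<le> t' + \<kappa>" "v \<bullet> \<phi> 1 h t = v \<bullet> D" by blast
  have tT: "t \<in> {0..T 1 h}" using t \<kappa> long by auto
  have "dist (\<phi> 1 h t) D < r"
  proof -
    have "dist t t' < d3" using t \<kappa>(4) by (simp add: dist_real_def abs_less_iff)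
    then have "dist (\<phi> 1 h0 t) D < r / 2" using d3(2)[of t] tT t \<kappa>(6) by auto
    moreover have "dist (\<phi> 1 h t) (\<phi> 1 h0 t) < r / 2" using close[of t] tT t \<kappa>(6) \<eta>(2) by auto
    ultimately show ?thesis using dist_triangle[of "\<phi> 1 h t" D "\<phi> 1 h0 t"] by linarith
  qed
  then have "\<phi> 1 h t = x"
    using x s t Fh(7)[OF tT] by (intro inj) (auto simp: h_def)
  then show False using nonneg[OF h(3) tT] x(2) s(1) by simp
qed

text \<open>What has to be derived is the sign of the field at both ends: the determinants exclude
  tangency, and the side on which the arc runs fixes the sign. The maps \<iota> and \<kappa> belong
  to the planes of entry and of exit.\<close>

lemma leg:
  assumes k: "k \<in> {1..4}" and h: "h \<in> G"
    and arc: "orbital_arc (f k) P Q {x \<in> U \<inter> region p k. H k x = c} (T k h) (\<phi> k h)"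
    and PQ: "P \<in> dom k" "Q \<in> dom k" "P \<in> U" "Q \<in> U"
    and inside: "\<And>t. 0 < t \<Longrightarrow> t < T k h \<Longrightarrow> \<phi> k h t \<in> U \<and> 0 < a * \<phi> k h t $ i \<and> 0 < b * \<phi> k h t $ j"
    and P: "0 < a * P $ i" "P $ j = 0" and Q: "Q $ i = 0" "0 < b * Q $ j"
    and \<iota>: "hyperplane \<iota> j" "hyperplane \<kappa> i"
    and det: "det (sel_cols \<iota> (jacobian (H k) (at P))) \<noteq> 0" "det (sel_cols \<kappa> (jacobian (H k) (at Q))) \<noteq> 0"
  shows "quadrant_arc (f k) (g k) (Df k) i j a b U (T k h) (\<phi> k h)"
proof -
  have T: "0 < T k h" "solves (f k) (\<phi> k h) {0..T k h}" and ends: "\<phi> k h 0 = P" "\<phi> k h (T k h) = Q"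
    using arc by (auto simp: orbital_arc_def)
  note J = arc_integral(2)[OF k h arc PQ(1,2)]
  have "f k (\<phi> k h 0) \<noteq> 0" "f k (\<phi> k h (T k h)) \<noteq> 0" using no_critical h k T(1) by auto
  then have nz: "f k (\<phi> k h 0) $ j \<noteq> 0" "f k (\<phi> k h (T k h)) $ i \<noteq> 0"
    using hyperplane.kernel_transversal[OF \<iota>(1) det(1), of "f k (\<phi> k h 0)"]
      hyperplane.kernel_transversal[OF \<iota>(2) det(2), of "f k (\<phi> k h (T k h))"] J[of 0] J[of "T k h"] T(1) ends
    by auto
  show "quadrant_arc (f k) (g k) (Df k) i j a b U (T k h) (\<phi> k h)"
  proof
    show "0 < b * f k (\<phi> k h 0) $ j"
      by (rule start_transversal[OF T(2,1)]) (use ends P Q inside nz in \<open>auto simp: less_imp_le\<close>)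
    show "a * f k (\<phi> k h (T k h)) $ i < 0"
      by (rule end_transversal[OF T(2,1)]) (use ends P Q inside nz in \<open>auto simp: less_imp_le\<close>)
  qed (use C1_f[OF k] continuous_g[OF k] open_U T ends P Q PQ inside in auto)
qed

abbreviation "swap \<equiv> \<lambda>j. if j = p then None else Some j"

text \<open>Only this leg takes strict positivity from \<open>arc1_interior\<close>; for the others
  it is part of the region. Odd legs go from \<open>x $ None = 0\<close> to
  \<open>x $ Some p = 0\<close>, even legs back.\<close>

lemma leg1:
  assumes "h \<in> G"
  shows "quadrant_arc (f 1) (g 1) (Df 1) (Some p) None 1 1 U (T 1 h) (\<phi> 1 h)"
    "\<phi> 1 h 0 = A h" "\<phi> 1 h (T 1 h) = B h"
proof -
  have k: "1 \<in> {1..4::nat}" by auto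
  have mem: "A h \<in> dom 1" "B h \<in> dom 1" "A h \<in> U" "B h \<in> U"
    using dom(2)[OF k assms] in_U assms by auto
  have inside: "\<phi> 1 h t \<in> U \<and> 0 < 1 * \<phi> 1 h t $ Some p \<and> 0 < 1 * \<phi> 1 h t $ None"
    if "0 < t" "t < T 1 h" for t
    using arc1_interior[OF assms that] arc1_facts(6)[OF assms, of t] that by auto
  have ends: "0 < 1 * A h $ Some p" "A h $ None = 0" "B h $ Some p = 0" "0 < 1 * B h $ None"
    using A_plane B_plane assms by auto
  have det: "det (sel_cols Some (jacobian (H 1) (at (A h)))) \<noteq> 0"
    "det (sel_cols swap (jacobian (H 1) (at (B h)))) \<noteq> 0"
    using bspec[OF bspec[OF transversal assms] k] by (simp_all add: drop_col_sel_cols)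
  note L = leg[OF k assms bspec[OF arc1 assms] mem inside ends hyperplane_Some hyperplane_swap det]
  show "quadrant_arc (f 1) (g 1) (Df 1) (Some p) None 1 1 U (T 1 h) (\<phi> 1 h)"
    by (rule L)
  show "\<phi> 1 h 0 = A h" "\<phi> 1 h (T 1 h) = B h"
    using bspec[OF arc1 assms] by (auto simp: orbital_arc_def)
qed

lemma leg2:
  assumes "h \<in> G"
  shows "quadrant_arc (f 2) (g 2) (Df 2) None (Some p) 1 (-1) U (T 2 h) (\<phi> 2 h)"
    "\<phi> 2 h 0 = B h" "\<phi> 2 h (T 2 h) = C h"
proof -
  have k: "2 \<in> {1..4::nat}" by auto
  have mem: "B h \<in> dom 2" "C h \<in> dom 2" "B h \<in> U" "C h \<in> U"
    using dom(2)[OF k assms] in_U assms by auto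
  have inside: "\<phi> 2 h t \<in> U \<and> 0 < 1 * \<phi> 2 h t $ None \<and> 0 < (-1) * \<phi> 2 h t $ Some p"
    if "0 < t" "t < T 2 h" for t
    using orbital_arc_interior[OF bspec[OF arc2 assms] that] by (auto simp: regions)
  have ends: "0 < 1 * B h $ None" "B h $ Some p = 0" "C h $ None = 0" "0 < (-1) * C h $ Some p"
    using B_plane C_plane assms by auto
  have det: "det (sel_cols swap (jacobian (H 2) (at (B h)))) \<noteq> 0"
    "det (sel_cols Some (jacobian (H 2) (at (C h)))) \<noteq> 0"
    using bspec[OF bspec[OF transversal assms] k] by (simp_all add: drop_col_sel_cols)
  note L = leg[OF k assms bspec[OF arc2 assms] mem inside ends hyperplane_swap hyperplane_Some det]
  show "quadrant_arc (f 2) (g 2) (Df 2) None (Some p) 1 (-1) U (T 2 h) (\<phi> 2 h)"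
    by (rule L)
  show "\<phi> 2 h 0 = B h" "\<phi> 2 h (T 2 h) = C h"
    using bspec[OF arc2 assms] by (auto simp: orbital_arc_def)
qed

lemma leg3:
  assumes "h \<in> G"
  shows "quadrant_arc (f 3) (g 3) (Df 3) (Some p) None (-1) (-1) U (T 3 h) (\<phi> 3 h)"
    "\<phi> 3 h 0 = C h" "\<phi> 3 h (T 3 h) = E h"
proof -
  have k: "3 \<in> {1..4::nat}" by auto
  have mem: "C h \<in> dom 3" "E h \<in> dom 3" "C h \<in> U" "E h \<in> U"
    using dom(2)[OF k assms] in_U assms by auto
  have inside: "\<phi> 3 h t \<in> U \<and> 0 < (-1) * \<phi> 3 h t $ Some p \<and> 0 < (-1) * \<phi> 3 h t $ None"
    if "0 < t" "t < T 3 h" for t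
    using orbital_arc_interior[OF bspec[OF arc3 assms] that] by (auto simp: regions)
  have ends: "0 < (-1) * C h $ Some p" "C h $ None = 0" "E h $ Some p = 0" "0 < (-1) * E h $ None"
    using C_plane E_plane assms by auto
  have det: "det (sel_cols Some (jacobian (H 3) (at (C h)))) \<noteq> 0"
    "det (sel_cols swap (jacobian (H 3) (at (E h)))) \<noteq> 0"
    using bspec[OF bspec[OF transversal assms] k] by (simp_all add: drop_col_sel_cols)
  note L = leg[OF k assms bspec[OF arc3 assms] mem inside ends hyperplane_Some hyperplane_swap det]
  show "quadrant_arc (f 3) (g 3) (Df 3) (Some p) None (-1) (-1) U (T 3 h) (\<phi> 3 h)"
    by (rule L)
  show "\<phi> 3 h 0 = C h" "\<phi> 3 h (T 3 h) = E h"
    using bspec[OF arc3 assms] by (auto simp: orbital_arc_def)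
qed

lemma leg4:
  assumes "h \<in> G"
  shows "quadrant_arc (f 4) (g 4) (Df 4) None (Some p) (-1) 1 U (T 4 h) (\<phi> 4 h)"
    "\<phi> 4 h 0 = E h" "\<phi> 4 h (T 4 h) = A h"
proof -
  have k: "4 \<in> {1..4::nat}" by auto
  have mem: "E h \<in> dom 4" "A h \<in> dom 4" "E h \<in> U" "A h \<in> U"
    using dom(2)[OF k assms] in_U assms by auto
  have inside: "\<phi> 4 h t \<in> U \<and> 0 < (-1) * \<phi> 4 h t $ None \<and> 0 < 1 * \<phi> 4 h t $ Some p"
    if "0 < t" "t < T 4 h" for t
    using orbital_arc_interior[OF bspec[OF arc4 assms] that] by (auto simp: regions)
  have ends: "0 < (-1) * E h $ None" "E h $ Some p = 0" "A h $ None = 0" "0 < 1 * A h $ Some p"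
    using E_plane A_plane assms by auto
  have det: "det (sel_cols swap (jacobian (H 4) (at (E h)))) \<noteq> 0"
    "det (sel_cols Some (jacobian (H 4) (at (A h)))) \<noteq> 0"
    using bspec[OF bspec[OF transversal assms] k] by (simp_all add: drop_col_sel_cols)
  note L = leg[OF k assms bspec[OF arc4 assms] mem inside ends hyperplane_swap hyperplane_Some det]
  show "quadrant_arc (f 4) (g 4) (Df 4) None (Some p) (-1) 1 U (T 4 h) (\<phi> 4 h)"
    by (rule L)
  show "\<phi> 4 h 0 = E h" "\<phi> 4 h (T 4 h) = A h"
    using bspec[OF arc4 assms] by (auto simp: orbital_arc_def)
qed

lemma quadrants:
  "quadrant U (Some p) None 1 1 \<subseteq> U \<inter> region p 1" "quadrant U None (Some p) 1 (-1) \<subseteq> U \<inter> region p 2"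
  "quadrant U (Some p) None (-1) (-1) \<subseteq> U \<inter> region p 3" "quadrant U None (Some p) (-1) 1 \<subseteq> U \<inter> region p 4"
  by (auto simp: quadrant_def regions)

lemma H2_C: "h \<in> G \<Longrightarrow> H 2 (C h) = H 2 (B h)" and H3_E: "h \<in> G \<Longrightarrow> H 3 (E h) = H 3 (C h)"
  and H4_A: "h \<in> G \<Longrightarrow> H 4 (A h) = H 4 (E h)"
proof -
  assume h: "h \<in> G"
  show "H 2 (C h) = H 2 (B h)"
    using arc_integral(1)[OF _ h bspec[OF arc2 h], of "T 2 h"] leg2(3)[OF h] dom(2)[OF _ h, of 2]
      quadrant_arc.T0[OF leg2(1)[OF h]] by auto
  show "H 3 (E h) = H 3 (C h)"
    using arc_integral(1)[OF _ h bspec[OF arc3 h], of "T 3 h"] leg3(3)[OF h] dom(2)[OF _ h, of 3]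
      quadrant_arc.T0[OF leg3(1)[OF h]] by auto
  show "H 4 (A h) = H 4 (E h)"
    using arc_integral(1)[OF _ h bspec[OF arc4 h], of "T 4 h"] leg4(3)[OF h] dom(2)[OF _ h, of 4]
      quadrant_arc.T0[OF leg4(1)[OF h]] by auto
qed

lemma reaches_self:
  assumes "quadrant_arc (f k) (g k) X' i j a b U (T k h) (\<phi> k h)" "\<phi> k h 0 = P" "\<phi> k h (T k h) = Q"
  shows "reaches (f k) (g k) i j UNIV 0 P Q"
  using quadrant_arc.crossing_self[OF assms(1)] assms(2,3) unfolding reaches_def by blast

lemma eventually_G: "h0 \<in> G \<Longrightarrow> (hh \<longlongrightarrow> h0) F \<Longrightarrow> \<forall>\<^sub>F s in F. hh s \<in> G"
  using open_G topological_tendstoD by blast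

lemma A_tendsto: "h0 \<in> G \<Longrightarrow> (hh \<longlongrightarrow> h0) F \<Longrightarrow> ((\<lambda>s. A (hh s)) \<longlongrightarrow> A h0) F"
  using A_continuous isCont_tendsto_compose by blast

lemma B_tendsto: "h0 \<in> G \<Longrightarrow> (hh \<longlongrightarrow> h0) F \<Longrightarrow> ((\<lambda>s. B (hh s)) \<longlongrightarrow> B h0) F"
  using B_continuous isCont_tendsto_compose by blast

text \<open>With \<epsilon> = 0 the arc from \<open>B (hh s)\<close> to \<open>C (hh s)\<close> is
  itself a crossing, so the limit of its start determines the limit of its end.\<close>

lemma C_tendsto:
  assumes h0: "h0 \<in> G" and hh: "(hh \<longlongrightarrow> h0) F"
  shows "((\<lambda>s. C (hh s)) \<longlongrightarrow> C h0) F"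
proof -
  have "\<forall>\<^sub>F s in F. reaches (f 2) (g 2) None (Some p) UNIV 0 (B (hh s)) (C (hh s))"
    using eventually_G[OF assms] by eventually_elim (use reaches_self leg2 in blast)
  from quadrant_arc.reaches_tendsto(1)[OF leg2(1)[OF h0] _ _ this]
  show ?thesis using leg2(2,3)[OF h0] B_tendsto[OF assms] by auto
qed

lemma E_tendsto:
  assumes h0: "h0 \<in> G" and hh: "(hh \<longlongrightarrow> h0) F"
  shows "((\<lambda>s. E (hh s)) \<longlongrightarrow> E h0) F"
proof -
  have "\<forall>\<^sub>F s in F. reaches (f 3) (g 3) (Some p) None UNIV 0 (C (hh s)) (E (hh s))"
    using eventually_G[OF assms] by eventually_elim (use reaches_self leg3 in blast)
  from quadrant_arc.reaches_tendsto(1)[OF leg3(1)[OF h0] _ _ this]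
  show ?thesis using leg3(2,3)[OF h0] C_tendsto[OF assms] by auto
qed

lemma leg_ratio:
  assumes k: "k \<in> {1..4}" and h: "h \<in> G"
    and leg: "quadrant_arc (f k) (g k) (Df k) i j a b U (T k h) (\<phi> k h)"
    and region: "quadrant U i j a b \<subseteq> U \<inter> region p k"
    and ends: "\<phi> k h 0 \<in> dom k" "\<phi> k h (T k h) \<in> dom k"
    and lim: "\<forall>\<^sub>F \<epsilon> in at_right 0. reaches (f k) (g k) i j UNIV \<epsilon> (x \<epsilon>) (y \<epsilon>)" "(x \<longlongrightarrow> \<phi> k h 0) (at_right 0)"
  shows "((\<lambda>\<epsilon>. (H k (y \<epsilon>) - H k (x \<epsilon>)) /\<^sub>R \<epsilon>) \<longlongrightarrow>
    integral {0..T k h} (\<lambda>t. jacobian (H k) (at (\<phi> k h t)) *v g k (\<phi> k h t))) (at_right 0)"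
proof -
  have sub: "quadrant U i j a b \<subseteq> dom k" using region dom(1)[OF k] by blast
  have "((\<lambda>\<epsilon>. (H k (y \<epsilon>) - H k (x \<epsilon>)) /\<^sub>R \<epsilon>) \<longlongrightarrow>
      integral {0..T k h} (\<lambda>t. blinfun_apply (DH k (\<phi> k h t)) (g k (\<phi> k h t)))) (at_right 0)"
    by (rule quadrant_arc.reaches_ratio_tendsto[OF leg dom(3)[OF k] sub ends _ tendsto_ident_at _ lim])
      (use DH_field[OF k] region in \<open>auto simp: eventually_at_right_less\<close>)
  moreover have "\<phi> k h t \<in> dom k" if "t \<in> {0..T k h}" for t
    using quadrant_arc.inside[OF leg, of t] sub ends that by (cases "t = 0 \<or> t = T k h") (auto simp: quadrant_def)
  then have "integral {0..T k h} (\<lambda>t. blinfun_apply (DH k (\<phi> k h t)) (g k (\<phi> k h t))) =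
      integral {0..T k h} (\<lambda>t. jacobian (H k) (at (\<phi> k h t)) *v g k (\<phi> k h t))"
    by (intro integral_cong) (simp add: C1_on_jacobian[OF dom(3)[OF k]])
  ultimately show ?thesis by simp
qed

end

subsection \<open>The perturbed system\<close>

text \<open>The set \<open>V\<close> makes smallness of \<epsilon> precise: it is a neighbourhood of
  \<open>G \<times> {0}\<close>, so the admissible range of \<epsilon> may depend on
  \<open>h\<close>.\<close>

locale perturbed_system = switching_system p f g H U G A B C E T \<phi>
  for p :: "'m::finite" and f g H U G A B C E T \<phi> +
  fixes V :: "((real ^ 'm) \<times> real) set"
    and A\<^sub>\<epsilon> B\<^sub>\<epsilon> C\<^sub>\<epsilon> E\<^sub>\<epsilon> :: "real ^ 'm \<Rightarrow> real \<Rightarrow> real ^ ('m option)"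
  assumes V: "open V" "V \<subseteq> G \<times> UNIV" "G \<times> {0} \<subseteq> V"
    and B\<^sub>\<epsilon>: "\<forall>h \<epsilon>. (h, \<epsilon>) \<in> V \<and> \<epsilon> \<ge> 0 \<longrightarrow>
          first_intersection (subsystem f g \<epsilon> 1) (Some p) (A h) (B\<^sub>\<epsilon> h \<epsilon>)"
    and C\<^sub>\<epsilon>: "\<forall>h \<epsilon>. (h, \<epsilon>) \<in> V \<and> \<epsilon> \<ge> 0 \<longrightarrow>
          first_intersection (subsystem f g \<epsilon> 2) None (B\<^sub>\<epsilon> h \<epsilon>) (C\<^sub>\<epsilon> h \<epsilon>)"
    and E\<^sub>\<epsilon>: "\<forall>h \<epsilon>. (h, \<epsilon>) \<in> V \<and> \<epsilon> \<ge> 0 \<longrightarrow>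
          first_intersection (subsystem f g \<epsilon> 3) (Some p) (C\<^sub>\<epsilon> h \<epsilon>) (E\<^sub>\<epsilon> h \<epsilon>)"
    and A\<^sub>\<epsilon>: "\<forall>h \<epsilon>. (h, \<epsilon>) \<in> V \<and> \<epsilon> \<ge> 0 \<longrightarrow>
          first_intersection (subsystem f g \<epsilon> 4) None (E\<^sub>\<epsilon> h \<epsilon>) (A\<^sub>\<epsilon> h \<epsilon>)"
begin

lemma perturbed_reaches:
  assumes "(h, \<epsilon>) \<in> V" "0 \<le> \<epsilon>"
  shows "reaches (f 1) (g 1) (Some p) None UNIV \<epsilon> (A h) (B\<^sub>\<epsilon> h \<epsilon>)" "B\<^sub>\<epsilon> h \<epsilon> $ Some p = 0"
    "reaches (f 2) (g 2) None (Some p) UNIV \<epsilon> (B\<^sub>\<epsilon> h \<epsilon>) (C\<^sub>\<epsilon> h \<epsilon>)" "C\<^sub>\<epsilon> h \<epsilon> $ None = 0"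
    "reaches (f 3) (g 3) (Some p) None UNIV \<epsilon> (C\<^sub>\<epsilon> h \<epsilon>) (E\<^sub>\<epsilon> h \<epsilon>)" "E\<^sub>\<epsilon> h \<epsilon> $ Some p = 0"
    "reaches (f 4) (g 4) None (Some p) UNIV \<epsilon> (E\<^sub>\<epsilon> h \<epsilon>) (A\<^sub>\<epsilon> h \<epsilon>)" "A\<^sub>\<epsilon> h \<epsilon> $ None = 0"
proof -
  have "h \<in> G" using assms V(2) by auto
  then have 0: "A h $ None = 0" using A_plane by blast
  have F: "first_intersection (subsystem f g \<epsilon> 1) (Some p) (A h) (B\<^sub>\<epsilon> h \<epsilon>)"
    "first_intersection (subsystem f g \<epsilon> 2) None (B\<^sub>\<epsilon> h \<epsilon>) (C\<^sub>\<epsilon> h \<epsilon>)"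
    "first_intersection (subsystem f g \<epsilon> 3) (Some p) (C\<^sub>\<epsilon> h \<epsilon>) (E\<^sub>\<epsilon> h \<epsilon>)"
    "first_intersection (subsystem f g \<epsilon> 4) None (E\<^sub>\<epsilon> h \<epsilon>) (A\<^sub>\<epsilon> h \<epsilon>)"
    using assms B\<^sub>\<epsilon> C\<^sub>\<epsilon> E\<^sub>\<epsilon> A\<^sub>\<epsilon> by blast+
  note 1 = first_intersection_reaches[OF F(1) 0]
  note 2 = first_intersection_reaches[OF F(2) 1(2)]
  note 3 = first_intersection_reaches[OF F(3) 2(2)]
  note 4 = first_intersection_reaches[OF F(4) 3(2)]
  show "reaches (f 1) (g 1) (Some p) None UNIV \<epsilon> (A h) (B\<^sub>\<epsilon> h \<epsilon>)" "B\<^sub>\<epsilon> h \<epsilon> $ Some p = 0"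
    "reaches (f 2) (g 2) None (Some p) UNIV \<epsilon> (B\<^sub>\<epsilon> h \<epsilon>) (C\<^sub>\<epsilon> h \<epsilon>)" "C\<^sub>\<epsilon> h \<epsilon> $ None = 0"
    "reaches (f 3) (g 3) (Some p) None UNIV \<epsilon> (C\<^sub>\<epsilon> h \<epsilon>) (E\<^sub>\<epsilon> h \<epsilon>)" "E\<^sub>\<epsilon> h \<epsilon> $ Some p = 0"
    "reaches (f 4) (g 4) None (Some p) UNIV \<epsilon> (E\<^sub>\<epsilon> h \<epsilon>) (A\<^sub>\<epsilon> h \<epsilon>)" "A\<^sub>\<epsilon> h \<epsilon> $ None = 0"
    by (rule 1 2 3 4)+
qed

context
  fixes h0 :: "real ^ 'm" and hh :: "'s \<Rightarrow> real ^ 'm" and ee :: "'s \<Rightarrow> real" and F :: "'s filter"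
  assumes h0: "h0 \<in> G" and hh: "(hh \<longlongrightarrow> h0) F" and ee: "(ee \<longlongrightarrow> 0) F"
    and V_nonneg: "\<forall>\<^sub>F s in F. (hh s, ee s) \<in> V \<and> 0 \<le> ee s"
begin

text \<open>The limits propagate around the orbit: the limit found for the end of one leg is the
  initial limit required for the next.\<close>

lemma perturbed_limits:
  shows "((\<lambda>s. B\<^sub>\<epsilon> (hh s) (ee s)) \<longlongrightarrow> B h0) F" "((\<lambda>s. C\<^sub>\<epsilon> (hh s) (ee s)) \<longlongrightarrow> C h0) F"
    "((\<lambda>s. E\<^sub>\<epsilon> (hh s) (ee s)) \<longlongrightarrow> E h0) F" "((\<lambda>s. A\<^sub>\<epsilon> (hh s) (ee s)) \<longlongrightarrow> A h0) F"
    and perturbed_reaches_region: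
    "\<forall>\<^sub>F s in F. reaches (f 1) (g 1) (Some p) None (region p 1) (ee s) (A (hh s)) (B\<^sub>\<epsilon> (hh s) (ee s))"
    "\<forall>\<^sub>F s in F. reaches (f 2) (g 2) None (Some p) (region p 2) (ee s) (B\<^sub>\<epsilon> (hh s) (ee s)) (C\<^sub>\<epsilon> (hh s) (ee s))"
    "\<forall>\<^sub>F s in F. reaches (f 3) (g 3) (Some p) None (region p 3) (ee s) (C\<^sub>\<epsilon> (hh s) (ee s)) (E\<^sub>\<epsilon> (hh s) (ee s))"
    "\<forall>\<^sub>F s in F. reaches (f 4) (g 4) None (Some p) (region p 4) (ee s) (E\<^sub>\<epsilon> (hh s) (ee s)) (A\<^sub>\<epsilon> (hh s) (ee s))"
proof -
  have nn: "\<forall>\<^sub>F s in F. 0 \<le> ee s" using V_nonneg by eventually_elim blast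
  have r: "\<forall>\<^sub>F s in F. reaches (f 1) (g 1) (Some p) None UNIV (ee s) (A (hh s)) (B\<^sub>\<epsilon> (hh s) (ee s))"
    "\<forall>\<^sub>F s in F. reaches (f 2) (g 2) None (Some p) UNIV (ee s) (B\<^sub>\<epsilon> (hh s) (ee s)) (C\<^sub>\<epsilon> (hh s) (ee s))"
    "\<forall>\<^sub>F s in F. reaches (f 3) (g 3) (Some p) None UNIV (ee s) (C\<^sub>\<epsilon> (hh s) (ee s)) (E\<^sub>\<epsilon> (hh s) (ee s))"
    "\<forall>\<^sub>F s in F. reaches (f 4) (g 4) None (Some p) UNIV (ee s) (E\<^sub>\<epsilon> (hh s) (ee s)) (A\<^sub>\<epsilon> (hh s) (ee s))"
    by (use V_nonneg in \<open>rule eventually_mono, use perturbed_reaches in blast\<close>)+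
  have mono: "reaches X g' i j S \<epsilon> P Q \<Longrightarrow> S \<subseteq> U \<inter> S' \<Longrightarrow> reaches X g' i j S' \<epsilon> P Q" for X g' i j S S' \<epsilon> P Q
    unfolding reaches_def by blast
  note 1 = quadrant_arc.reaches_tendsto[OF leg1(1)[OF h0] ee nn r(1), unfolded leg1(2,3)[OF h0], OF A_tendsto[OF h0 hh]]
  note 2 = quadrant_arc.reaches_tendsto[OF leg2(1)[OF h0] ee nn r(2), unfolded leg2(2,3)[OF h0], OF 1(1)]
  note 3 = quadrant_arc.reaches_tendsto[OF leg3(1)[OF h0] ee nn r(3), unfolded leg3(2,3)[OF h0], OF 2(1)]
  note 4 = quadrant_arc.reaches_tendsto[OF leg4(1)[OF h0] ee nn r(4), unfolded leg4(2,3)[OF h0], OF 3(1)]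
  show "((\<lambda>s. B\<^sub>\<epsilon> (hh s) (ee s)) \<longlongrightarrow> B h0) F" "((\<lambda>s. C\<^sub>\<epsilon> (hh s) (ee s)) \<longlongrightarrow> C h0) F"
    "((\<lambda>s. E\<^sub>\<epsilon> (hh s) (ee s)) \<longlongrightarrow> E h0) F" "((\<lambda>s. A\<^sub>\<epsilon> (hh s) (ee s)) \<longlongrightarrow> A h0) F"
    by (rule 1(1) 2(1) 3(1) 4(1))+
  show "\<forall>\<^sub>F s in F. reaches (f 1) (g 1) (Some p) None (region p 1) (ee s) (A (hh s)) (B\<^sub>\<epsilon> (hh s) (ee s))"
    using 1(2) by (rule eventually_mono) (rule mono[OF _ quadrants(1)])
  show "\<forall>\<^sub>F s in F. reaches (f 2) (g 2) None (Some p) (region p 2) (ee s) (B\<^sub>\<epsilon> (hh s) (ee s)) (C\<^sub>\<epsilon> (hh s) (ee s))"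
    using 2(2) by (rule eventually_mono) (rule mono[OF _ quadrants(2)])
  show "\<forall>\<^sub>F s in F. reaches (f 3) (g 3) (Some p) None (region p 3) (ee s) (C\<^sub>\<epsilon> (hh s) (ee s)) (E\<^sub>\<epsilon> (hh s) (ee s))"
    using 3(2) by (rule eventually_mono) (rule mono[OF _ quadrants(3)])
  show "\<forall>\<^sub>F s in F. reaches (f 4) (g 4) None (Some p) (region p 4) (ee s) (E\<^sub>\<epsilon> (hh s) (ee s)) (A\<^sub>\<epsilon> (hh s) (ee s))"
    using 4(2) by (rule eventually_mono) (rule mono[OF _ quadrants(4)])
qed

end

abbreviation "I k h \<equiv> integral {0..T k h} (\<lambda>t. jacobian (H k) (at (\<phi> k h t)) *v g k (\<phi> k h t))"

text \<open>
  The perturbed point \<open>B\<^sub>\<epsilon>(h)\<close> lies on an unperturbed orbit, namely on that of level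
  \<open>h' = H\<^sup>1(B\<^sub>\<epsilon>(h))\<close>. Comparing the later perturbed points with \<open>C(h')\<close>, \<open>E(h')\<close> and \<open>A(h')\<close>
  instead of \<open>C(h)\<close>, \<open>E(h)\<close> and \<open>A(h)\<close> gives the first integral the coefficient 1.
\<close>

lemma melnikov_limit:
  assumes h: "h \<in> G"
  shows "((\<lambda>\<epsilon>. (H 1 (A\<^sub>\<epsilon> h \<epsilon>) - H 1 (A h)) /\<^sub>R \<epsilon>) \<longlongrightarrow>
     I 1 h + (drop_col1 (jacobian (H 1) (at (A h))) ** matrix_inv (drop_col1 (jacobian (H 4) (at (A h))))) *v
      (I 4 h + (drop_col2 p (jacobian (H 4) (at (E h))) ** matrix_inv (drop_col2 p (jacobian (H 3) (at (E h))))) *v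
       (I 3 h + (drop_col1 (jacobian (H 3) (at (C h))) ** matrix_inv (drop_col1 (jacobian (H 2) (at (C h))))) *v I 2 h)))
    (at_right 0)"
proof -
  let ?F = "at_right (0::real)"
  have id: "((\<lambda>\<epsilon>. \<epsilon>) \<longlongrightarrow> 0) ?F" by (rule tendsto_ident_at)
  have "((\<lambda>\<epsilon>. (h, \<epsilon>)) \<longlongrightarrow> (h, 0)) ?F" by (intro tendsto_Pair tendsto_const id)
  then have "\<forall>\<^sub>F \<epsilon> in ?F. (h, \<epsilon>) \<in> V" using V h by (intro topological_tendstoD) auto
  then have inV: "\<forall>\<^sub>F \<epsilon> in ?F. (h, \<epsilon>) \<in> V \<and> 0 \<le> \<epsilon>"
    using eventually_at_right_less[of "0::real"] by eventually_elim auto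
  note lim = perturbed_limits[where hh="\<lambda>_. h" and ee="\<lambda>\<epsilon>. \<epsilon>", OF h tendsto_const id inV]
  have r: "\<forall>\<^sub>F \<epsilon> in ?F. reaches (f 1) (g 1) (Some p) None UNIV \<epsilon> (A h) (B\<^sub>\<epsilon> h \<epsilon>)"
    "\<forall>\<^sub>F \<epsilon> in ?F. reaches (f 2) (g 2) None (Some p) UNIV \<epsilon> (B\<^sub>\<epsilon> h \<epsilon>) (C\<^sub>\<epsilon> h \<epsilon>)"
    "\<forall>\<^sub>F \<epsilon> in ?F. reaches (f 3) (g 3) (Some p) None UNIV \<epsilon> (C\<^sub>\<epsilon> h \<epsilon>) (E\<^sub>\<epsilon> h \<epsilon>)"
    "\<forall>\<^sub>F \<epsilon> in ?F. reaches (f 4) (g 4) None (Some p) UNIV \<epsilon> (E\<^sub>\<epsilon> h \<epsilon>) (A\<^sub>\<epsilon> h \<epsilon>)"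
    and plane: "\<forall>\<^sub>F \<epsilon> in ?F. B\<^sub>\<epsilon> h \<epsilon> $ Some p = 0" "\<forall>\<^sub>F \<epsilon> in ?F. C\<^sub>\<epsilon> h \<epsilon> $ None = 0"
    "\<forall>\<^sub>F \<epsilon> in ?F. E\<^sub>\<epsilon> h \<epsilon> $ Some p = 0" "\<forall>\<^sub>F \<epsilon> in ?F. A\<^sub>\<epsilon> h \<epsilon> $ None = 0"
    by (use inV in \<open>rule eventually_mono, use perturbed_reaches in blast\<close>)+
  have mem: "A h \<in> dom k" "B h \<in> dom k" "C h \<in> dom k" "E h \<in> dom k" if "k \<in> {1..4}" for k
    using dom(2)[OF that h] by auto
  have k: "1 \<in> {1..4::nat}" "2 \<in> {1..4::nat}" "3 \<in> {1..4::nat}" "4 \<in> {1..4::nat}" by auto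
  have q1: "((\<lambda>\<epsilon>. (H 1 (B\<^sub>\<epsilon> h \<epsilon>) - H 1 (A h)) /\<^sub>R \<epsilon>) \<longlongrightarrow> I 1 h) ?F"
    by (rule leg_ratio[OF k(1) h leg1(1)[OF h] quadrants(1), unfolded leg1(2,3)[OF h], OF mem(1,2)[OF k(1)] r(1) tendsto_const])
  have q2: "((\<lambda>\<epsilon>. (H 2 (C\<^sub>\<epsilon> h \<epsilon>) - H 2 (B\<^sub>\<epsilon> h \<epsilon>)) /\<^sub>R \<epsilon>) \<longlongrightarrow> I 2 h) ?F"
    by (rule leg_ratio[OF k(2) h leg2(1)[OF h] quadrants(2), unfolded leg2(2,3)[OF h], OF mem(2,3)[OF k(2)] r(2) lim(1)])
  have q3: "((\<lambda>\<epsilon>. (H 3 (E\<^sub>\<epsilon> h \<epsilon>) - H 3 (C\<^sub>\<epsilon> h \<epsilon>)) /\<^sub>R \<epsilon>) \<longlongrightarrow> I 3 h) ?F"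
    by (rule leg_ratio[OF k(3) h leg3(1)[OF h] quadrants(3), unfolded leg3(2,3)[OF h], OF mem(3,4)[OF k(3)] r(3) lim(2)])
  have q4: "((\<lambda>\<epsilon>. (H 4 (A\<^sub>\<epsilon> h \<epsilon>) - H 4 (E\<^sub>\<epsilon> h \<epsilon>)) /\<^sub>R \<epsilon>) \<longlongrightarrow> I 4 h) ?F"
    by (rule leg_ratio[OF k(4) h leg4(1)[OF h] quadrants(4), unfolded leg4(2,3)[OF h], OF mem(4,1)[OF k(4)] r(4) lim(3)])
  define h' where "h' \<epsilon> = H 1 (B\<^sub>\<epsilon> h \<epsilon>)" for \<epsilon>
  have "isCont (H 1) (B h)"
    using C1_onD(3)[OF dom(3)[OF k(1)] mem(2)[OF k(1)]] has_derivative_continuous by blast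
  from isCont_tendsto_compose[OF this lim(1)] have h': "(h' \<longlongrightarrow> h) ?F"
    by (simp add: h'_def[abs_def] H1_B[OF h])
  note G' = eventually_G[OF h h']
  obtain \<rho> where \<rho>: "\<rho> > 0" "\<forall>x. dist x (B h) < \<rho> \<longrightarrow> x $ Some p = 0 \<longrightarrow> H 1 x \<in> G \<longrightarrow> x = B (H 1 x)"
    using B_section[OF h] by blast
  have B': "\<forall>\<^sub>F \<epsilon> in ?F. B\<^sub>\<epsilon> h \<epsilon> = B (h' \<epsilon>)"
    using tendstoD[OF lim(1) \<rho>(1)] plane(1) G' by eventually_elim (use \<rho>(2) in \<open>simp add: h'_def\<close>)
  have plane': "\<forall>\<^sub>F \<epsilon> in ?F. C (h' \<epsilon>) $ None = 0" "\<forall>\<^sub>F \<epsilon> in ?F. E (h' \<epsilon>) $ Some p = 0"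
    "\<forall>\<^sub>F \<epsilon> in ?F. A (h' \<epsilon>) $ None = 0"
    by (use G' in \<open>rule eventually_mono, use C_plane E_plane A_plane in blast\<close>)+
  have det: "det (sel_cols Some (jacobian (H 2) (at (C h)))) \<noteq> 0"
    "det (sel_cols swap (jacobian (H 3) (at (E h)))) \<noteq> 0"
    "det (sel_cols Some (jacobian (H 4) (at (A h)))) \<noteq> 0"
    using transversal h by (auto simp: drop_col_sel_cols[symmetric])
  let ?M2 = "sel_cols Some (jacobian (H 3) (at (C h))) ** matrix_inv (sel_cols Some (jacobian (H 2) (at (C h))))"
  let ?M3 = "sel_cols swap (jacobian (H 4) (at (E h))) ** matrix_inv (sel_cols swap (jacobian (H 3) (at (E h))))"
  let ?M4 = "sel_cols Some (jacobian (H 1) (at (A h))) ** matrix_inv (sel_cols Some (jacobian (H 4) (at (A h))))"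
  \<comment> \<open>The perturbed point \<open>B\<^sub>\<epsilon> h \<epsilon>\<close> is
    \<open>B (h' \<epsilon>)\<close>, where \<open>H 2\<close> has the same value as at
    \<open>C (h' \<epsilon>)\<close>. The change along leg 2 is therefore already the displacement
    at its end.\<close>
  have "((\<lambda>\<epsilon>. (H 2 (C\<^sub>\<epsilon> h \<epsilon>) - H 2 (C (h' \<epsilon>))) /\<^sub>R \<epsilon>) \<longlongrightarrow> I 2 h) ?F"
  proof (rule Lim_transform_eventually[OF q2])
    show "\<forall>\<^sub>F \<epsilon> in ?F. (H 2 (C\<^sub>\<epsilon> h \<epsilon>) - H 2 (B\<^sub>\<epsilon> h \<epsilon>)) /\<^sub>R \<epsilon> = (H 2 (C\<^sub>\<epsilon> h \<epsilon>) - H 2 (C (h' \<epsilon>))) /\<^sub>R \<epsilon>"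
      using B' G' by eventually_elim (simp add: H2_C)
  qed
  from hyperplane.hyperplane_transfer[OF hyperplane_Some dom(3)[OF k(2)] mem(3)[OF k(2)] dom(3)[OF k(3)] mem(3)[OF k(3)]
      det(1) lim(2) C_tendsto[OF h h'] plane(2) plane'(1) this]
  have t3: "((\<lambda>\<epsilon>. (H 3 (C\<^sub>\<epsilon> h \<epsilon>) - H 3 (C (h' \<epsilon>))) /\<^sub>R \<epsilon>) \<longlongrightarrow> ?M2 *v I 2 h) ?F" .
  \<comment> \<open>As \<open>H 3\<close> agrees at \<open>C (h' \<epsilon>)\<close> and
    \<open>E (h' \<epsilon>)\<close>, the displacement at the end of leg 3 is the change along the
    leg plus the displacement at its start.\<close>
  have "((\<lambda>\<epsilon>. (H 3 (E\<^sub>\<epsilon> h \<epsilon>) - H 3 (E (h' \<epsilon>))) /\<^sub>R \<epsilon>) \<longlongrightarrow> I 3 h + ?M2 *v I 2 h) ?F"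
  proof (rule Lim_transform_eventually[OF tendsto_add[OF q3 t3]])
    show "\<forall>\<^sub>F \<epsilon> in ?F. (H 3 (E\<^sub>\<epsilon> h \<epsilon>) - H 3 (C\<^sub>\<epsilon> h \<epsilon>)) /\<^sub>R \<epsilon> + (H 3 (C\<^sub>\<epsilon> h \<epsilon>) - H 3 (C (h' \<epsilon>))) /\<^sub>R \<epsilon> =
        (H 3 (E\<^sub>\<epsilon> h \<epsilon>) - H 3 (E (h' \<epsilon>))) /\<^sub>R \<epsilon>"
      using G' by eventually_elim (simp add: H3_E scaleR_add_right[symmetric])
  qed
  from hyperplane.hyperplane_transfer[OF hyperplane_swap dom(3)[OF k(3)] mem(4)[OF k(3)] dom(3)[OF k(4)] mem(4)[OF k(4)]
      det(2) lim(3) E_tendsto[OF h h'] plane(3) plane'(2) this]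
  have t4: "((\<lambda>\<epsilon>. (H 4 (E\<^sub>\<epsilon> h \<epsilon>) - H 4 (E (h' \<epsilon>))) /\<^sub>R \<epsilon>) \<longlongrightarrow> ?M3 *v (I 3 h + ?M2 *v I 2 h)) ?F" .
  have "((\<lambda>\<epsilon>. (H 4 (A\<^sub>\<epsilon> h \<epsilon>) - H 4 (A (h' \<epsilon>))) /\<^sub>R \<epsilon>) \<longlongrightarrow> I 4 h + ?M3 *v (I 3 h + ?M2 *v I 2 h)) ?F"
  proof (rule Lim_transform_eventually[OF tendsto_add[OF q4 t4]])
    show "\<forall>\<^sub>F \<epsilon> in ?F. (H 4 (A\<^sub>\<epsilon> h \<epsilon>) - H 4 (E\<^sub>\<epsilon> h \<epsilon>)) /\<^sub>R \<epsilon> + (H 4 (E\<^sub>\<epsilon> h \<epsilon>) - H 4 (E (h' \<epsilon>))) /\<^sub>R \<epsilon> =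
        (H 4 (A\<^sub>\<epsilon> h \<epsilon>) - H 4 (A (h' \<epsilon>))) /\<^sub>R \<epsilon>"
      using G' by eventually_elim (simp add: H4_A scaleR_add_right[symmetric])
  qed
  from hyperplane.hyperplane_transfer[OF hyperplane_Some dom(3)[OF k(4)] mem(1)[OF k(4)] dom(3)[OF k(1)] mem(1)[OF k(1)]
      det(3) lim(4) A_tendsto[OF h h'] plane(4) plane'(3) this]
  have t1: "((\<lambda>\<epsilon>. (H 1 (A\<^sub>\<epsilon> h \<epsilon>) - H 1 (A (h' \<epsilon>))) /\<^sub>R \<epsilon>) \<longlongrightarrow> ?M4 *v (I 4 h + ?M3 *v (I 3 h + ?M2 *v I 2 h))) ?F" .
  \<comment> \<open>The two quotients telescope, since the level of \<open>A (h' \<epsilon>)\<close>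
    is \<open>h' \<epsilon>\<close>, which is that of
    \<open>B\<^sub>\<epsilon> h \<epsilon>\<close>.\<close>
  have "((\<lambda>\<epsilon>. (H 1 (A\<^sub>\<epsilon> h \<epsilon>) - H 1 (A h)) /\<^sub>R \<epsilon>) \<longlongrightarrow> I 1 h + ?M4 *v (I 4 h + ?M3 *v (I 3 h + ?M2 *v I 2 h))) ?F"
  proof (rule Lim_transform_eventually[OF tendsto_add[OF q1 t1]])
    show "\<forall>\<^sub>F \<epsilon> in ?F. (H 1 (B\<^sub>\<epsilon> h \<epsilon>) - H 1 (A h)) /\<^sub>R \<epsilon> + (H 1 (A\<^sub>\<epsilon> h \<epsilon>) - H 1 (A (h' \<epsilon>))) /\<^sub>R \<epsilon> =
        (H 1 (A\<^sub>\<epsilon> h \<epsilon>) - H 1 (A h)) /\<^sub>R \<epsilon>"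
      using G' by eventually_elim (simp add: H1_A h'_def scaleR_add_right[symmetric])
  qed
  then show ?thesis by (simp only: drop_col_sel_cols)
qed

end

section \<open>Zeros of F and closed orbits\<close>

lemma implicit_function_zeros:
  fixes F :: "'a::euclidean_space \<times> real \<Rightarrow> 'a"
  assumes F: "C1_on W F F'" "(h0, 0) \<in> W" "F (h0, 0) = 0"
    and ker: "\<And>v. blinfun_apply (F' (h0, 0)) (v, 0) = 0 \<Longrightarrow> v = 0"
  shows "\<exists>d>0. ball (h0, 0) d \<subseteq> W \<and> inj_on (\<lambda>z. (F z, snd z)) (ball (h0, 0) d)"
    and "r > 0 \<Longrightarrow> \<exists>d>0. \<forall>\<epsilon>. \<bar>\<epsilon>\<bar> < d \<longrightarrow> (\<exists>h. dist (h, \<epsilon>) (h0, 0) < r \<and> F (h, \<epsilon>) = 0)"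
proof -
  let ?i = "\<lambda>x::'a. (x, 0::real)" and ?s = "\<lambda>z::'a \<times> real. (0::'a, snd z)"
  have bl: "bounded_linear ?i" "bounded_linear ?s"
    by (intro bounded_linear_Pair bounded_linear_ident bounded_linear_zero bounded_linear_snd)+
  \<comment> \<open>Its derivative at (h0, 0) is injective because the partial derivative in h is.
    Local injectivity gives uniqueness of the zero for each \<epsilon>; openness gives existence, as
    (0, \<epsilon>) is close to the value (0, 0) at (h0, 0).\<close>
  let ?\<Phi> = "\<lambda>z. (F z, snd z)"
  let ?\<Phi>' = "\<lambda>z. (Blinfun ?i o\<^sub>L F' z) + Blinfun ?s"
  have \<Phi>'_apply: "blinfun_apply (?\<Phi>' z) v = (blinfun_apply (F' z) v, snd v)" for z v
    by (simp add: blinfun.add_left bounded_linear_Blinfun_apply[OF bl(1)] bounded_linear_Blinfun_apply[OF bl(2)])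
  have C1: "C1_on W ?\<Phi> ?\<Phi>'"
    unfolding C1_on_def
  proof (intro conjI ballI)
    show "open W" "continuous_on W ?\<Phi>'"
      using C1_onD(1,2)[OF F(1)] by (auto intro!: continuous_intros)
    fix z assume "z \<in> W"
    have "(?\<Phi> has_derivative (\<lambda>v. (blinfun_apply (F' z) v, snd v))) (at z)"
      by (intro has_derivative_Pair C1_onD(3)[OF F(1) \<open>z \<in> W\<close>] has_derivative_snd has_derivative_ident)
    then show "(?\<Phi> has_derivative blinfun_apply (?\<Phi>' z)) (at z)"
      by (rule has_derivative_eq_rhs) (simp add: fun_eq_iff \<Phi>'_apply)
  qed
  have inj: "v = 0" if "blinfun_apply (?\<Phi>' (h0, 0)) v = 0" for v
    using ker[of "fst v"] that unfolding \<Phi>'_apply by (cases v) (simp add: zero_prod_def)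
  show "\<exists>d>0. ball (h0, 0) d \<subseteq> W \<and> inj_on ?\<Phi> (ball (h0, 0) d)"
    by (rule C1_on_locally_injective[OF C1 F(2) inj]) blast+
  show "\<exists>d>0. \<forall>\<epsilon>. \<bar>\<epsilon>\<bar> < d \<longrightarrow> (\<exists>h. dist (h, \<epsilon>) (h0, 0) < r \<and> F (h, \<epsilon>) = 0)" if r: "r > 0"
  proof -
    obtain d where d: "d > 0" "ball (?\<Phi> (h0, 0)) d \<subseteq> ?\<Phi> ` ball (h0, 0) r"
      using C1_on_open_mapping[OF C1 F(2) inj r] by blast
    have "\<exists>h. dist (h, \<epsilon>) (h0, 0) < r \<and> F (h, \<epsilon>) = 0" if "\<bar>\<epsilon>\<bar> < d" for \<epsilon>
    proof -
      have "(0, \<epsilon>) \<in> ball (?\<Phi> (h0, 0)) d" using that F(3) by (simp add: dist_Pair_Pair)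
      then obtain z where z: "z \<in> ball (h0, 0) r" "(0, \<epsilon>) = ?\<Phi> z" using d(2) by blast
      then have "z = (fst z, \<epsilon>)" "F z = 0" by (auto simp: prod_eq_iff)
      then show ?thesis using z(1) by (metis dist_commute mem_ball)
    qed
    then show ?thesis using d(1) by blast
  qed
qed

context perturbed_system
begin

lemma closed_orbits_near:
  assumes h0: "h0 \<in> G"
  shows "\<exists>\<rho>>0. \<forall>h \<epsilon>. dist (h, \<epsilon>) (h0, 0) < \<rho> \<longrightarrow> 0 < \<epsilon> \<longrightarrow> (h, \<epsilon>) \<in> V \<and>
    (H 1 (A\<^sub>\<epsilon> h \<epsilon>) = H 1 (A h) \<longrightarrow> A\<^sub>\<epsilon> h \<epsilon> = A h) \<and>
    (A\<^sub>\<epsilon> h \<epsilon> = A h \<longrightarrow> closed_orbit_through p f g \<epsilon> (A h))"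
proof -
  \<comment> \<open>Limits for each fixed h would give a bound on \<epsilon> that depends on h; the
    joint filter yields one \<rho> for all h near \<open>h0\<close>.\<close>
  let ?F = "at (h0, 0::real) within {z. 0 < snd z}"
  have lim: "(fst \<longlongrightarrow> h0) ?F" "(snd \<longlongrightarrow> 0) ?F"
    using tendsto_fst[OF tendsto_ident_at[of "(h0, 0::real)"]] tendsto_snd[OF tendsto_ident_at[of "(h0, 0::real)"]] by auto
  have "\<forall>\<^sub>F z in ?F. z \<in> V" using V h0 by (intro topological_tendstoD[OF tendsto_ident_at]) auto
  then have inV: "\<forall>\<^sub>F z in ?F. (fst z, snd z) \<in> V \<and> 0 \<le> snd z"
    unfolding eventually_at_filter by eventually_elim auto
  note L = perturbed_limits[OF h0 lim inV]
  note R = perturbed_reaches_region[OF h0 lim inV]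
  have k: "1 \<in> {1..4::nat}" by auto
  have Ad: "A h0 \<in> dom 1" using dom(2)[OF k h0] by blast
  have "det (sel_cols Some (jacobian (H 1) (at (A h0)))) \<noteq> 0"
    using bspec[OF bspec[OF transversal h0] k] by (simp add: drop_col_sel_cols)
  from hyperplane.hyperplane_inj[OF hyperplane_Some dom(3)[OF k] Ad this]
  obtain r where r: "r > 0" "\<And>x y. dist x (A h0) < r \<Longrightarrow> dist y (A h0) < r \<Longrightarrow> x $ None = 0 \<Longrightarrow> y $ None = 0 \<Longrightarrow>
      H 1 x = H 1 y \<Longrightarrow> x = y" by blast
  define good where "good h \<epsilon> \<longleftrightarrow> (h, \<epsilon>) \<in> V \<and> (H 1 (A\<^sub>\<epsilon> h \<epsilon>) = H 1 (A h) \<longrightarrow> A\<^sub>\<epsilon> h \<epsilon> = A h) \<and>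
    (A\<^sub>\<epsilon> h \<epsilon> = A h \<longrightarrow> closed_orbit_through p f g \<epsilon> (A h))" for h \<epsilon>
  have "\<forall>\<^sub>F z in ?F. good (fst z) (snd z)"
    using inV tendstoD[OF L(4) r(1)] tendstoD[OF A_tendsto[OF h0 lim(1)] r(1)] R
  proof eventually_elim
    case (elim z)
    obtain h \<epsilon> where z: "z = (h, \<epsilon>)" by (cases z)
    have "h \<in> G" using elim(1) V(2) z by auto
    have "A\<^sub>\<epsilon> h \<epsilon> = A h" if "H 1 (A\<^sub>\<epsilon> h \<epsilon>) = H 1 (A h)"
      using elim(2,3) that perturbed_reaches(8)[of h \<epsilon>] elim(1) A_plane \<open>h \<in> G\<close> by (intro r(2)) (auto simp: z)
    moreover have "closed_orbit_through p f g \<epsilon> (A h)" if "A\<^sub>\<epsilon> h \<epsilon> = A h"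
    proof -
      define P where "P = (\<lambda>k::nat. if k = 0 then A h else if k = 1 then B\<^sub>\<epsilon> h \<epsilon> else if k = 2 then C\<^sub>\<epsilon> h \<epsilon>
        else if k = 3 then E\<^sub>\<epsilon> h \<epsilon> else A\<^sub>\<epsilon> h \<epsilon>)"
      have "closed_orbit_through p f g \<epsilon> (P 0)"
      proof (rule closed_orbit_through_reaches)
        fix k :: nat assume "k \<in> {1..4}"
        then consider "k = 1" | "k = 2" | "k = 3" | "k = 4" by force
        then show "reaches (f k) (g k) (if odd k then Some p else None) (if odd k then None else Some p) (region p k) \<epsilon>
            (P (k - 1)) (P k)"
          by cases (use elim(4-7) in \<open>simp_all add: P_def z\<close>)
      qed (simp add: P_def that)
      then show ?thesis by (simp add: P_def)
    qed
    ultimately show ?case using elim(1) by (simp add: z good_def)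
  qed
  then obtain \<rho> where \<rho>: "\<rho> > 0"
    "\<forall>z\<in>{z. 0 < snd z}. z \<noteq> (h0, 0) \<and> dist z (h0, 0) < \<rho> \<longrightarrow> good (fst z) (snd z)"
    unfolding eventually_at by blast
  have "good h \<epsilon>" if "dist (h, \<epsilon>) (h0, 0) < \<rho>" "0 < \<epsilon>" for h \<epsilon>
    using bspec[OF \<rho>(2), of "(h, \<epsilon>)"] that by simp
  then have "\<forall>h \<epsilon>. dist (h, \<epsilon>) (h0, 0) < \<rho> \<longrightarrow> 0 < \<epsilon> \<longrightarrow> good h \<epsilon>" by simp
  then show ?thesis unfolding good_def using \<rho>(1) by (intro exI[of _ \<rho>] conjI)
qed

text \<open>The quantifiers express more than uniqueness in one neighbourhood:
  \<open>r\<^sub>0\<close> is independent of \<epsilon>, and since every smaller \<open>r\<close> is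
  allowed, the unique zero tends to \<open>h0\<close> with \<epsilon>.\<close>

lemma unique_closed_orbit:
  fixes F :: "(real ^ 'm) \<times> real \<Rightarrow> real ^ 'm"
  assumes F_eq: "\<forall>h \<epsilon>. (h, \<epsilon>) \<in> V \<and> \<epsilon> \<ge> 0 \<longrightarrow> H 1 (A\<^sub>\<epsilon> h \<epsilon>) - H 1 (A h) = \<epsilon> *\<^sub>R F (h, \<epsilon>)"
    and F_smooth: "smooth_on {z \<in> V. snd z \<ge> 0} F"
    and M: "\<forall>h\<in>G. M h = F (h, 0)"
    and h0: "h0 \<in> G" "M h0 = 0" "det (jacobian M (at h0)) \<noteq> 0"
  shows "\<exists>r\<^sub>0>0. \<forall>r. 0 < r \<and> r \<le> r\<^sub>0 \<longrightarrow>
              (\<exists>\<epsilon>\<^sub>0>0. ball h0 r \<times> {0<..<\<epsilon>\<^sub>0} \<subseteq> V \<and>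
                (\<forall>\<epsilon>. 0 < \<epsilon> \<and> \<epsilon> < \<epsilon>\<^sub>0 \<longrightarrow>
                  (\<exists>!h. h \<in> ball h0 r \<and> A\<^sub>\<epsilon> h \<epsilon> = A h) \<and>
                  (\<forall>h\<in>ball h0 r. A\<^sub>\<epsilon> h \<epsilon> = A h \<longrightarrow> closed_orbit_through p f g \<epsilon> (A h))))"
proof -
  let ?S = "{z \<in> V. snd z \<ge> 0}"
  obtain W K K' where W: "?S \<subseteq> W" and K: "C1_on W K K'" and KF: "\<And>z. z \<in> ?S \<Longrightarrow> K z = F z"
    using smooth_on_imp_C1_extension[OF F_smooth] by blast
  have G0: "(h, 0) \<in> ?S" if "h \<in> G" for h using V(3) that by auto
  have h0W: "(h0, 0) \<in> W" "K (h0, 0) = 0" using G0[OF h0(1)] W KF M h0 by auto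
  have "((\<lambda>h. (h, 0::real)) has_derivative (\<lambda>v. (v, 0))) (at h0)"
    by (intro has_derivative_Pair has_derivative_ident has_derivative_const)
  from has_derivative_compose[OF this C1_onD(3)[OF K h0W(1)]]
  have "((\<lambda>h. K (h, 0)) has_derivative (\<lambda>v. blinfun_apply (K' (h0, 0)) (v, 0))) (at h0)" .
  \<comment> \<open>On the open set \<open>G\<close> the function \<open>M\<close> coincides with
    the extension \<open>K\<close> at \<epsilon> = 0, so its derivative is the partial derivative of
    \<open>K\<close> in h.\<close>
  then have dM: "(M has_derivative (\<lambda>v. blinfun_apply (K' (h0, 0)) (v, 0))) (at h0)"
    by (rule has_derivative_transform_within_open[OF _ open_G h0(1)]) (use M KF G0 in auto)
  have jac: "jacobian M (at h0) *v v = blinfun_apply (K' (h0, 0)) (v, 0)" for v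
    unfolding jacobian_def frechet_derivative_at[OF dM, symmetric]
    using has_derivative_linear[OF dM] by (simp add: matrix_works)
  have ker: "v = 0" if "blinfun_apply (K' (h0, 0)) (v, 0) = 0" for v
  proof -
    have "inj ((*v) (jacobian M (at h0)))"
      using h0(3) inj_matrix_vector_mult[of "jacobian M (at h0)"] by (simp add: invertible_det_nz)
    from injD[OF this, of v 0] show ?thesis using that by (simp add: jac)
  qed
  note Z = implicit_function_zeros[OF K h0W ker]
  obtain d where d: "d > 0" "inj_on (\<lambda>z. (K z, snd z)) (ball (h0, 0) d)" using Z(1) by blast
  obtain \<rho> where \<rho>: "\<rho> > 0" "\<And>h \<epsilon>. dist (h, \<epsilon>) (h0, 0) < \<rho> \<Longrightarrow> 0 < \<epsilon> \<Longrightarrow> (h, \<epsilon>) \<in> V \<and>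
    (H 1 (A\<^sub>\<epsilon> h \<epsilon>) = H 1 (A h) \<longrightarrow> A\<^sub>\<epsilon> h \<epsilon> = A h) \<and>
    (A\<^sub>\<epsilon> h \<epsilon> = A h \<longrightarrow> closed_orbit_through p f g \<epsilon> (A h))"
    using closed_orbits_near[OF h0(1)] by blast
  \<comment> \<open>Points with h in \<open>ball h0 r\<close> and 0 < \<epsilon> < r0 are then
    within \<open>2 * r0\<close> of (h0, 0), where both the injectivity radius \<open>d\<close> and
    the radius \<rho> of \<open>closed_orbits_near\<close> apply.\<close>
  define r0 where "r0 = min d \<rho> / 2"
  have r0: "r0 > 0" "2 * r0 \<le> d" "2 * r0 \<le> \<rho>" using d(1) \<rho>(1) by (auto simp: r0_def)
  show ?thesis
  proof (rule exI[of _ r0], intro conjI allI impI)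
    fix r assume r: "0 < r \<and> r \<le> r0"
    obtain e where e: "e > 0" "\<And>\<epsilon>. \<bar>\<epsilon>\<bar> < e \<Longrightarrow> \<exists>h. dist (h, \<epsilon>) (h0, 0) < r \<and> K (h, \<epsilon>) = 0"
      using Z(2)[of r] r by blast
    have near: "dist (h, \<epsilon>) (h0, 0) < 2 * r0" if "h \<in> ball h0 r" "0 < \<epsilon>" "\<epsilon> < min e r0" for h \<epsilon>
    proof -
      have "dist (h, \<epsilon>) (h0, 0) \<le> dist h h0 + \<bar>\<epsilon>\<bar>"
        using sqrt_sum_squares_le_sum_abs[of "dist h h0" "\<bar>\<epsilon>\<bar>"] by (simp add: dist_Pair_Pair dist_real_def)
      then show ?thesis using that r by (simp add: dist_commute)
    qed
    \<comment> \<open>As \<epsilon> is positive, a zero of \<open>K\<close> means equal levels of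
      \<open>H 1\<close>, and near \<open>A h0\<close> on the plane the level determines the
      point.\<close>
    have zero_iff: "A\<^sub>\<epsilon> h \<epsilon> = A h \<longleftrightarrow> K (h, \<epsilon>) = 0" if "h \<in> ball h0 r" "0 < \<epsilon>" "\<epsilon> < min e r0" for h \<epsilon>
    proof -
      have V': "(h, \<epsilon>) \<in> V" and *: "H 1 (A\<^sub>\<epsilon> h \<epsilon>) = H 1 (A h) \<longrightarrow> A\<^sub>\<epsilon> h \<epsilon> = A h"
        using \<rho>(2)[of h \<epsilon>] near[OF that] r0(3) that(2) by auto
      have "K (h, \<epsilon>) = F (h, \<epsilon>)" using KF V' that by auto
      moreover have "H 1 (A\<^sub>\<epsilon> h \<epsilon>) - H 1 (A h) = \<epsilon> *\<^sub>R F (h, \<epsilon>)" using F_eq V' that by auto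
      ultimately show ?thesis using * that(2) by auto
    qed
    show "\<exists>\<epsilon>\<^sub>0>0. ball h0 r \<times> {0<..<\<epsilon>\<^sub>0} \<subseteq> V \<and>
                (\<forall>\<epsilon>. 0 < \<epsilon> \<and> \<epsilon> < \<epsilon>\<^sub>0 \<longrightarrow>
                  (\<exists>!h. h \<in> ball h0 r \<and> A\<^sub>\<epsilon> h \<epsilon> = A h) \<and>
                  (\<forall>h\<in>ball h0 r. A\<^sub>\<epsilon> h \<epsilon> = A h \<longrightarrow> closed_orbit_through p f g \<epsilon> (A h)))"
    proof (rule exI[of _ "min e r0"], intro conjI allI impI)
      show "ball h0 r \<times> {0<..<min e r0} \<subseteq> V"
        using \<rho>(2) near r0(3) by fastforce
      fix \<epsilon> assume \<epsilon>: "0 < \<epsilon> \<and> \<epsilon> < min e r0"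
      then obtain h where h: "dist (h, \<epsilon>) (h0, 0) < r" "K (h, \<epsilon>) = 0" using e(2)[of \<epsilon>] by auto
      have hr: "h \<in> ball h0 r" using dist_fst_le[of "(h, \<epsilon>)" "(h0, 0)"] h(1) by (simp add: dist_commute)
      show "\<exists>!h. h \<in> ball h0 r \<and> A\<^sub>\<epsilon> h \<epsilon> = A h"
      proof (rule ex1I[of _ h])
        show "h \<in> ball h0 r \<and> A\<^sub>\<epsilon> h \<epsilon> = A h" using hr zero_iff[OF hr] h(2) \<epsilon> by auto
        fix k assume k: "k \<in> ball h0 r \<and> A\<^sub>\<epsilon> k \<epsilon> = A k"
        then have "K (k, \<epsilon>) = 0" using zero_iff[of k \<epsilon>] \<epsilon> by auto
        moreover have "(k, \<epsilon>) \<in> ball (h0, 0) d" "(h, \<epsilon>) \<in> ball (h0, 0) d"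
          using near[of k \<epsilon>] near[OF hr, of \<epsilon>] k \<epsilon> r0(2) by (auto simp: dist_commute)
        ultimately show "k = h" using inj_onD[OF d(2), of "(k, \<epsilon>)" "(h, \<epsilon>)"] h(2) by auto
      qed
      show "\<forall>h\<in>ball h0 r. A\<^sub>\<epsilon> h \<epsilon> = A h \<longrightarrow> closed_orbit_through p f g \<epsilon> (A h)"
        using \<rho>(2) near \<epsilon> r0(3) by (meson less_le_trans)
    qed (use e(1) r0(1) in auto)
  qed (use r0(1) in auto)
qed

text \<open>At \<epsilon> = 0 the equation \<open>F_eq\<close> does not determine \<open>F\<close>.
  The value is the limit of the quotients for positive \<epsilon>, by continuity of the extension
  \<open>K\<close>.\<close>

lemma melnikov_formula:
  fixes F :: "(real ^ 'm) \<times> real \<Rightarrow> real ^ 'm"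
  assumes F_eq: "\<forall>h \<epsilon>. (h, \<epsilon>) \<in> V \<and> \<epsilon> \<ge> 0 \<longrightarrow> H 1 (A\<^sub>\<epsilon> h \<epsilon>) - H 1 (A h) = \<epsilon> *\<^sub>R F (h, \<epsilon>)"
    and F_smooth: "smooth_on {z \<in> V. snd z \<ge> 0} F"
    and h: "h \<in> G"
  shows "F (h, 0) =
     I 1 h + (drop_col1 (jacobian (H 1) (at (A h))) ** matrix_inv (drop_col1 (jacobian (H 4) (at (A h))))) *v
      (I 4 h + (drop_col2 p (jacobian (H 4) (at (E h))) ** matrix_inv (drop_col2 p (jacobian (H 3) (at (E h))))) *v
       (I 3 h + (drop_col1 (jacobian (H 3) (at (C h))) ** matrix_inv (drop_col1 (jacobian (H 2) (at (C h))))) *v I 2 h))"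
proof -
  let ?S = "{z \<in> V. snd z \<ge> 0}" and ?F = "at_right (0::real)"
  obtain W K K' where W: "?S \<subseteq> W" and K: "C1_on W K K'" and KF: "\<And>z. z \<in> ?S \<Longrightarrow> K z = F z"
    using smooth_on_imp_C1_extension[OF F_smooth] by blast
  have h0: "(h, 0) \<in> ?S" using V(3) h by auto
  have lim: "((\<lambda>\<epsilon>. (h, \<epsilon>)) \<longlongrightarrow> (h, 0)) ?F" by (intro tendsto_Pair tendsto_const tendsto_ident_at)
  have "isCont K (h, 0)" using C1_onD(3)[OF K] h0 W has_derivative_continuous by blast
  from isCont_tendsto_compose[OF this lim] have "((\<lambda>\<epsilon>. K (h, \<epsilon>)) \<longlongrightarrow> F (h, 0)) ?F" using KF[OF h0] by simp
  moreover have "\<forall>\<^sub>F \<epsilon> in ?F. (h, \<epsilon>) \<in> V" using V(1) h0 lim by (intro topological_tendstoD) auto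
  then have "\<forall>\<^sub>F \<epsilon> in ?F. K (h, \<epsilon>) = (H 1 (A\<^sub>\<epsilon> h \<epsilon>) - H 1 (A h)) /\<^sub>R \<epsilon>"
    using eventually_at_right_less[of "0::real"] by eventually_elim (use KF F_eq in auto)
  ultimately have "((\<lambda>\<epsilon>. (H 1 (A\<^sub>\<epsilon> h \<epsilon>) - H 1 (A h)) /\<^sub>R \<epsilon>) \<longlongrightarrow> F (h, 0)) ?F"
    by (rule Lim_transform_eventually)
  then show ?thesis using melnikov_limit[OF h] tendsto_unique trivial_limit_at_right_real by blast
qed

end

theorem theorem1p1:
  fixes p :: "'m::finite"
    and f g :: "nat \<Rightarrow> real ^ ('m option) \<Rightarrow> real ^ ('m option)"
    and H :: "nat \<Rightarrow> real ^ ('m option) \<Rightarrow> real ^ 'm"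
    and U :: "(real ^ ('m option)) set"
    and G :: "(real ^ 'm) set"
    and A B C E :: "real ^ 'm \<Rightarrow> real ^ ('m option)"
    and T :: "nat \<Rightarrow> real ^ 'm \<Rightarrow> real"
    and \<phi> :: "nat \<Rightarrow> real ^ 'm \<Rightarrow> real \<Rightarrow> real ^ ('m option)"
    and V :: "((real ^ 'm) \<times> real) set"
    and A\<^sub>\<epsilon> B\<^sub>\<epsilon> C\<^sub>\<epsilon> E\<^sub>\<epsilon> :: "real ^ 'm \<Rightarrow> real \<Rightarrow> real ^ ('m option)"
    and F :: "(real ^ 'm) \<times> real \<Rightarrow> real ^ 'm"
    and M :: "real ^ 'm \<Rightarrow> real ^ 'm"
  assumes smooth_fields: "\<forall>k\<in>{1..4}. smooth_on UNIV (f k) \<and> smooth_on UNIV (g k)"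
    \<comment> \<open>(A1)\<close>
    and A1_U: "open U" "\<exists>x\<in>U. x $ None = 0 \<and> x $ Some p = 0"
    and A1_smooth: "\<forall>k\<in>{1..4}. \<exists>W. open W \<and> U \<inter> region p k \<subseteq> W \<and>
          (\<forall>h\<in>G. {A h, B h, C h, E h} \<subseteq> W) \<and> smooth_on W (H k)"
    and A1_first_integrals: "\<forall>k\<in>{1..4}. \<forall>x\<in>U \<inter> region p k. jacobian (H k) (at x) *v f k x = 0"
    and A1_independent: "\<forall>k\<in>{1..4}. \<forall>x\<in>U \<inter> region p k.
          inj (\<lambda>j. row j (jacobian (H k) (at x))) \<and> independent (rows (jacobian (H k) (at x)))"
    \<comment> \<open>(A2)\<close>
    and A2_G: "open G"
    and A2_in_U: "\<forall>h\<in>G. {A h, B h, C h, E h} \<subseteq> U \<and> distinct [A h, B h, C h, E h]"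
    and A2_A: "\<forall>h\<in>G. A h $ None = 0 \<and> A h $ Some p > 0"
    and A2_B: "\<forall>h\<in>G. B h $ None > 0 \<and> B h $ Some p = 0"
    and A2_C: "\<forall>h\<in>G. C h $ None = 0 \<and> C h $ Some p < 0"
    and A2_E: "\<forall>h\<in>G. E h $ None < 0 \<and> E h $ Some p = 0"
    and A2_arc1: "\<forall>h\<in>G. orbital_arc (f 1) (A h) (B h)
          {x \<in> U \<inter> region p 1. H 1 x = h} (T 1 h) (\<phi> 1 h)"
    and A2_arc2: "\<forall>h\<in>G. orbital_arc (f 2) (B h) (C h)
          {x \<in> U \<inter> region p 2. H 2 x = H 2 (B h)} (T 2 h) (\<phi> 2 h)"
    and A2_arc3: "\<forall>h\<in>G. orbital_arc (f 3) (C h) (E h)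
          {x \<in> U \<inter> region p 3. H 3 x = H 3 (C h)} (T 3 h) (\<phi> 3 h)"
    and A2_arc4: "\<forall>h\<in>G. orbital_arc (f 4) (E h) (A h)
          {x \<in> U \<inter> region p 4. H 4 x = H 4 (E h)} (T 4 h) (\<phi> 4 h)"
    and A2_no_critical: "\<forall>h\<in>G. \<forall>k\<in>{1..4}. \<forall>t\<in>{0..T k h}. f k (\<phi> k h t) \<noteq> 0"
    \<comment> \<open>(A3)\<close>
    and A3: "\<forall>h\<in>G. \<forall>k\<in>{1..4}.
          det (drop_col1 (jacobian (H k) (at (A h)))) \<noteq> 0 \<and>
          det (drop_col1 (jacobian (H k) (at (C h)))) \<noteq> 0 \<and>
          det (drop_col2 p (jacobian (H k) (at (B h)))) \<noteq> 0 \<and>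
          det (drop_col2 p (jacobian (H k) (at (E h)))) \<noteq> 0"
    \<comment> \<open>the perturbed intersection points, for \<open>h \<in> G\<close> and small \<open>\<epsilon> \<ge> 0\<close>, and the function \<open>F\<close>\<close>
    and V: "open V" "V \<subseteq> G \<times> UNIV" "G \<times> {0} \<subseteq> V"
    and B\<^sub>\<epsilon>: "\<forall>h \<epsilon>. (h, \<epsilon>) \<in> V \<and> \<epsilon> \<ge> 0 \<longrightarrow>
          first_intersection (subsystem f g \<epsilon> 1) (Some p) (A h) (B\<^sub>\<epsilon> h \<epsilon>)"
    and C\<^sub>\<epsilon>: "\<forall>h \<epsilon>. (h, \<epsilon>) \<in> V \<and> \<epsilon> \<ge> 0 \<longrightarrow>
          first_intersection (subsystem f g \<epsilon> 2) None (B\<^sub>\<epsilon> h \<epsilon>) (C\<^sub>\<epsilon> h \<epsilon>)"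
    and E\<^sub>\<epsilon>: "\<forall>h \<epsilon>. (h, \<epsilon>) \<in> V \<and> \<epsilon> \<ge> 0 \<longrightarrow>
          first_intersection (subsystem f g \<epsilon> 3) (Some p) (C\<^sub>\<epsilon> h \<epsilon>) (E\<^sub>\<epsilon> h \<epsilon>)"
    and A\<^sub>\<epsilon>: "\<forall>h \<epsilon>. (h, \<epsilon>) \<in> V \<and> \<epsilon> \<ge> 0 \<longrightarrow>
          first_intersection (subsystem f g \<epsilon> 4) None (E\<^sub>\<epsilon> h \<epsilon>) (A\<^sub>\<epsilon> h \<epsilon>)"
    and F_eq: "\<forall>h \<epsilon>. (h, \<epsilon>) \<in> V \<and> \<epsilon> \<ge> 0 \<longrightarrow>
          H 1 (A\<^sub>\<epsilon> h \<epsilon>) - H 1 (A h) = \<epsilon> *\<^sub>R F (h, \<epsilon>)"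
    and F_smooth: "smooth_on {z \<in> V. snd z \<ge> 0} F"
    and M: "\<forall>h\<in>G. M h = F (h, 0)"
  shows "(\<forall>h\<in>G. M h =
            integral {0..T 1 h} (\<lambda>t. jacobian (H 1) (at (\<phi> 1 h t)) *v g 1 (\<phi> 1 h t))
          + (drop_col1 (jacobian (H 1) (at (A h))) ** matrix_inv (drop_col1 (jacobian (H 4) (at (A h))))
             ** drop_col2 p (jacobian (H 4) (at (E h))) ** matrix_inv (drop_col2 p (jacobian (H 3) (at (E h))))
             ** drop_col1 (jacobian (H 3) (at (C h))) ** matrix_inv (drop_col1 (jacobian (H 2) (at (C h)))))
            *v integral {0..T 2 h} (\<lambda>t. jacobian (H 2) (at (\<phi> 2 h t)) *v g 2 (\<phi> 2 h t))
          + (drop_col1 (jacobian (H 1) (at (A h))) ** matrix_inv (drop_col1 (jacobian (H 4) (at (A h))))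
             ** drop_col2 p (jacobian (H 4) (at (E h))) ** matrix_inv (drop_col2 p (jacobian (H 3) (at (E h)))))
            *v integral {0..T 3 h} (\<lambda>t. jacobian (H 3) (at (\<phi> 3 h t)) *v g 3 (\<phi> 3 h t))
          + (drop_col1 (jacobian (H 1) (at (A h))) ** matrix_inv (drop_col1 (jacobian (H 4) (at (A h)))))
            *v integral {0..T 4 h} (\<lambda>t. jacobian (H 4) (at (\<phi> 4 h t)) *v g 4 (\<phi> 4 h t)))
       \<and> (\<forall>h\<^sub>0\<in>G. M h\<^sub>0 = 0 \<and> det (jacobian M (at h\<^sub>0)) \<noteq> 0 \<longrightarrow>
            (\<exists>r\<^sub>0>0. \<forall>r. 0 < r \<and> r \<le> r\<^sub>0 \<longrightarrow>
              (\<exists>\<epsilon>\<^sub>0>0. ball h\<^sub>0 r \<times> {0<..<\<epsilon>\<^sub>0} \<subseteq> V \<and>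
                (\<forall>\<epsilon>. 0 < \<epsilon> \<and> \<epsilon> < \<epsilon>\<^sub>0 \<longrightarrow>
                  (\<exists>!h. h \<in> ball h\<^sub>0 r \<and> A\<^sub>\<epsilon> h \<epsilon> = A h) \<and>
                  (\<forall>h\<in>ball h\<^sub>0 r. A\<^sub>\<epsilon> h \<epsilon> = A h \<longrightarrow> closed_orbit_through p f g \<epsilon> (A h))))))"
proof -
  interpret perturbed_system p f g H U G A B C E T \<phi> V A\<^sub>\<epsilon> B\<^sub>\<epsilon> C\<^sub>\<epsilon> E\<^sub>\<epsilon>
  proof unfold_locales
    show "\<forall>h\<in>G. {A h, B h, C h, E h} \<subseteq> U" using A2_in_U by blast
  qed (rule smooth_fields A1_U(1) A1_smooth A1_first_integrals A1_independent A2_G A2_A A2_B A2_C A2_E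
      A2_arc1 A2_arc2 A2_arc3 A2_arc4 A2_no_critical A3 V B\<^sub>\<epsilon> C\<^sub>\<epsilon> E\<^sub>\<epsilon> A\<^sub>\<epsilon>)+
  show ?thesis
  proof (rule conjI; rule ballI)
    fix h assume h: "h \<in> G"
    then have "M h = F (h, 0)" using M by blast
    then show "M h =
            integral {0..T 1 h} (\<lambda>t. jacobian (H 1) (at (\<phi> 1 h t)) *v g 1 (\<phi> 1 h t))
          + (drop_col1 (jacobian (H 1) (at (A h))) ** matrix_inv (drop_col1 (jacobian (H 4) (at (A h))))
             ** drop_col2 p (jacobian (H 4) (at (E h))) ** matrix_inv (drop_col2 p (jacobian (H 3) (at (E h))))
             ** drop_col1 (jacobian (H 3) (at (C h))) ** matrix_inv (drop_col1 (jacobian (H 2) (at (C h)))))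
            *v integral {0..T 2 h} (\<lambda>t. jacobian (H 2) (at (\<phi> 2 h t)) *v g 2 (\<phi> 2 h t))
          + (drop_col1 (jacobian (H 1) (at (A h))) ** matrix_inv (drop_col1 (jacobian (H 4) (at (A h))))
             ** drop_col2 p (jacobian (H 4) (at (E h))) ** matrix_inv (drop_col2 p (jacobian (H 3) (at (E h)))))
            *v integral {0..T 3 h} (\<lambda>t. jacobian (H 3) (at (\<phi> 3 h t)) *v g 3 (\<phi> 3 h t))
          + (drop_col1 (jacobian (H 1) (at (A h))) ** matrix_inv (drop_col1 (jacobian (H 4) (at (A h)))))
            *v integral {0..T 4 h} (\<lambda>t. jacobian (H 4) (at (\<phi> 4 h t)) *v g 4 (\<phi> 4 h t))"
      \<comment> \<open>The nested form, with one pair of matrices per switching plane, is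
        multiplied out.\<close>
      unfolding melnikov_formula[OF F_eq F_smooth h]
      by (simp add: matrix_vector_right_distrib matrix_vector_mul_assoc matrix_mul_assoc)
  next
    fix h\<^sub>0 assume "h\<^sub>0 \<in> G"
    then show "M h\<^sub>0 = 0 \<and> det (jacobian M (at h\<^sub>0)) \<noteq> 0 \<longrightarrow>
            (\<exists>r\<^sub>0>0. \<forall>r. 0 < r \<and> r \<le> r\<^sub>0 \<longrightarrow>
              (\<exists>\<epsilon>\<^sub>0>0. ball h\<^sub>0 r \<times> {0<..<\<epsilon>\<^sub>0} \<subseteq> V \<and>
                (\<forall>\<epsilon>. 0 < \<epsilon> \<and> \<epsilon> < \<epsilon>\<^sub>0 \<longrightarrow>
                  (\<exists>!h. h \<in> ball h\<^sub>0 r \<and> A\<^sub>\<epsilon> h \<epsilon> = A h) \<and>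
                  (\<forall>h\<in>ball h\<^sub>0 r. A\<^sub>\<epsilon> h \<epsilon> = A h \<longrightarrow> closed_orbit_through p f g \<epsilon> (A h)))))"
      using unique_closed_orbit[OF F_eq F_smooth M] by blast
  qed
qed


end
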